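(* Let $\mathbb{L}=\{\mathbb{I}_\lambda\}_{\lambda\in\Lambda}$ be a family of iterated function systems of contracting similarities on $\mathbb{R}^d$ that satisfies the uniform open set condition and the uniform bounds $2\le\mathcal{N}=\sup_\lambda\mathcal{N}_\lambda<\infty$ and $0<c_{\min}\le c_\lambda^i\le c_{\max}<1$ for all $\lambda\in\Lambda$, $1\le i\le\mathcal{N}_\lambda$. Let $\mathbb{P}$ be a code-tree measure, and assume that the associated random code-tree attractor $F_\tau$ is not almost deterministic. Let $h$ be any gauge function. Then \[ \mathbb{P}\{\tau\in\mathcal{T} \mid \mathscr{H}^h(F_\tau)\in\{0,\infty\}\}=1 . \] In particular, there does not exist a gauge function $h$ with $0<\mathscr{H}^h(F_\tau)<\infty$ almost surely.
   Context: **Iterated function systems.** $\Lambda\subset\mathbb{R}^k$ is a non-empty compact set. For each $\lambda\in\Lambda$, $\mathbb{I}_\lambda=\{f_\lambda^1,\dots,f_\lambda^{\mathcal{N}_\lambda}\}$ with $\mathcal{N}_\lambda\in\mathbb{N}$, $\mathcal{N}_\lambda\ge1$, where $|f_\lambda^i(x)-f_\lambda^i(y)|=c_\lambda^i|x-y|$ for all $x,y\in\mathbb{R}^d$. The dependence on $\lambda$ is understood to be measurable, and there is a compact set $\Delta\subset\mathbb{R}^d$ with $f_\lambda^i(\Delta)\subseteq\Delta$ for all $\lambda,i$. **Uniform open set condition (UOSC).** There is a non-empty bounded open set $\mathcal{O}\subset\mathbb{R}^d$ with $f_\lambda^i(\mathcal{O})\subseteq\mathcal{O}$ and $f_\lambda^i(\mathcal{O})\cap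 f_\lambda^j(\mathcal{O})=\varnothing$ for all $\lambda\in\Lambda$ and $1\le i,j\le\mathcal{N}_\lambda$, $i\ne j$. **Code-trees.** Let $\Sigma_k=\{1,\dots,\mathcal{N}\}^k$, where $\Sigma_0$ contains only the root, and $\Sigma^*=\bigcup_{k\ge0}\Sigma_k$, the rooted $\mathcal{N}$-ary tree. $\mathcal{T}$ is the set of all labellings $\tau:\Sigma^*\to\Lambda$ with the product topology. For $v\in\Sigma^*$, $\sigma^v\tau\in\mathcal{T}$ is the labelled subtree at $v$, i.e. $(\sigma^v\tau)(w)=\tau(vw)$. A node $v=(v_1,\dots,v_k)$ is *alive* for $\tau$ if $v_j\le\mathcal{N}_{\tau((v_1,\dots,v_{j-1}))}$ for all $1\le j\le k$. To an alive node $v$ at level $k$ one associates the word (coding) $e=\mathbf{T}_\tau(v)=e_1\cdots e_k$, whose $j$-th letter stands for the map $f_{e_j}=f_{\tau((v_1,\dots,v_{j-1}))}^{v_j}$. Put $f_e=f_{e_1}\circ\dots\circ f_{e_k}$ and let $c_e$ be the contraction ratio of $f_e$, the product of the ratios of the $f_{e_j}$. $\mathbf{T}_\tau^k$ is the collection of codings of all alive nodes at level $k$ (indexed by the alive nodes). The attractor is \[F_\tau=\bigcap_{k=1}^\infty\bigcup_{e\in\mathbf{T}_\tau^k}f_e(\Delta).\] **Necks.** A strictly increasing sequence $\mathbf{N}=(N_1,N_2,\dots)\in\mathbb{N}^{\mathbb{N}}$ is a *neck list* for $\tau$ if for every $k$ one has $\sigma^v\tau=\sigma^w\tau$ for all alive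 $v,w\in\Sigma_{N_k}$. The *neck shift* is \[\Pi(\tau,\mathbf{N})=(\sigma^{1_{N_1}}\tau,(N_2-N_1,N_3-N_1,\dots)),\] where $1_{N_1}=(1,\dots,1)\in\Sigma_{N_1}$. **Code-tree measure.** A code-tree measure $\mathbb{P}$ is a Borel probability measure on $\mathcal{T}\times\mathbb{N}^{\mathbb{N}}$ (product topology), carried by pairs $(\tau,\mathbf{N})$ such that $\mathbf{N}$ is a neck list for $\tau$, such that: (i) $\mathbb{P}$ is $\Pi$-invariant; (ii) $\mathbb{E}(N_1)<\infty$; (iii) neck blocks are independent: the first block, consisting of $N_1$ and the restriction of $\tau$ to $\bigcup_{j=0}^{N_1-1}\Sigma_j$, is independent of $\Pi(\tau,\mathbf{N})$. Events about $\tau$ are read as events about $(\tau,\mathbf{N})$. Consequently $\dim_H F_\tau$ is almost surely equal to a constant $s$. **Almost deterministic.** The random code-tree fractal is *almost deterministic* if $\mathbb{P}\{\sum_{e\in\mathbf{T}_\tau^{N_1}}(c_e)^s=1\}=1$, where $s$ is the almost sure Hausdorff dimension of $F_\tau$. **Gauge functions.** A gauge function is a left-continuous, non-decreasing $h:[0,\infty)\to[0,\infty)$ with $h(r)\to0$ as $r\to0$. The $h$-Hausdorff measure is $\mathscr{H}^h(F)=\lim_{\delta\to0}\inf\{\sum_i h(|U_i|) : \{U_i\}$ a countable cover of $F$ by sets of diameter $|U_i|\le\delta\}$. *)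

theory Defs
  imports "HOL-Probability.Probability"
begin

definition gauge_function :: "(real \<Rightarrow> real) \<Rightarrow> bool" where
  "gauge_function h \<longleftrightarrow>
     (\<forall>r\<ge>0. 0 \<le> h r) \<and> mono_on {0..} h \<and>
     (\<forall>r>0. continuous (at_left r) h) \<and> (h \<longlongrightarrow> 0) (at_right 0)"

text \<open>Boundedness has to be required, because the library sets the diameter of an unbounded set
  to 0.  Finite covers are included: they may be padded with empty sets, which have diameter 0,
  and a gauge function vanishes at 0.\<close>

definition hausdorff_premeasure :: "(real \<Rightarrow> real) \<Rightarrow> real \<Rightarrow> 'a::metric_space set \<Rightarrow> ennreal" where
  "hausdorff_premeasure h \<delta> F =
     (INF U \<in> {U :: nat \<Rightarrow> 'a set. F \<subseteq> (\<Union>i. U i) \<and> (\<forall>i. bounded (U i) \<and> diameter (U i) \<le> \<delta>)}.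
        \<Sum>i. ennreal (h (diameter (U i))))"

definition hausdorff_measure :: "(real \<Rightarrow> real) \<Rightarrow> 'a::metric_space set \<Rightarrow> ennreal" where
  "hausdorff_measure h F = Lim (at_right 0) (\<lambda>\<delta>. hausdorff_premeasure h \<delta> F)"

lemma hausdorff_premeasure_tendsto:
  "((\<lambda>\<delta>. hausdorff_premeasure h \<delta> F) \<longlongrightarrow> (SUP \<delta>\<in>{0<..}. hausdorff_premeasure h \<delta> F)) (at_right 0)"
proof (rule order_tendstoI)
  fix a assume "a < (SUP \<delta>\<in>{0<..}. hausdorff_premeasure h \<delta> F)"
  then obtain d where d: "d > 0" "a < hausdorff_premeasure h d F"
    by (auto simp: less_SUP_iff)
  have "a < hausdorff_premeasure h x F" if "0 < x" "x < d" for x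
  proof -
    have "hausdorff_premeasure h d F \<le> hausdorff_premeasure h x F"
      unfolding hausdorff_premeasure_def using that by (intro INF_superset_mono) (auto intro: order_trans[OF _ less_imp_le])
    with d show ?thesis by simp
  qed
  then show "\<forall>\<^sub>F x in at_right 0. a < hausdorff_premeasure h x F"
    unfolding eventually_at_right_field using d by blast
next
  fix a assume a: "(SUP \<delta>\<in>{0<..}. hausdorff_premeasure h \<delta> F) < a"
  have "hausdorff_premeasure h x F < a" if "0 < x" for x
    by (rule le_less_trans[OF SUP_upper a]) (use that in simp)
  then show "\<forall>\<^sub>F x in at_right 0. hausdorff_premeasure h x F < a"
    unfolding eventually_at_right_field by (intro exI[of _ 1]) auto
qed

lemma hausdorff_measure_eq_SUP:
  "hausdorff_measure h F = (SUP \<delta>\<in>{0<..}. hausdorff_premeasure h \<delta> F)"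
  unfolding hausdorff_measure_def
  by (rule tendsto_Lim[OF _ hausdorff_premeasure_tendsto]) simp

text \<open>Only exponents t > 0 are used, so the value of \<open>0 powr 0\<close> is irrelevant; the infimum is the
  same as over all exponents for which the Hausdorff measure vanishes.  In a Euclidean space that
  set contains every t above the dimension of the space, so the real infimum is over a nonempty
  set bounded below.\<close>

definition hausdorff_dim :: "'a::euclidean_space set \<Rightarrow> real" where
  "hausdorff_dim F = Inf {t. 0 < t \<and> hausdorff_measure (\<lambda>r. r powr t) F = 0}"

text \<open>The system with parameter l consists of the maps \<open>f l i\<close>, \<open>i = 1, ..., n l\<close>, with similarity
  ratios \<open>c l i\<close>.  Values at indices outside this range are irrelevant.  Since similarities are
  continuous, the measurability condition makes \<open>f l i x\<close> jointly measurable in l and x, and the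
  ratios measurable in l.\<close>

definition similarity_ifs_family ::
    "'l::euclidean_space set \<Rightarrow> ('l \<Rightarrow> nat) \<Rightarrow> ('l \<Rightarrow> nat \<Rightarrow> 'a::euclidean_space \<Rightarrow> 'a) \<Rightarrow>
     ('l \<Rightarrow> nat \<Rightarrow> real) \<Rightarrow> 'a set \<Rightarrow> bool" where
  "similarity_ifs_family \<Lambda> n f c \<Delta> \<longleftrightarrow>
     compact \<Lambda> \<and> \<Lambda> \<noteq> {} \<and>
     (\<forall>l\<in>\<Lambda>. 1 \<le> n l) \<and>
     (\<forall>l\<in>\<Lambda>. \<forall>i\<in>{1..n l}. \<forall>x y. dist (f l i x) (f l i y) = c l i * dist x y) \<and>
     n \<in> measurable (restrict_space borel \<Lambda>) (count_space UNIV) \<and>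
     (\<forall>i\<ge>1. \<forall>x. (\<lambda>l. f l i x) \<in> borel_measurable (restrict_space borel {l\<in>\<Lambda>. i \<le> n l})) \<and>
     compact \<Delta> \<and> (\<forall>l\<in>\<Lambda>. \<forall>i\<in>{1..n l}. f l i ` \<Delta> \<subseteq> \<Delta>)"

definition uniform_open_set_condition ::
    "'l set \<Rightarrow> ('l \<Rightarrow> nat) \<Rightarrow> ('l \<Rightarrow> nat \<Rightarrow> 'a::euclidean_space \<Rightarrow> 'a) \<Rightarrow> bool" where
  "uniform_open_set_condition \<Lambda> n f \<longleftrightarrow>
     (\<exists>U. U \<noteq> {} \<and> bounded U \<and> open U \<and>
        (\<forall>l\<in>\<Lambda>. \<forall>i\<in>{1..n l}. f l i ` U \<subseteq> U) \<and>
        (\<forall>l\<in>\<Lambda>. \<forall>i\<in>{1..n l}. \<forall>j\<in>{1..n l}. i \<noteq> j \<longrightarrow> f l i ` U \<inter> f l j ` U = {}))"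

definition max_maps :: "'l set \<Rightarrow> ('l \<Rightarrow> nat) \<Rightarrow> nat" where
  "max_maps \<Lambda> n = (SUP l\<in>\<Lambda>. n l)"

text \<open>Throughout, \<open>N\<close> is the arity of the tree.  Its nodes are words over \<open>{1..N}\<close>, and a labelling is
  a function on words which is \<open>undefined\<close> outside the tree.\<close>

definition level :: "nat \<Rightarrow> nat \<Rightarrow> nat list set" where
  "level N k = {v. length v = k \<and> set v \<subseteq> {1..N}}"

definition tree_nodes :: "nat \<Rightarrow> nat list set" where
  "tree_nodes N = (\<Union>k. level N k)"

definition labellings :: "nat \<Rightarrow> 'l set \<Rightarrow> (nat list \<Rightarrow> 'l) set" where
  "labellings N \<Lambda> = tree_nodes N \<rightarrow>\<^sub>E \<Lambda>"

definition subtree :: "nat \<Rightarrow> nat list \<Rightarrow> (nat list \<Rightarrow> 'l) \<Rightarrow> nat list \<Rightarrow> 'l" where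
  "subtree N v \<tau> = (\<lambda>w\<in>tree_nodes N. \<tau> (v @ w))"

definition alive_nodes :: "nat \<Rightarrow> ('l \<Rightarrow> nat) \<Rightarrow> (nat list \<Rightarrow> 'l) \<Rightarrow> nat \<Rightarrow> nat list set" where
  "alive_nodes N n \<tau> k = {v \<in> level N k. \<forall>j<k. v ! j \<le> n (\<tau> (take j v))}"

text \<open>The letter \<open>(l, i)\<close> stands for the map \<open>f l i\<close>.\<close>

definition coding :: "(nat list \<Rightarrow> 'l) \<Rightarrow> nat list \<Rightarrow> ('l \<times> nat) list" where
  "coding \<tau> v = map (\<lambda>j. (\<tau> (take j v), v ! j)) [0..<length v]"

definition word_map :: "('l \<Rightarrow> nat \<Rightarrow> 'a \<Rightarrow> 'a) \<Rightarrow> ('l \<times> nat) list \<Rightarrow> 'a \<Rightarrow> 'a" where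
  "word_map f e = foldr (\<lambda>(l, i) g. f l i \<circ> g) e id"

definition word_ratio :: "('l \<Rightarrow> nat \<Rightarrow> real) \<Rightarrow> ('l \<times> nat) list \<Rightarrow> real" where
  "word_ratio c e = (\<Prod>(l, i)\<leftarrow>e. c l i)"

definition attractor ::
    "nat \<Rightarrow> ('l \<Rightarrow> nat) \<Rightarrow> ('l \<Rightarrow> nat \<Rightarrow> 'a \<Rightarrow> 'a) \<Rightarrow> 'a set \<Rightarrow> (nat list \<Rightarrow> 'l) \<Rightarrow> 'a set" where
  "attractor N n f \<Delta> \<tau> = (\<Inter>k\<in>{1..}. \<Union>e\<in>coding \<tau> ` alive_nodes N n \<tau> k. word_map f e ` \<Delta>)"

text \<open>Sequences of neck levels are indexed from 0, so \<open>M 0\<close> is the first neck.\<close>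

definition neck_list :: "nat \<Rightarrow> ('l \<Rightarrow> nat) \<Rightarrow> (nat list \<Rightarrow> 'l) \<Rightarrow> (nat \<Rightarrow> nat) \<Rightarrow> bool" where
  "neck_list N n \<tau> M \<longleftrightarrow> strict_mono M \<and>
     (\<forall>k. \<forall>v\<in>alive_nodes N n \<tau> (M k). \<forall>w\<in>alive_nodes N n \<tau> (M k). subtree N v \<tau> = subtree N w \<tau>)"

definition neck_shift ::
    "nat \<Rightarrow> (nat list \<Rightarrow> 'l) \<times> (nat \<Rightarrow> nat) \<Rightarrow> (nat list \<Rightarrow> 'l) \<times> (nat \<Rightarrow> nat)" where
  "neck_shift N = (\<lambda>(\<tau>, M). (subtree N (replicate (M 0) 1) \<tau>, \<lambda>k. M (Suc k) - M 0))"

definition first_block :: "nat \<Rightarrow> (nat list \<Rightarrow> 'l) \<times> (nat \<Rightarrow> nat) \<Rightarrow> nat \<times> (nat list \<Rightarrow> 'l)" where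
  "first_block N = (\<lambda>(\<tau>, M). (M 0, restrict \<tau> (\<Union>j<M 0. level N j)))"

text \<open>The topology on functions is the product topology, so the sigma-algebra of a code-tree
  measure is the Borel sigma-algebra of the space of labellings times the space of sequences.\<close>

definition code_tree_measure ::
    "'l::euclidean_space set \<Rightarrow> ('l \<Rightarrow> nat) \<Rightarrow> ((nat list \<Rightarrow> 'l) \<times> (nat \<Rightarrow> nat)) measure \<Rightarrow> bool" where
  "code_tree_measure \<Lambda> n P \<longleftrightarrow>
     (let N = max_maps \<Lambda> n in
        prob_space P \<and>
        sets P = sets (restrict_space borel (labellings N \<Lambda> \<times> UNIV)) \<and>
        (AE (\<tau>, M) in P. neck_list N n \<tau> M) \<and>
        distr P P (neck_shift N) = P \<and>
        integrable P (\<lambda>(\<tau>, M). real (M 0)) \<and>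
        prob_space.indep_set P
          (sets (vimage_algebra (space P) (first_block N) borel))
          (sets (vimage_algebra (space P) (neck_shift N) borel)))"

text \<open>The Hausdorff dimension of the attractor is almost surely constant for a code-tree measure;
  s is this (necessarily unique) constant.\<close>

definition almost_deterministic ::
    "'l::euclidean_space set \<Rightarrow> ('l \<Rightarrow> nat) \<Rightarrow> ('l \<Rightarrow> nat \<Rightarrow> 'a::euclidean_space \<Rightarrow> 'a) \<Rightarrow>
     ('l \<Rightarrow> nat \<Rightarrow> real) \<Rightarrow> 'a set \<Rightarrow> ((nat list \<Rightarrow> 'l) \<times> (nat \<Rightarrow> nat)) measure \<Rightarrow> bool" where
  "almost_deterministic \<Lambda> n f c \<Delta> P \<longleftrightarrow>
     (let N = max_maps \<Lambda> n in
        \<exists>s. (AE (\<tau>, M) in P. hausdorff_dim (attractor N n f \<Delta> \<tau>) = s) \<and>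
            (AE (\<tau>, M) in P. (\<Sum>v\<in>alive_nodes N n \<tau> (M 0). word_ratio c (coding \<tau> v) powr s) = 1))"

end

theory Submission
  imports Defs
begin

text \<open>
  Up to constants, \<open>\<H>\<^sup>h(F\<^sub>\<tau>)\<close> is a net measure that only sees the contraction ratios along the tree: the
  cylinders cover \<open>F\<^sub>\<tau>\<close>, and by the open set condition a set of diameter \<open>u\<close> meets boundedly many cylinders
  of size about \<open>u\<close>. Let \<open>Y(\<omega>, t)\<close> be this net measure after rescaling all ratios by \<open>t\<close>. It is exactly
  additive along the first block, \<open>Y(\<omega>, t) = \<Sum>\<^sub>v Y(\<Pi>\<omega>, t c\<^sub>v)\<close>, and the order of the independent blocks is
  irrelevant for such sums. So a Hewitt--Savage law (proved by a Choquet--Deny argument) makes \<open>Y(\<cdot>, t)\<close> almost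
  surely equal to a constant \<open>a(t)\<close>, and \<open>a(t) = \<Sum>\<^sub>v a(t c\<^sub>v)\<close> for almost every block. If \<open>a(1)\<close> is positive
  and finite, then, \<open>a\<close> being monotone, \<open>a(t)\<close> is of order \<open>t\<^sup>s\<close> for the exponent \<open>s\<close> with \<open>\<Sum>\<^sub>v c\<^sub>v\<^sup>s = 1\<close>. Hence
  almost every block has the same exponent \<open>s\<close>, which is then the Hausdorff dimension of \<open>F\<^sub>\<tau>\<close>: the fractal is
  almost deterministic.
\<close>

text \<open>The gauge is not assumed to be doubling, so both comparisons with the Hausdorff measure
  use the cost \<open>h (D * ratio)\<close> with the same \<open>D\<close>; the overlap constant
  counts cylinders of cost at most h(u) and does not change the argument of h. Additivity along
  blocks sends \<open>t\<close> to \<open>t * C \<omega> v\<close>, so the single number Y(\<omega>,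
  1) satisfies no closed equation and the whole function of t is carried along. The statement Y(.,
  t) = a(t) holds outside a null set that depends on t, while the scales produced by a block are
  random. The block is therefore decoupled from the shifted tree, and the resulting equation for a
  is kept at rational t and transferred to all t by left limits. The net measure is a countable
  expression in the ratios, hence measurable; Hausdorff measures enter only through inequalities
  that hold for every labelling. That the common exponent is the dimension is not automatic, since
  necks may be far apart: integrability of the first neck makes the gaps sublinear, so that the
  contraction down to a neck outweighs the branching before the next one.\<close>

declare One_nat_def [simp del]

section \<open>Net measures on trees\<close>

lemma level_0 [simp]: "level N 0 = {[]}"
  by (auto simp: level_def)

lemma level_Suc: "level N (Suc k) = (\<Union>i\<in>{1..N}. (#) i ` level N k)"
  by (auto simp: level_def length_Suc_conv image_iff)

lemma finite_level [simp]: "finite (level N k)"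
  by (induction k) (simp_all add: level_Suc)

lemma card_level: "card (level N k) = N ^ k"
  using card_lists_length_eq[of "{1..N}" k] by (simp add: level_def conj_commute)

lemma sum_level_Suc:
  "(\<Sum>v\<in>level N (Suc k). F v) = (\<Sum>i\<in>{1..N}. \<Sum>v\<in>level N k. F (i # v))"
proof -
  have "(\<Sum>v\<in>level N (Suc k). F v) = (\<Sum>i\<in>{1..N}. \<Sum>v\<in>(#) i ` level N k. F v)"
    unfolding level_Suc by (rule sum.UNION_disjoint) auto
  also have "\<dots> = (\<Sum>i\<in>{1..N}. \<Sum>v\<in>level N k. F (i # v))"
    by (rule sum.cong[OF refl], subst sum.reindex) (auto simp: inj_on_def)
  finally show ?thesis .
qed

lemma sum_level_add:
  "(\<Sum>v\<in>level N (j + k). F v) = (\<Sum>u\<in>level N j. \<Sum>w\<in>level N k. F (u @ w))"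
  by (induction j arbitrary: F) (simp_all add: sum_level_Suc)

text \<open>A cut of the tree below the root picks, on every branch, one node between the levels \<open>k\<close> and
  \<open>k + m\<close>; \<open>cut_value H N k m C\<close> is the least cost of such a cut if the node \<open>v\<close> costs \<open>H (C v)\<close>.\<close>

fun cut_value :: "(real \<Rightarrow> ennreal) \<Rightarrow> nat \<Rightarrow> nat \<Rightarrow> nat \<Rightarrow> (nat list \<Rightarrow> real) \<Rightarrow> ennreal" where
  "cut_value H N 0 0 C = H (C [])"
| "cut_value H N 0 (Suc m) C = min (H (C [])) (\<Sum>i\<in>{1..N}. cut_value H N 0 m (\<lambda>w. C (i # w)))"
| "cut_value H N (Suc k) m C = (\<Sum>i\<in>{1..N}. cut_value H N k m (\<lambda>w. C (i # w)))"

text \<open>The supremum over \<open>k\<close> forces the cuts ever deeper, the analogue of \<delta>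
  tending to 0 in the Hausdorff measure. Only cuts of finite depth occur; compactness of the
  cylinders will show that these suffice.\<close>

definition net_measure :: "(real \<Rightarrow> ennreal) \<Rightarrow> nat \<Rightarrow> (nat list \<Rightarrow> real) \<Rightarrow> ennreal" where
  "net_measure H N C = (SUP k. INF m. cut_value H N k m C)"

lemma cut_value_mono:
  assumes "mono H" "\<And>w. C w \<le> C' w"
  shows "cut_value H N k m C \<le> cut_value H N k m C'"
  using assms
proof (induction H N k m C arbitrary: C' rule: cut_value.induct)
  case (2 H N m C)
  have "(\<Sum>i\<in>{1..N}. cut_value H N 0 m (\<lambda>w. C (i # w))) \<le> (\<Sum>i\<in>{1..N}. cut_value H N 0 m (\<lambda>w. C' (i # w)))"
    using 2 by (intro sum_mono) auto
  then show ?case using 2(2,3) unfolding cut_value.simps by (intro min.mono) (simp_all add: mono_def)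
qed (auto simp: mono_def intro!: sum_mono)

lemma cut_value_Suc_right_le: "cut_value H N k (Suc m) C \<le> cut_value H N k m C"
proof (induction k arbitrary: C)
  case 0
  show ?case
  proof (induction m arbitrary: C)
    case (Suc m)
    have "(\<Sum>i\<in>{1..N}. cut_value H N 0 (Suc m) (\<lambda>w. C (i # w)))
        \<le> (\<Sum>i\<in>{1..N}. cut_value H N 0 m (\<lambda>w. C (i # w)))"
      by (intro sum_mono Suc)
    then show ?case
      unfolding cut_value.simps(2)[of H N "Suc m" C] cut_value.simps(2)[of H N m C]
      by (rule min.mono[OF order_refl])
  qed simp
next
  case (Suc k)
  then show ?case by (simp add: sum_mono)
qed

lemma cut_value_antimono: "antimono (\<lambda>m. cut_value H N k m C)"
  using cut_value_Suc_right_le by (rule decseq_SucI)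

text \<open>The two ranges of levels end at the same depth, and the one on the left starts one level
  higher, so it allows more cuts.\<close>

lemma cut_value_Suc_le: "cut_value H N k (Suc m) C \<le> cut_value H N (Suc k) m C"
proof (induction k arbitrary: C)
  case (Suc k)
  have "cut_value H N (Suc k) (Suc m) C = (\<Sum>i\<in>{1..N}. cut_value H N k (Suc m) (\<lambda>w. C (i # w)))"
    by simp
  also have "\<dots> \<le> (\<Sum>i\<in>{1..N}. cut_value H N (Suc k) m (\<lambda>w. C (i # w)))"
    by (intro sum_mono Suc)
  finally show ?case by simp
qed simp

lemma incseq_INF_cut_value: "incseq (\<lambda>k. INF m. cut_value H N k m C)"
proof (rule incseq_SucI, rule INF_greatest)
  fix k m
  have "(INF m. cut_value H N k m C) \<le> cut_value H N k (Suc m) C" by (rule INF_lower) simp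
  also have "\<dots> \<le> cut_value H N (Suc k) m C" by (rule cut_value_Suc_le)
  finally show "(INF m. cut_value H N k m C) \<le> cut_value H N (Suc k) m C" .
qed

lemma INF_sum_ennreal:
  fixes g :: "'b \<Rightarrow> nat \<Rightarrow> ennreal"
  assumes "\<And>i. i \<in> I \<Longrightarrow> decseq (g i)"
  shows "(INF m. \<Sum>i\<in>I. g i m) = (\<Sum>i\<in>I. INF m. g i m)"
proof -
  have "(\<lambda>m. \<Sum>i\<in>I. g i m) \<longlonglongrightarrow> (\<Sum>i\<in>I. INF m. g i m)"
    by (intro tendsto_sum LIMSEQ_INF assms)
  moreover have "decseq (\<lambda>m. \<Sum>i\<in>I. g i m)"
    using assms by (auto simp: decseq_def intro!: sum_mono)
  ultimately show ?thesis
    using LIMSEQ_INF LIMSEQ_unique by blast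
qed

text \<open>A cut strictly below the root is an independent choice of cuts in the subtrees. With
  \<open>k = 0\<close> a \<open>cut_value\<close> is only subadditive, since the root itself may be
  chosen; the supremum can skip \<open>k = 0\<close>, and this makes the identity exact.\<close>

lemma net_measure_children: "net_measure H N C = (\<Sum>i\<in>{1..N}. net_measure H N (\<lambda>w. C (i # w)))"
proof -
  let ?f = "\<lambda>k. INF m. cut_value H N k m C"
  have "(SUP k. ?f k) = (SUP k. ?f (Suc k))"
  proof (rule antisym)
    show "(SUP k. ?f k) \<le> (SUP k. ?f (Suc k))"
      using incseq_SucD[OF incseq_INF_cut_value] by (rule SUP_mono')
    show "(SUP k. ?f (Suc k)) \<le> (SUP k. ?f k)"
      by (rule SUP_least) (rule SUP_upper, simp)
  qed
  then have "net_measure H N C = (SUP k. INF m. cut_value H N (Suc k) m C)"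
    unfolding net_measure_def .
  also have "\<dots> = (SUP k. \<Sum>i\<in>{1..N}. INF m. cut_value H N k m (\<lambda>w. C (i # w)))"
    by (simp add: INF_sum_ennreal cut_value_antimono)
  also have "\<dots> = (\<Sum>i\<in>{1..N}. net_measure H N (\<lambda>w. C (i # w)))"
    unfolding net_measure_def by (intro ennreal_SUP_sum incseq_INF_cut_value)
  finally show ?thesis .
qed

lemma net_measure_level: "net_measure H N C = (\<Sum>v\<in>level N k. net_measure H N (\<lambda>w. C (v @ w)))"
proof (induction k arbitrary: C)
  case (Suc k)
  show ?case
    by (subst net_measure_children, subst Suc) (simp add: sum_level_Suc)
qed simp

lemma net_measure_mono:
  assumes "mono H" "\<And>w. C w \<le> C' w"
  shows "net_measure H N C \<le> net_measure H N C'"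
  unfolding net_measure_def by (intro SUP_mono' INF_mono' cut_value_mono assms)

lemma cut_value_0: "H 0 = 0 \<Longrightarrow> cut_value H N k m (\<lambda>_. 0) = 0"
  by (induction k, induction m) auto

lemma net_measure_0: "H 0 = 0 \<Longrightarrow> net_measure H N (\<lambda>_. 0) = 0"
  by (simp add: net_measure_def cut_value_0)

text \<open>Mass distribution principle: a weight that is dominated by the cost and loses nothing
  when passed on to the children bounds every cut from below.\<close>

lemma cut_value_ge:
  assumes "\<And>v. g v \<le> H (C v)" "\<And>v. g v \<le> (\<Sum>i\<in>{1..N}. g (v @ [i]))"
  shows "g v \<le> cut_value H N 0 m (\<lambda>w. C (v @ w))"
proof (induction m arbitrary: v)
  case (Suc m)
  have "g v \<le> (\<Sum>i\<in>{1..N}. g (v @ [i]))" by (rule assms)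
  also have "\<dots> \<le> (\<Sum>i\<in>{1..N}. cut_value H N 0 m (\<lambda>w. C ((v @ [i]) @ w)))"
    by (intro sum_mono Suc)
  finally show ?case using assms(1)[of v] by simp
qed (simp add: assms)

lemma cut_value_le_level: "cut_value H N k m C \<le> (\<Sum>v\<in>level N (k + m). H (C v))"
proof (induction H N k m C rule: cut_value.induct)
  case (2 H N m C)
  have "(\<Sum>i\<in>{1..N}. cut_value H N 0 m (\<lambda>w. C (i # w))) \<le> (\<Sum>i\<in>{1..N}. \<Sum>v\<in>level N m. H (C (i # v)))"
    using 2 by (intro sum_mono) auto
  then show ?case by (auto simp: sum_level_Suc intro: min.coboundedI2)
qed (auto simp: sum_level_Suc intro!: sum_mono)

lemma sum_children_le:
  fixes F :: "nat list \<Rightarrow> ennreal"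
  assumes "finite W" "finite I"
  shows "(\<Sum>i\<in>I. \<Sum>w\<in>{w. i # w \<in> W}. F (i # w)) \<le> (\<Sum>w\<in>W. F w)"
proof -
  have fin: "finite {w. i # w \<in> W}" for i
    using finite_vimageI[OF assms(1), of "(#) i"] by (simp add: vimage_def inj_on_def)
  have "(\<Sum>i\<in>I. \<Sum>w\<in>{w. i # w \<in> W}. F (i # w)) = (\<Sum>i\<in>I. \<Sum>w\<in>(#) i ` {w. i # w \<in> W}. F w)"
    by (rule sum.cong[OF refl], subst sum.reindex) (auto simp: inj_on_def)
  also have "\<dots> = (\<Sum>w\<in>(\<Union>i\<in>I. (#) i ` {w. i # w \<in> W}). F w)"
    by (rule sum.UNION_disjoint[symmetric]) (use assms fin in auto)
  also have "\<dots> \<le> (\<Sum>w\<in>W. F w)"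
    by (rule sum_mono2) (use assms in auto)
  finally show ?thesis .
qed

text \<open>\<open>W\<close> may contain comparable nodes or nodes of other levels, which only
  increases the right-hand side. Nodes of zero cost may be cut for free; this takes care of dead
  branches.\<close>

lemma cut_value_le_sum:
  assumes "finite W"
    and "\<And>v. v \<in> level N (k + m) \<Longrightarrow> \<exists>j. k \<le> j \<and> j \<le> k + m \<and> (take j v \<in> W \<or> H (C (take j v)) = 0)"
  shows "cut_value H N k m C \<le> (\<Sum>w\<in>W. H (C w))"
  using assms
proof (induction H N k m C arbitrary: W rule: cut_value.induct)
  case (1 H N C)
  then show ?case by (auto intro: member_le_sum)
next
  case (2 H N m C)
  show ?case
  proof (cases "[] \<in> W \<or> H (C []) = 0")
    case True
    then have "H (C []) \<le> (\<Sum>w\<in>W. H (C w))" using 2(2) by (auto intro: member_le_sum)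
    then show ?thesis by (simp add: min.coboundedI1)
  next
    case False
    have "cut_value H N 0 m (\<lambda>w. C (i # w)) \<le> (\<Sum>w\<in>{w. i # w \<in> W}. H (C (i # w)))"
      if i: "i \<in> {1..N}" for i
    proof (rule 2(1)[OF i])
      show "finite {w. i # w \<in> W}"
        using finite_vimageI[OF 2(2), of "(#) i"] by (simp add: vimage_def inj_on_def)
      fix v assume "v \<in> level N (0 + m)"
      then have "i # v \<in> level N (0 + Suc m)" using i by (auto simp: level_Suc)
      from 2(3)[OF this] obtain j where
        j: "j \<le> Suc m" "take j (i # v) \<in> W \<or> H (C (take j (i # v))) = 0" by auto
      with False obtain j' where "j = Suc j'" by (cases j) auto
      with j show "\<exists>j. 0 \<le> j \<and> j \<le> 0 + m \<and> (take j v \<in> {w. i # w \<in> W} \<or> H (C (i # take j v)) = 0)"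
        by auto
    qed
    then have "(\<Sum>i\<in>{1..N}. cut_value H N 0 m (\<lambda>w. C (i # w)))
      \<le> (\<Sum>i\<in>{1..N}. \<Sum>w\<in>{w. i # w \<in> W}. H (C (i # w)))" by (rule sum_mono)
    also have "\<dots> \<le> (\<Sum>w\<in>W. H (C w))" by (rule sum_children_le) (use 2 in auto)
    finally show ?thesis by (simp add: min.coboundedI2)
  qed
next
  case (3 H N k m C)
  have "cut_value H N k m (\<lambda>w. C (i # w)) \<le> (\<Sum>w\<in>{w. i # w \<in> W}. H (C (i # w)))"
    if i: "i \<in> {1..N}" for i
  proof (rule 3(1)[OF i])
    show "finite {w. i # w \<in> W}"
      using finite_vimageI[OF 3(2), of "(#) i"] by (simp add: vimage_def inj_on_def)
    fix v assume "v \<in> level N (k + m)"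
    then have "i # v \<in> level N (Suc k + m)" using i by (auto simp: level_Suc)
    from 3(3)[OF this] obtain j where
      j: "Suc k \<le> j" "j \<le> Suc k + m" "take j (i # v) \<in> W \<or> H (C (take j (i # v))) = 0" by auto
    then obtain j' where "j = Suc j'" by (cases j) auto
    with j show "\<exists>j\<ge>k. j \<le> k + m \<and> (take j v \<in> {w. i # w \<in> W} \<or> H (C (i # take j v)) = 0)"
      by auto
  qed
  then have "cut_value H N (Suc k) m C \<le> (\<Sum>i\<in>{1..N}. \<Sum>w\<in>{w. i # w \<in> W}. H (C (i # w)))"
    unfolding cut_value.simps by (rule sum_mono)
  also have "\<dots> \<le> (\<Sum>w\<in>W. H (C w))" by (rule sum_children_le) (use 3 in auto)
  finally show ?case .
qed


section \<open>Measurability of the net measure as a function of the ratios\<close>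

lemma measurable_comp_borel:
  "(\<lambda>C w. C (g w)) \<in> (borel :: ('i::countable \<Rightarrow> 'b::second_countable_topology) measure) \<rightarrow>\<^sub>M (borel :: ('j::countable \<Rightarrow> 'b) measure)"
  by (intro borel_measurable_continuous_onI continuous_on_coordinatewise_then_product
      continuous_on_product_coordinates)

lemma measurable_coord_borel:
  "(\<lambda>C. C w) \<in> (borel :: ('i::countable \<Rightarrow> 'b::second_countable_topology) measure) \<rightarrow>\<^sub>M borel"
  by (intro borel_measurable_continuous_onI continuous_on_product_coordinates)

lemma cut_value_measurable:
  assumes H: "H \<in> borel_measurable borel"
  shows "(\<lambda>C. cut_value H N k m C) \<in> borel_measurable borel"
proof (induction k)
  case 0
  have root: "(\<lambda>C :: nat list \<Rightarrow> real. H (C [])) \<in> borel_measurable borel"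
    by (rule measurable_compose[OF measurable_coord_borel H])
  show ?case
  proof (induction m)
    case (Suc m)
    show ?case unfolding cut_value.simps
      by (intro borel_measurable_min root borel_measurable_sum measurable_compose[OF measurable_comp_borel Suc])
  qed (simp add: root)
next
  case (Suc k)
  show ?case unfolding cut_value.simps
    by (intro borel_measurable_sum measurable_compose[OF measurable_comp_borel Suc])
qed

lemma net_measure_measurable:
  assumes "H \<in> borel_measurable borel"
  shows "(\<lambda>C. net_measure H N C) \<in> borel_measurable borel"
  unfolding net_measure_def by (intro borel_measurable_SUP borel_measurable_INF cut_value_measurable assms) auto

section \<open>Hausdorff premeasures and gauge functions\<close>

lemma hausdorff_premeasure_mono: "A \<subseteq> B \<Longrightarrow> hausdorff_premeasure h \<delta> A \<le> hausdorff_premeasure h \<delta> B"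
  unfolding hausdorff_premeasure_def by (rule INF_superset_mono) auto

lemma hausdorff_premeasure_le:
  assumes "bounded A" "diameter A \<le> \<delta>" "0 \<le> \<delta>" "h 0 = 0"
  shows "hausdorff_premeasure h \<delta> A \<le> ennreal (h (diameter A))"
proof -
  let ?U = "\<lambda>i::nat. if i = 0 then A else {}"
  have "(\<Sum>i. ennreal (h (diameter (?U i)))) = (\<Sum>i\<in>{0}. ennreal (h (diameter (?U i))))"
    by (rule suminf_finite) (auto simp: assms)
  then show ?thesis unfolding hausdorff_premeasure_def
    by (intro INF_lower2[of ?U]) (use assms in \<open>auto split: if_splits\<close>)
qed

lemma hausdorff_premeasure_empty:
  assumes "0 \<le> \<delta>" "h 0 = 0"
  shows "hausdorff_premeasure h \<delta> {} = 0"
  using hausdorff_premeasure_le[of "{}" \<delta> h] assms by simp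

lemma hausdorff_premeasure_Un:
  assumes "0 \<le> \<delta>" "h 0 = 0"
  shows "hausdorff_premeasure h \<delta> (A \<union> B) \<le> hausdorff_premeasure h \<delta> A + hausdorff_premeasure h \<delta> B"
proof (rule ennreal_le_epsilon)
  fix e :: real assume fin: "hausdorff_premeasure h \<delta> A + hausdorff_premeasure h \<delta> B < top" and e: "0 < e"
  have cov: "\<exists>U. D \<subseteq> (\<Union>i. U i) \<and> (\<forall>i. bounded (U i) \<and> diameter (U i) \<le> \<delta>) \<and>
      (\<Sum>i::nat. ennreal (h (diameter (U i)))) < hausdorff_premeasure h \<delta> D + ennreal (e / 2)"
    if "hausdorff_premeasure h \<delta> D < top" for D :: "'a set"
  proof -
    have "hausdorff_premeasure h \<delta> D < hausdorff_premeasure h \<delta> D + ennreal (e / 2)"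
      using that e by (simp add: ennreal_less_zero_iff)
    then show ?thesis
      by (subst (asm) (1) hausdorff_premeasure_def) (auto simp: INF_less_iff)
  qed
  from fin cov[of A] cov[of B] obtain U V where
    U: "A \<subseteq> (\<Union>i. U i)" "\<And>i. bounded (U i) \<and> diameter (U i) \<le> \<delta>"
       "(\<Sum>i::nat. ennreal (h (diameter (U i)))) < hausdorff_premeasure h \<delta> A + ennreal (e / 2)" and
    V: "B \<subseteq> (\<Union>i. V i)" "\<And>i. bounded (V i) \<and> diameter (V i) \<le> \<delta>"
       "(\<Sum>i::nat. ennreal (h (diameter (V i)))) < hausdorff_premeasure h \<delta> B + ennreal (e / 2)"
    by (auto simp: less_top)
  \<comment> \<open>Row 0 carries the cover of \<open>A\<close> and row 1 that of \<open>B\<close>;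
    all other rows are empty and cost \<open>h 0 = 0\<close>. \<open>prod_decode\<close> then lists
    both covers as one sequence.\<close>
  define Q where "Q = (\<lambda>(m, i). if m = 0 then U i else if m = (1::nat) then V i else {})"
  define W where "W k = Q (prod_decode k)" for k
  define g where "g m = (\<Sum>i. ennreal (h (diameter (Q (m, i)))))" for m
  have "(\<Sum>k. ennreal (h (diameter (W k)))) = suminf g"
    unfolding W_def by (rule suminf_ennreal_2dimen[where f = "\<lambda>p. ennreal (h (diameter (Q p)))"]) (simp add: g_def)
  also have "suminf g = (\<Sum>m\<in>{0, 1}. g m)"
    by (rule suminf_finite) (auto simp: g_def Q_def assms)
  also have "\<dots> = (\<Sum>i. ennreal (h (diameter (U i)))) + (\<Sum>i. ennreal (h (diameter (V i))))"
    by (simp add: g_def Q_def)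
  also have "\<dots> \<le> (hausdorff_premeasure h \<delta> A + ennreal (e / 2)) + (hausdorff_premeasure h \<delta> B + ennreal (e / 2))"
    using U(3) V(3) by (intro add_mono less_imp_le)
  also have "\<dots> = hausdorff_premeasure h \<delta> A + hausdorff_premeasure h \<delta> B + (ennreal (e / 2) + ennreal (e / 2))"
    by (simp add: ac_simps)
  also have "ennreal (e / 2) + ennreal (e / 2) = ennreal e"
    using e by (simp flip: ennreal_plus)
  finally have sum: "(\<Sum>k. ennreal (h (diameter (W k)))) \<le> hausdorff_premeasure h \<delta> A + hausdorff_premeasure h \<delta> B + ennreal e" .
  have "A \<union> B \<subseteq> (\<Union>k. W k)"
  proof
    fix x assume "x \<in> A \<union> B"
    then consider i where "x \<in> U i" | i where "x \<in> V i" using U(1) V(1) by blast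
    then obtain p where "x \<in> Q p"
    proof cases
      case (1 i)
      then show ?thesis using that[of "(0, i)"] by (simp add: Q_def)
    next
      case (2 i)
      then show ?thesis using that[of "(1, i)"] by (simp add: Q_def)
    qed
    then have "x \<in> W (prod_encode p)" by (simp add: W_def)
    then show "x \<in> (\<Union>k. W k)" by blast
  qed
  moreover have "bounded (W k) \<and> diameter (W k) \<le> \<delta>" for k
    unfolding W_def Q_def using U(2) V(2) assms by (auto split: prod.split)
  ultimately have "hausdorff_premeasure h \<delta> (A \<union> B) \<le> (\<Sum>k. ennreal (h (diameter (W k))))"
    unfolding hausdorff_premeasure_def by (intro INF_lower) simp
  with sum show "hausdorff_premeasure h \<delta> (A \<union> B) \<le> hausdorff_premeasure h \<delta> A + hausdorff_premeasure h \<delta> B + ennreal e"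
    by simp
qed

lemma hausdorff_premeasure_UN:
  assumes "finite I" "0 \<le> \<delta>" "h 0 = 0"
  shows "hausdorff_premeasure h \<delta> (\<Union>i\<in>I. A i) \<le> (\<Sum>i\<in>I. hausdorff_premeasure h \<delta> (A i))"
  using assms(1)
proof induction
  case (insert i I)
  have "hausdorff_premeasure h \<delta> (\<Union>i\<in>insert i I. A i)
      \<le> hausdorff_premeasure h \<delta> (A i) + hausdorff_premeasure h \<delta> (\<Union>i\<in>I. A i)"
    using hausdorff_premeasure_Un[where h = h, OF assms(2,3)] by simp
  also have "\<dots> \<le> hausdorff_premeasure h \<delta> (A i) + (\<Sum>i\<in>I. hausdorff_premeasure h \<delta> (A i))"
    by (intro add_left_mono insert)
  finally show ?case using insert by simp
qed (simp add: hausdorff_premeasure_empty assms)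

lemma gauge_function_0: "gauge_function h \<Longrightarrow> h 0 = 0"
proof -
  assume h: "gauge_function h"
  have "h 0 \<le> 0"
  proof (rule tendsto_lowerbound)
    show "(h \<longlongrightarrow> 0) (at_right 0)" using h by (simp add: gauge_function_def)
    show "\<forall>\<^sub>F r in at_right 0. h 0 \<le> h r"
      using h by (auto simp: gauge_function_def mono_on_def eventually_at_right_field intro!: exI[of _ 1])
  qed simp
  with h show ?thesis by (auto simp: gauge_function_def intro: antisym)
qed

lemma gauge_function_powr: "0 < t \<Longrightarrow> gauge_function (\<lambda>r. r powr t)"
  unfolding gauge_function_def
proof (intro conjI allI impI)
  assume t: "0 < t"
  show "mono_on {0..} (\<lambda>r. r powr t)" using t by (auto intro!: mono_onI powr_mono2)
  show "continuous (at_left r) (\<lambda>r. r powr t)" if "0 < r" for r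
    by (rule continuous_at_imp_continuous_at_within, rule DERIV_isCont[OF has_real_derivative_powr[OF that]])
  show "((\<lambda>r. r powr t) \<longlongrightarrow> 0) (at_right 0)"
    using tendsto_powr2[of "\<lambda>r::real. r" 0 "at_right 0" "\<lambda>_. t" t] t gt_ex[of "0::real"]
    by (auto simp: eventually_at_right_field intro!: exI[of _ 1])
qed simp

text \<open>With \<open>D\<close> at least the diameter of \<Delta>, \<open>D * x\<close> bounds the
  diameter of a cylinder of ratio \<open>x\<close>. The explicit value 0 makes dead nodes free and
  the cost monotone on the whole line, although \<open>h\<close> is uncontrolled at negative
  arguments.\<close>

definition gauge_cost :: "(real \<Rightarrow> real) \<Rightarrow> real \<Rightarrow> real \<Rightarrow> ennreal" where
  "gauge_cost h D x = (if 0 < x then ennreal (h (D * x)) else 0)"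

lemma gauge_cost_0 [simp]: "gauge_cost h D 0 = 0"
  by (simp add: gauge_cost_def)

lemma gauge_mono: "gauge_function h \<Longrightarrow> 0 \<le> x \<Longrightarrow> x \<le> y \<Longrightarrow> h x \<le> h y"
  by (auto simp: gauge_function_def mono_on_def)

lemma gauge_nonneg: "gauge_function h \<Longrightarrow> 0 \<le> x \<Longrightarrow> 0 \<le> h x"
  by (auto simp: gauge_function_def)

lemma mono_gauge_cost: "gauge_function h \<Longrightarrow> 0 \<le> D \<Longrightarrow> mono (gauge_cost h D)"
  by (auto simp: gauge_cost_def intro!: monoI ennreal_leI gauge_mono[of h] mult_left_mono)

lemma measurable_gauge_cost:
  assumes "gauge_function h" "0 \<le> D"
  shows "gauge_cost h D \<in> borel_measurable borel"
proof -
  have "mono (\<lambda>x. if 0 < x then h (D * x) else 0)"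
    using assms by (auto intro!: monoI gauge_mono[of h] gauge_nonneg[of h] mult_left_mono)
  then have "(\<lambda>x. ennreal (if 0 < x then h (D * x) else 0)) \<in> borel_measurable borel"
    by (intro measurable_compose[OF borel_measurable_mono measurable_ennreal])
  then show ?thesis by (simp add: gauge_cost_def[abs_def] if_distrib[of ennreal] cong: if_cong)
qed

lemma diameter_similar_image_le:
  fixes g :: "'x::metric_space \<Rightarrow> 'y::real_normed_vector"
  assumes "\<And>x y. dist (g x) (g y) = t * dist x y" "0 \<le> t" "bounded A"
  shows "bounded (g ` A)" "diameter (g ` A) \<le> t * diameter A"
proof -
  have d: "dist (g x) (g y) \<le> t * diameter A" if "x \<in> A" "y \<in> A" for x y
    using that assms diameter_bounded_bound[of A x y] by (simp add: mult_left_mono)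
  have "bounded (g ` A) \<and> diameter (g ` A) \<le> t * diameter A"
  proof (cases "A = {}")
    case False
    from False have "0 \<le> t * diameter A" using d by (metis all_not_in_conv dist_self)
    then have "diameter (g ` A) \<le> t * diameter A"
      using d False by (intro diameter_le) (auto simp flip: dist_norm)
    moreover from False obtain x0 where "x0 \<in> A" by blast
    then have "bounded (g ` A)"
      unfolding bounded_def using d by (intro exI[of _ "g x0"] exI[of _ "t * diameter A"]) blast
    ultimately show ?thesis by simp
  qed simp
  then show "bounded (g ` A)" "diameter (g ` A) \<le> t * diameter A" by auto
qed

section \<open>The tree of a labelling\<close>

locale similarity_tree =
  fixes \<Lambda> :: "'l::euclidean_space set"
    and n :: "'l \<Rightarrow> nat"
    and f :: "'l \<Rightarrow> nat \<Rightarrow> 'a::euclidean_space \<Rightarrow> 'a"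
    and c :: "'l \<Rightarrow> nat \<Rightarrow> real"
    and \<Delta> :: "'a set"
    and c_min c_max :: real
    and N :: nat
  assumes family: "similarity_ifs_family \<Lambda> n f c \<Delta>"
    and uosc: "uniform_open_set_condition \<Lambda> n f"
    and bdd: "bdd_above (n ` \<Lambda>)"
    and N_eq: "N = max_maps \<Lambda> n"
    and c_min: "0 < c_min" and c_max: "c_max < 1"
    and c_bounds: "\<And>l i. l \<in> \<Lambda> \<Longrightarrow> i \<in> {1..n l} \<Longrightarrow> c_min \<le> c l i \<and> c l i \<le> c_max"
begin

lemma n_le: "l \<in> \<Lambda> \<Longrightarrow> n l \<le> N"
  unfolding N_eq max_maps_def using bdd by (rule cSUP_upper[rotated])

lemma n_ge: "l \<in> \<Lambda> \<Longrightarrow> 1 \<le> n l"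
  using family by (auto simp: similarity_ifs_family_def)

lemma dist_f: "l \<in> \<Lambda> \<Longrightarrow> i \<in> {1..n l} \<Longrightarrow> dist (f l i x) (f l i y) = c l i * dist x y"
  using family by (simp add: similarity_ifs_family_def)

lemma f_Delta: "l \<in> \<Lambda> \<Longrightarrow> i \<in> {1..n l} \<Longrightarrow> f l i ` \<Delta> \<subseteq> \<Delta>"
  using family by (simp add: similarity_ifs_family_def)

lemma compact_Delta: "compact \<Delta>"
  using family by (simp add: similarity_ifs_family_def)

lemma c_max_pos: "0 < c_max"
proof -
  obtain l where "l \<in> \<Lambda>" using family by (auto simp: similarity_ifs_family_def)
  then show ?thesis using c_bounds[of l 1] n_ge[of l] c_min by auto
qed

definition valid :: "(nat list \<Rightarrow> 'l) \<Rightarrow> bool" where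
  "valid \<tau> \<longleftrightarrow> (\<forall>v. set v \<subseteq> {1..N} \<longrightarrow> \<tau> v \<in> \<Lambda>)"

lemma valid_child: "valid \<tau> \<Longrightarrow> i \<in> {1..N} \<Longrightarrow> valid (\<lambda>w. \<tau> (i # w))"
  by (simp add: valid_def)

lemma valid_root: "valid \<tau> \<Longrightarrow> \<tau> [] \<in> \<Lambda>"
  by (simp add: valid_def)

lemma valid_labellings: "\<tau> \<in> labellings N \<Lambda> \<Longrightarrow> valid \<tau>"
  by (auto simp: valid_def labellings_def tree_nodes_def level_def PiE_iff)

text \<open>Dead nodes get ratio 0; this turns sums over alive nodes into sums over full levels.\<close>

definition edge :: "'l \<Rightarrow> nat \<Rightarrow> real" where
  "edge l i = (if l \<in> \<Lambda> \<and> i \<in> {1..n l} then c l i else 0)"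

text \<open>Recursion on the first letter moves on to the labelling of the subtree, so inductions on
  nodes generalise over the labelling.\<close>

primrec node_ratio :: "nat list \<Rightarrow> (nat list \<Rightarrow> 'l) \<Rightarrow> real" where
  "node_ratio [] \<tau> = 1"
| "node_ratio (i # v) \<tau> = edge (\<tau> []) i * node_ratio v (\<lambda>w. \<tau> (i # w))"

primrec node_map :: "nat list \<Rightarrow> (nat list \<Rightarrow> 'l) \<Rightarrow> 'a \<Rightarrow> 'a" where
  "node_map [] \<tau> = id"
| "node_map (i # v) \<tau> = f (\<tau> []) i \<circ> node_map v (\<lambda>w. \<tau> (i # w))"

lemma edge_pos: "l \<in> \<Lambda> \<Longrightarrow> i \<in> {1..n l} \<Longrightarrow> 0 < edge l i"
  using c_bounds[of l i] c_min by (auto simp: edge_def)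

lemma edge_ge: "edge l i \<noteq> 0 \<Longrightarrow> c_min \<le> edge l i"
  using c_bounds[of l i] by (auto simp: edge_def split: if_splits)

lemma edge_nonneg: "0 \<le> edge l i"
  using c_bounds[of l i] c_min by (auto simp: edge_def)

lemma edge_le: "edge l i \<le> c_max"
  using c_bounds[of l i] c_max_pos by (auto simp: edge_def)

lemma node_ratio_append: "node_ratio (u @ w) \<tau> = node_ratio u \<tau> * node_ratio w (\<lambda>x. \<tau> (u @ x))"
  by (induction u arbitrary: \<tau>) simp_all

lemma node_map_append: "node_map (u @ w) \<tau> = node_map u \<tau> \<circ> node_map w (\<lambda>x. \<tau> (u @ x))"
  by (induction u arbitrary: \<tau>) (simp_all add: comp_assoc)

lemma node_ratio_nonneg: "0 \<le> node_ratio v \<tau>"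
  by (induction v arbitrary: \<tau>) (simp_all add: edge_nonneg)

lemma node_ratio_le: "node_ratio v \<tau> \<le> c_max ^ length v"
  by (induction v arbitrary: \<tau>) (auto intro!: mult_mono edge_le node_ratio_nonneg less_imp_le[OF c_max_pos])

lemma node_ratio_le_1: "node_ratio v \<tau> \<le> 1"
  by (rule order_trans[OF node_ratio_le]) (use c_max c_max_pos in \<open>simp add: power_le_one\<close>)

lemma node_ratio_ge: "node_ratio v \<tau> \<noteq> 0 \<Longrightarrow> c_min ^ length v \<le> node_ratio v \<tau>"
  using c_min by (induction v arbitrary: \<tau>) (auto intro!: mult_mono edge_ge edge_nonneg)

lemma node_ratio_nonzero_set: "node_ratio v \<tau> \<noteq> 0 \<Longrightarrow> set v \<subseteq> {1..N}"
proof (induction v arbitrary: \<tau>)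
  case (Cons i v)
  then have "edge (\<tau> []) i \<noteq> 0" "set v \<subseteq> {1..N}" by auto
  then show ?case using n_le[of "\<tau> []"] by (auto simp: edge_def split: if_splits)
qed simp

definition live :: "(nat list \<Rightarrow> 'l) \<Rightarrow> nat \<Rightarrow> nat list set" where
  "live \<tau> k = {v \<in> level N k. node_ratio v \<tau> \<noteq> 0}"

lemma finite_live [simp]: "finite (live \<tau> k)"
  by (simp add: live_def)

lemma live_0 [simp]: "live \<tau> 0 = {[]}"
  by (auto simp: live_def)

lemma live_Suc:
  assumes "\<tau> [] \<in> \<Lambda>"
  shows "live \<tau> (Suc k) = (\<Union>i\<in>{1..n (\<tau> [])}. (#) i ` live (\<lambda>w. \<tau> (i # w)) k)"
proof (rule set_eqI)
  fix v
  show "v \<in> live \<tau> (Suc k) \<longleftrightarrow> v \<in> (\<Union>i\<in>{1..n (\<tau> [])}. (#) i ` live (\<lambda>w. \<tau> (i # w)) k)"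
  proof (cases v)
    case (Cons i v')
    have "edge (\<tau> []) i \<noteq> 0 \<longleftrightarrow> i \<in> {1..n (\<tau> [])}"
      using edge_pos[OF assms, of i] by (auto simp: edge_def)
    then show ?thesis using n_le[OF assms] by (auto simp: Cons live_def level_Suc)
  qed (auto simp: live_def level_Suc)
qed

lemma alive_nodes_eq_live: "valid \<tau> \<Longrightarrow> alive_nodes N n \<tau> k = live \<tau> k"
proof (induction k arbitrary: \<tau>)
  case 0
  then show ?case by (auto simp: alive_nodes_def)
next
  case (Suc k)
  have "i # v \<in> alive_nodes N n \<tau> (Suc k) \<longleftrightarrow> i # v \<in> live \<tau> (Suc k)" for i v
  proof -
    have "i # v \<in> alive_nodes N n \<tau> (Suc k) \<longleftrightarrow>
        i \<in> {1..N} \<and> i \<le> n (\<tau> []) \<and> v \<in> alive_nodes N n (\<lambda>w. \<tau> (i # w)) k"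
      by (auto simp: alive_nodes_def level_Suc All_less_Suc2)
    also have "\<dots> \<longleftrightarrow> i \<in> {1..n (\<tau> [])} \<and> v \<in> live (\<lambda>w. \<tau> (i # w)) k"
      using Suc.IH[OF valid_child[OF Suc.prems], of i] n_le[OF valid_root[OF Suc.prems]] by auto
    also have "\<dots> \<longleftrightarrow> i # v \<in> live \<tau> (Suc k)"
      by (auto simp: live_Suc[of \<tau>, OF valid_root[OF Suc.prems]])
    finally show ?thesis .
  qed
  moreover have "\<exists>i v'. v = i # v'" if "v \<in> alive_nodes N n \<tau> (Suc k) \<or> v \<in> live \<tau> (Suc k)" for v
    using that by (auto simp: alive_nodes_def live_def level_Suc)
  ultimately show ?case by blast
qed

lemma coding_Cons: "coding \<tau> (i # v) = (\<tau> [], i) # coding (\<lambda>w. \<tau> (i # w)) v"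
  by (simp add: coding_def upt_conv_Cons map_Suc_upt[symmetric] del: upt_Suc)

lemma word_map_coding: "word_map f (coding \<tau> v) = node_map v \<tau>"
proof (induction v arbitrary: \<tau>)
  case Nil
  show ?case by (simp add: coding_def word_map_def)
next
  case (Cons i v)
  then show ?case by (simp add: coding_Cons word_map_def)
qed

lemma word_ratio_coding: "node_ratio v \<tau> \<noteq> 0 \<Longrightarrow> word_ratio c (coding \<tau> v) = node_ratio v \<tau>"
proof (induction v arbitrary: \<tau>)
  case Nil
  show ?case by (simp add: coding_def word_ratio_def)
next
  case (Cons i v)
  then show ?case by (simp add: coding_Cons word_ratio_def edge_def split: if_splits)
qed

lemma dist_node_map:
  "node_ratio v \<tau> \<noteq> 0 \<Longrightarrow> dist (node_map v \<tau> x) (node_map v \<tau> y) = node_ratio v \<tau> * dist x y"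
proof (induction v arbitrary: \<tau>)
  case (Cons i v)
  then show ?case using dist_f[of "\<tau> []" i] by (auto simp: edge_def split: if_splits)
qed simp

lemma node_map_image:
  assumes "\<And>l i. l \<in> \<Lambda> \<Longrightarrow> i \<in> {1..n l} \<Longrightarrow> f l i ` X \<subseteq> X"
  shows "node_ratio v \<tau> \<noteq> 0 \<Longrightarrow> node_map v \<tau> ` X \<subseteq> X"
proof (induction v arbitrary: \<tau>)
  case (Cons i v)
  then have "node_map v (\<lambda>w. \<tau> (i # w)) ` X \<subseteq> X" "\<tau> [] \<in> \<Lambda>" "i \<in> {1..n (\<tau> [])}"
    by (auto simp: edge_def split: if_splits)
  with assms[OF this(2,3)] show ?case by (auto simp: image_subset_iff)
qed simp

definition cylinders :: "nat \<Rightarrow> (nat list \<Rightarrow> 'l) \<Rightarrow> 'a set" where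
  "cylinders k \<tau> = (\<Union>v\<in>live \<tau> k. node_map v \<tau> ` \<Delta>)"

lemma attractor_eq: "valid \<tau> \<Longrightarrow> attractor N n f \<Delta> \<tau> = (\<Inter>k\<in>{1..}. cylinders k \<tau>)"
  by (simp add: attractor_def cylinders_def alive_nodes_eq_live word_map_coding)

lemma cylinders_Suc:
  "\<tau> [] \<in> \<Lambda> \<Longrightarrow> cylinders (Suc k) \<tau> = (\<Union>i\<in>{1..n (\<tau> [])}. f (\<tau> []) i ` cylinders k (\<lambda>w. \<tau> (i # w)))"
  by (auto simp: cylinders_def live_Suc)

lemma cylinders_subset: "cylinders k \<tau> \<subseteq> \<Delta>"
  unfolding cylinders_def live_def using node_map_image[OF f_Delta] by blast

text \<open>Each node of a cut contributes one covering set, of diameter at most \<open>D\<close>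
  times its ratio. The outer similarity \<open>g\<close> of ratio \<open>t\<close> collects the maps
  already passed, so that the induction can follow the recursion of \<open>cut_value\<close> into
  the subtrees. The last hypothesis ensures that nodes of level at least \<open>k\<close> give sets
  of diameter at most \<delta>.\<close>

lemma premeasure_cylinders_le_cut:
  fixes g :: "'a \<Rightarrow> 'a"
  assumes h: "gauge_function h" and D: "diameter \<Delta> \<le> D" "0 \<le> D"
    and "valid \<tau>" "0 \<le> t" "\<And>x y. dist (g x) (g y) = t * dist x y" "t * c_max ^ k * D \<le> \<delta>"
  shows "hausdorff_premeasure h \<delta> (g ` cylinders (k + m) \<tau>)
    \<le> cut_value (gauge_cost h D) N k m (\<lambda>w. t * node_ratio w \<tau>)"
  using assms(4-)
proof (induction k arbitrary: \<tau> t g)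
  case 0
  have root: "hausdorff_premeasure h \<delta> (g ` A) \<le> gauge_cost h D t"
    if A: "A \<subseteq> \<Delta>" and t: "0 \<le> t" "\<And>x y. dist (g x) (g y) = t * dist x y" "t * D \<le> \<delta>"
    for A and g :: "'a \<Rightarrow> 'a" and t
  proof -
    have bA: "bounded A" and dA: "diameter A \<le> D"
      using compact_imp_bounded[OF compact_Delta] A bounded_subset diameter_subset[of A \<Delta>] D by auto
    note g = diameter_similar_image_le[OF t(2,1) bA]
    from dA t have tD: "t * diameter A \<le> t * D" by (simp add: mult_left_mono)
    have "hausdorff_premeasure h \<delta> (g ` A) \<le> ennreal (h (diameter (g ` A)))"
      using g tD t D by (intro hausdorff_premeasure_le) (auto simp: gauge_function_0[OF h] intro: order_trans[OF _ t(3)])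
    also have "\<dots> \<le> ennreal (h (D * t))"
      using g tD by (intro ennreal_leI gauge_mono[OF h] diameter_ge_0) (auto simp: mult.commute)
    also have "\<dots> \<le> gauge_cost h D t"
      using t(1) by (auto simp: gauge_cost_def gauge_function_0[OF h])
    finally show ?thesis .
  qed
  from 0 show ?case
  proof (induction m arbitrary: \<tau> t g)
    case 0
    then show ?case using root[of \<Delta> t g] by (simp add: cylinders_def)
  next
    case (Suc m)
    let ?n = "n (\<tau> [])"
    have \<delta>: "0 \<le> \<delta>"
      by (rule order_trans[OF _ Suc.prems(4)]) (use D Suc.prems(2) in simp)
    have l: "\<tau> [] \<in> \<Lambda>" by (rule valid_root[OF Suc.prems(1)])
    have "hausdorff_premeasure h \<delta> (g ` cylinders (0 + Suc m) \<tau>) \<le> gauge_cost h D t"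
      using Suc.prems by (intro root cylinders_subset) auto
    moreover {
    have "hausdorff_premeasure h \<delta> (g ` cylinders (0 + Suc m) \<tau>)
      \<le> (\<Sum>i\<in>{1..?n}. hausdorff_premeasure h \<delta> ((g \<circ> f (\<tau> []) i) ` cylinders m (\<lambda>w. \<tau> (i # w))))"
      using Suc.prems l D hausdorff_premeasure_UN[of "{1..?n}" \<delta> h "\<lambda>i. (g \<circ> f (\<tau> []) i) ` cylinders m (\<lambda>w. \<tau> (i # w))"]
      by (simp add: cylinders_Suc image_UN image_comp gauge_function_0[OF h] \<delta>)
    also have "\<dots> \<le> (\<Sum>i\<in>{1..?n}. cut_value (gauge_cost h D) N 0 m (\<lambda>w. (t * edge (\<tau> []) i) * node_ratio w (\<lambda>w. \<tau> (i # w))))"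
    proof (rule sum_mono)
      fix i assume i: "i \<in> {1..?n}"
      then have iN: "i \<in> {1..N}" using n_le[OF l] by auto
      show "hausdorff_premeasure h \<delta> ((g \<circ> f (\<tau> []) i) ` cylinders m (\<lambda>w. \<tau> (i # w)))
        \<le> cut_value (gauge_cost h D) N 0 m (\<lambda>w. (t * edge (\<tau> []) i) * node_ratio w (\<lambda>w. \<tau> (i # w)))"
      proof (rule Suc.IH[simplified])
        show "valid (\<lambda>w. \<tau> (i # w))" by (rule valid_child[OF Suc.prems(1) iN])
        show "0 \<le> t * edge (\<tau> []) i" using Suc.prems by (simp add: edge_nonneg)
        show "dist ((g \<circ> f (\<tau> []) i) x) ((g \<circ> f (\<tau> []) i) y) = t * edge (\<tau> []) i * dist x y" for x y
          using Suc.prems(3) dist_f[OF l i] i l by (simp add: edge_def)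
        have "t * edge (\<tau> []) i * D \<le> t * 1 * D"
          using Suc.prems(2) D order_trans[OF edge_le less_imp_le[OF c_max]] by (intro mult_mono) (auto simp: edge_nonneg)
        then show "t * edge (\<tau> []) i * D \<le> \<delta>" using Suc.prems(4) by simp
      qed
    qed
    also have "\<dots> \<le> (\<Sum>i\<in>{1..N}. cut_value (gauge_cost h D) N 0 m (\<lambda>w. (t * edge (\<tau> []) i) * node_ratio w (\<lambda>w. \<tau> (i # w))))"
      using n_le[OF l] by (intro sum_mono2) auto
    finally have "hausdorff_premeasure h \<delta> (g ` cylinders (0 + Suc m) \<tau>) \<le> \<dots>" . }
    ultimately show ?case by (simp add: mult.assoc)
  qed
next
  case (Suc k)
  let ?n = "n (\<tau> [])"
  have l: "\<tau> [] \<in> \<Lambda>" by (rule valid_root[OF Suc.prems(1)])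
  have \<delta>: "0 \<le> \<delta>"
    by (rule order_trans[OF _ Suc.prems(4)]) (use D c_max_pos Suc.prems(2) in simp)
  have "hausdorff_premeasure h \<delta> (g ` cylinders (Suc k + m) \<tau>)
    \<le> (\<Sum>i\<in>{1..?n}. hausdorff_premeasure h \<delta> ((g \<circ> f (\<tau> []) i) ` cylinders (k + m) (\<lambda>w. \<tau> (i # w))))"
    using l hausdorff_premeasure_UN[of "{1..?n}" \<delta> h "\<lambda>i. (g \<circ> f (\<tau> []) i) ` cylinders (k + m) (\<lambda>w. \<tau> (i # w))"]
    by (simp add: cylinders_Suc image_UN image_comp gauge_function_0[OF h] \<delta>)
  also have "\<dots> \<le> (\<Sum>i\<in>{1..?n}. cut_value (gauge_cost h D) N k m (\<lambda>w. (t * edge (\<tau> []) i) * node_ratio w (\<lambda>w. \<tau> (i # w))))"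
  proof (rule sum_mono)
    fix i assume i: "i \<in> {1..?n}"
    then have iN: "i \<in> {1..N}" using n_le[OF l] by auto
    show "hausdorff_premeasure h \<delta> ((g \<circ> f (\<tau> []) i) ` cylinders (k + m) (\<lambda>w. \<tau> (i # w)))
      \<le> cut_value (gauge_cost h D) N k m (\<lambda>w. (t * edge (\<tau> []) i) * node_ratio w (\<lambda>w. \<tau> (i # w)))"
    proof (rule Suc.IH)
      show "valid (\<lambda>w. \<tau> (i # w))" by (rule valid_child[OF Suc.prems(1) iN])
      show "0 \<le> t * edge (\<tau> []) i" using Suc.prems by (simp add: edge_nonneg)
      show "dist ((g \<circ> f (\<tau> []) i) x) ((g \<circ> f (\<tau> []) i) y) = t * edge (\<tau> []) i * dist x y" for x y
        using Suc.prems(3) dist_f[OF l i] i l by (simp add: edge_def)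
      have "t * edge (\<tau> []) i * c_max ^ k * D \<le> t * c_max * c_max ^ k * D"
        using Suc.prems(2) D c_max_pos edge_le[of "\<tau> []" i] by (intro mult_mono) (auto simp: edge_nonneg)
      then show "t * edge (\<tau> []) i * c_max ^ k * D \<le> \<delta>" using Suc.prems(4) by (simp add: mult.assoc)
    qed
  qed
  also have "\<dots> \<le> (\<Sum>i\<in>{1..N}. cut_value (gauge_cost h D) N k m (\<lambda>w. (t * edge (\<tau> []) i) * node_ratio w (\<lambda>w. \<tau> (i # w))))"
    using n_le[OF l] by (intro sum_mono2) auto
  finally show ?case by (simp add: mult.assoc)
qed

lemma hausdorff_measure_le_net:
  assumes h: "gauge_function h" and D: "diameter \<Delta> \<le> D" "0 \<le> D" and \<tau>: "valid \<tau>"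
  shows "hausdorff_measure h (attractor N n f \<Delta> \<tau>) \<le> net_measure (gauge_cost h D) N (\<lambda>w. node_ratio w \<tau>)"
  unfolding hausdorff_measure_eq_SUP
proof (rule SUP_least)
  fix \<delta> :: real assume "\<delta> \<in> {0<..}"
  then have \<delta>: "0 < \<delta>" by simp
  have "(\<lambda>k. c_max ^ k * D) \<longlonglongrightarrow> 0 * D"
    using c_max c_max_pos by (intro tendsto_mult LIMSEQ_power_zero tendsto_const) auto
  then have "\<forall>\<^sub>F k in sequentially. c_max ^ k * D < \<delta>"
    using \<delta> by (intro order_tendstoD) auto
  \<comment> \<open>\<open>1 \<le> k\<close> is kept because the attractor is an intersection over
    the levels from 1 on.\<close>
  then obtain k where k: "1 \<le> k" "c_max ^ k * D < \<delta>"
    using eventually_happens[OF eventually_conj[OF eventually_ge_at_top[of 1]]] by fastforce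
  have "hausdorff_premeasure h \<delta> (attractor N n f \<Delta> \<tau>) \<le> cut_value (gauge_cost h D) N k m (\<lambda>w. node_ratio w \<tau>)" for m
  proof -
    have "attractor N n f \<Delta> \<tau> \<subseteq> id ` cylinders (k + m) \<tau>"
      using k by (auto simp: attractor_eq[OF \<tau>])
    then have "hausdorff_premeasure h \<delta> (attractor N n f \<Delta> \<tau>) \<le> hausdorff_premeasure h \<delta> (id ` cylinders (k + m) \<tau>)"
      by (rule hausdorff_premeasure_mono)
    also have "\<dots> \<le> cut_value (gauge_cost h D) N k m (\<lambda>w. 1 * node_ratio w \<tau>)"
      by (rule premeasure_cylinders_le_cut[OF h D \<tau>]) (use k in auto)
    finally show ?thesis by simp
  qed
  then show "hausdorff_premeasure h \<delta> (attractor N n f \<Delta> \<tau>) \<le> net_measure (gauge_cost h D) N (\<lambda>w. node_ratio w \<tau>)"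
    unfolding net_measure_def by (intro SUP_upper2[of k] INF_greatest) auto
qed

end

section \<open>Bounded overlap of cylinders and the lower bound for the Hausdorff measure\<close>

lemma card_disjoint_balls_le:
  fixes x :: "'i \<Rightarrow> 'a::euclidean_space"
  assumes "finite S" "0 < \<rho>" "0 < R"
    and disj: "disjoint_family_on (\<lambda>w. ball (x w) \<rho>) S"
    and sub: "\<And>w. w \<in> S \<Longrightarrow> ball (x w) \<rho> \<subseteq> ball q R"
  shows "real (card S) \<le> (R / \<rho>) ^ DIM('a)"
proof -
  let ?v = "unit_ball_vol (DIM('a))"
  have "ennreal (real (card S) * (?v * \<rho> ^ DIM('a))) = (\<Sum>w\<in>S. emeasure lborel (ball (x w) \<rho>))"
    using assms by (simp add: emeasure_ball ennreal_mult ennreal_of_nat_eq_real_of_nat)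
  also have "\<dots> = emeasure lborel (\<Union>w\<in>S. ball (x w) \<rho>)"
    by (rule sum_emeasure) (use assms in auto)
  also have "\<dots> \<le> emeasure lborel (ball q R)"
    by (rule emeasure_mono) (use sub in auto)
  also have "\<dots> = ennreal (?v * R ^ DIM('a))"
    using assms by (simp add: emeasure_ball)
  finally have "real (card S) * (?v * \<rho> ^ DIM('a)) \<le> ?v * R ^ DIM('a)"
    using assms by (subst (asm) ennreal_le_iff) auto
  then have "?v * (real (card S) * \<rho> ^ DIM('a)) \<le> ?v * R ^ DIM('a)" by (simp add: ac_simps)
  then have "real (card S) * \<rho> ^ DIM('a) \<le> R ^ DIM('a)"
    by (rule mult_left_le_imp_le) simp
  then show ?thesis using assms by (simp add: power_divide field_simps)
qed

text \<open>A similarity of a Euclidean space is onto: after subtraction of its value at 0 it is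
  linear and injective, hence surjective.\<close>

lemma ball_subset_similar_image:
  fixes g :: "'a::euclidean_space \<Rightarrow> 'a"
  assumes g: "\<And>x y. dist (g x) (g y) = t * dist x y" and t: "0 < t"
  shows "ball (g p) (t * r) \<subseteq> g ` ball p r"
proof
  define L where "L x = g x - g 0" for x
  have "linear L" by (rule scaling_linear[where c = t]) (use g in \<open>simp_all add: L_def dist_norm\<close>)
  moreover have "inj L"
  proof (rule injI)
    fix x y assume "L x = L y"
    then have "dist (g x) (g y) = 0" by (simp add: L_def)
    then show "x = y" using g[of x y] t by simp
  qed
  ultimately have "surj L" by (rule eucl.linear_inj_imp_surj)
  fix y assume y: "y \<in> ball (g p) (t * r)"
  from \<open>surj L\<close> obtain x where "L x = y - g 0" by (metis surjD)
  then have "g x = y" by (simp add: L_def)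
  moreover from this y g[of p x] t have "dist p x < r" by simp
  ultimately show "y \<in> g ` ball p r" by auto
qed

lemma sum_UN_le_ennreal:
  fixes F :: "'b \<Rightarrow> ennreal"
  assumes "finite I" "\<And>i. i \<in> I \<Longrightarrow> finite (W i)"
  shows "(\<Sum>w\<in>(\<Union>i\<in>I. W i). F w) \<le> (\<Sum>i\<in>I. \<Sum>w\<in>W i. F w)"
  using assms
proof (induction I)
  case (insert i I)
  have "(\<Sum>w\<in>W i \<union> (\<Union>i\<in>I. W i). F w) \<le> (\<Sum>w\<in>W i. F w) + (\<Sum>w\<in>(\<Union>i\<in>I. W i). F w)"
    using sum.union_inter[of "W i" "\<Union>i\<in>I. W i" F] insert by (metis add_increasing2 finite_UN_I insertCI le_iff_add order_refl zero_le)
  also have "\<dots> \<le> (\<Sum>w\<in>W i. F w) + (\<Sum>i\<in>I. \<Sum>w\<in>W i. F w)"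
    using insert by (intro add_left_mono) auto
  finally show ?case using insert by simp
qed simp

lemma le_mult_INF_ennreal:
  fixes X :: ennreal and K :: nat
  assumes "0 < K" "\<And>i. i \<in> I \<Longrightarrow> X \<le> of_nat K * g i"
  shows "X \<le> of_nat K * (INF i\<in>I. g i)"
proof -
  have K: "(of_nat K :: ennreal) \<noteq> 0" "(of_nat K :: ennreal) \<noteq> top" "0 < (of_nat K :: ennreal)"
    using assms(1) by (auto simp: of_nat_less_top order.strict_implies_not_eq)
  have "X / of_nat K \<le> (INF i\<in>I. g i)"
    using assms(2) K(3) by (intro INF_greatest divide_le_posI_ennreal) (auto simp: mult.commute)
  then have "of_nat K * (X / of_nat K) \<le> of_nat K * (INF i\<in>I. g i)" by (rule mult_left_mono) simp
  then show ?thesis using K by (simp add: ennreal_times_divide mult.commute[of "of_nat K" X] ennreal_mult_divide_eq)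
qed

context similarity_tree
begin

lemma node_map_prefix:
  assumes "node_ratio (u @ w) \<tau> \<noteq> 0"
  shows "node_map (u @ w) \<tau> ` \<Delta> \<subseteq> node_map u \<tau> ` \<Delta>"
proof -
  have "node_map w (\<lambda>x. \<tau> (u @ x)) ` \<Delta> \<subseteq> \<Delta>"
    by (rule node_map_image[OF f_Delta]) (use assms in \<open>auto simp: node_ratio_append\<close>)
  then show ?thesis by (auto simp: node_map_append)
qed

lemma node_ratio_take:
  "node_ratio v \<tau> \<noteq> 0 \<Longrightarrow> node_ratio (take j v) \<tau> \<noteq> 0 \<and> node_ratio v \<tau> \<le> node_ratio (take j v) \<tau>"
proof -
  assume "node_ratio v \<tau> \<noteq> 0"
  moreover have eq: "node_ratio v \<tau> = node_ratio (take j v) \<tau> * node_ratio (drop j v) (\<lambda>x. \<tau> (take j v @ x))"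
    by (simp flip: node_ratio_append)
  moreover have "\<dots> \<le> node_ratio (take j v) \<tau>"
    by (rule mult_left_le[OF node_ratio_le_1 node_ratio_nonneg])
  ultimately show ?thesis by auto
qed

lemma cylinders_decreasing:
  assumes "j \<le> k"
  shows "cylinders k \<tau> \<subseteq> cylinders j \<tau>"
proof -
  have "node_map v \<tau> ` \<Delta> \<subseteq> cylinders j \<tau>" if v: "v \<in> live \<tau> k" for v
  proof -
    have "take j v \<in> live \<tau> j"
      using v assms node_ratio_take[of v \<tau> j] by (auto simp: live_def level_def dest: in_set_takeD)
    moreover have "node_map v \<tau> ` \<Delta> \<subseteq> node_map (take j v) \<tau> ` \<Delta>"
      using node_map_prefix[of "take j v" "drop j v" \<tau>] v by (simp add: live_def)
    ultimately show ?thesis unfolding cylinders_def by blast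
  qed
  then show ?thesis unfolding cylinders_def[of k] by blast
qed

lemma compact_cylinders: "compact (cylinders k \<tau>)"
proof -
  have "continuous_on \<Delta> (node_map v \<tau>)" if "v \<in> live \<tau> k" for v
    using that node_ratio_nonneg[of v \<tau>] dist_node_map[of v \<tau>]
    by (intro lipschitz_on_continuous_on[of "node_ratio v \<tau>"] lipschitz_onI) (auto simp: live_def)
  then show ?thesis unfolding cylinders_def
    by (intro compact_UN finite_live compact_continuous_image compact_Delta)
qed

text \<open>A common first letter is removed by injectivity of its map. Where the nodes first
  differ, the open set condition for the label separates the two first-level images of
  \<open>X\<close> that contain the sets in question. Incomparability guarantees that such a place
  exists.\<close>

lemma node_map_disjoint:
  assumes X: "\<And>l i. l \<in> \<Lambda> \<Longrightarrow> i \<in> {1..n l} \<Longrightarrow> f l i ` X \<subseteq> X"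
    and disj: "\<And>l i j. l \<in> \<Lambda> \<Longrightarrow> i \<in> {1..n l} \<Longrightarrow> j \<in> {1..n l} \<Longrightarrow> i \<noteq> j \<Longrightarrow> f l i ` X \<inter> f l j ` X = {}"
  shows "node_ratio u \<tau> \<noteq> 0 \<Longrightarrow> node_ratio w \<tau> \<noteq> 0 \<Longrightarrow> \<nexists>x. w = u @ x \<Longrightarrow> \<nexists>x. u = w @ x \<Longrightarrow>
    node_map u \<tau> ` X \<inter> node_map w \<tau> ` X = {}"
proof (induction u arbitrary: \<tau> w)
  case (Cons i u)
  then obtain j w' where w: "w = j # w'" by (cases w) auto
  from Cons.prems have i: "\<tau> [] \<in> \<Lambda>" "i \<in> {1..n (\<tau> [])}" "node_ratio u (\<lambda>w. \<tau> (i # w)) \<noteq> 0"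
    and j: "j \<in> {1..n (\<tau> [])}" "node_ratio w' (\<lambda>w. \<tau> (j # w)) \<noteq> 0"
    by (auto simp: edge_def w split: if_splits)
  show ?case
  proof (cases "i = j")
    case True
    have "node_map u (\<lambda>w. \<tau> (i # w)) ` X \<inter> node_map w' (\<lambda>w. \<tau> (i # w)) ` X = {}"
      by (rule Cons.IH) (use Cons.prems i j in \<open>auto simp: w True\<close>)
    moreover have "inj (f (\<tau> []) i)"
    proof (rule injI)
      fix x y assume "f (\<tau> []) i x = f (\<tau> []) i y"
      then show "x = y" using dist_f[OF i(1,2), of x y] c_bounds[OF i(1,2)] c_min by auto
    qed
    ultimately have "f (\<tau> []) i ` node_map u (\<lambda>w. \<tau> (i # w)) ` X \<inter> f (\<tau> []) i ` node_map w' (\<lambda>w. \<tau> (i # w)) ` X = {}"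
      by (simp flip: image_Int)
    then show ?thesis by (simp add: w True image_comp)
  next
    case False
    have "node_map u (\<lambda>w. \<tau> (i # w)) ` X \<subseteq> X" "node_map w' (\<lambda>w. \<tau> (j # w)) ` X \<subseteq> X"
      by (rule node_map_image[OF X i(3)], assumption+) (rule node_map_image[OF X j(2)], assumption+)
    then have "f (\<tau> []) i ` node_map u (\<lambda>w. \<tau> (i # w)) ` X \<subseteq> f (\<tau> []) i ` X"
        "f (\<tau> []) j ` node_map w' (\<lambda>w. \<tau> (j # w)) ` X \<subseteq> f (\<tau> []) j ` X"
      by (auto intro!: image_mono)
    with disj[OF i(1,2) j(1) False] show ?thesis unfolding w by (simp add: image_comp[symmetric]) blast
  qed
qed auto

text \<open>The first nodes along the branches whose ratio is at most \<open>s\<close>. The root is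
  excluded for want of a parent, so \<open>s < 1\<close> is required where every branch is to be
  stopped.\<close>

definition stopping_nodes :: "real \<Rightarrow> (nat list \<Rightarrow> 'l) \<Rightarrow> nat list set" where
  "stopping_nodes s \<tau> = {w. node_ratio w \<tau> \<noteq> 0 \<and> node_ratio w \<tau> \<le> s \<and> w \<noteq> [] \<and> s < node_ratio (butlast w) \<tau>}"

text \<open>Only the last edge takes the ratio down to at most \<open>s\<close>, and a nonzero edge
  is at least \<open>c_min\<close>.\<close>

lemma stopping_nodes_ge:
  assumes "w \<in> stopping_nodes s \<tau>" "0 < s"
  shows "c_min * s \<le> node_ratio w \<tau>"
proof -
  have w: "w = butlast w @ [last w]" using assms by (simp add: stopping_nodes_def)
  have "node_ratio w \<tau> = node_ratio (butlast w) \<tau> * edge (\<tau> (butlast w)) (last w)"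
    by (subst w, subst node_ratio_append) simp
  moreover from this assms have "c_min \<le> edge (\<tau> (butlast w)) (last w)"
    by (intro edge_ge) (auto simp: stopping_nodes_def)
  ultimately have "s * c_min \<le> node_ratio w \<tau>"
    using assms c_min by (auto simp: stopping_nodes_def intro!: mult_mono)
  then show ?thesis by (simp add: mult.commute)
qed

lemma stopping_nodes_incomparable:
  assumes "u \<in> stopping_nodes s \<tau>" "w \<in> stopping_nodes s \<tau>" "u \<noteq> w"
  shows "\<nexists>x. w = u @ x"
proof
  assume "\<exists>x. w = u @ x"
  then obtain x where x: "w = u @ x" "x \<noteq> []" using assms(3) by auto
  then have "node_ratio (butlast w) \<tau> = node_ratio u \<tau> * node_ratio (butlast x) (\<lambda>y. \<tau> (u @ y))"
    by (simp add: butlast_append node_ratio_append)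
  also have "\<dots> \<le> node_ratio u \<tau>"
    using node_ratio_le_1 node_ratio_nonneg by (simp add: mult_left_le)
  finally show False using assms by (auto simp: stopping_nodes_def)
qed

lemma stopping_nodes_prefix:
  assumes "node_ratio v \<tau> \<noteq> 0" "node_ratio v \<tau> \<le> s" "s < 1"
  obtains j where "j \<le> length v" "take j v \<in> stopping_nodes s \<tau>"
proof -
  define j where "j = (LEAST j. node_ratio (take j v) \<tau> \<le> s)"
  have ex: "node_ratio (take (length v) v) \<tau> \<le> s" using assms by simp
  have j: "node_ratio (take j v) \<tau> \<le> s" unfolding j_def using ex by (rule LeastI)
  have jl: "j \<le> length v" unfolding j_def using ex by (rule Least_le)
  from j assms have "j \<noteq> 0" by (auto intro: ccontr)
  then have "\<not> node_ratio (take (j - 1) v) \<tau> \<le> s" unfolding j_def by (intro not_less_Least) auto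
  then have "take j v \<in> stopping_nodes s \<tau>"
    using j jl \<open>j \<noteq> 0\<close> node_ratio_take[OF assms(1), of j] assms(1)
    by (auto simp: stopping_nodes_def butlast_take)
  with jl show ?thesis by (rule that)
qed

text \<open>The open set condition enters here: the images of the open set under the maps of the stopping
  nodes are disjoint, contain balls of radius comparable to \<open>s\<close> and lie close to \<open>q\<close>.\<close>

lemma card_stopping_nodes_bound:
  assumes "0 < D"
  obtains K :: nat where "0 < K"
    "\<And>\<tau> s q. 0 < s \<Longrightarrow>
      finite {w \<in> stopping_nodes s \<tau>. node_map w \<tau> ` \<Delta> \<inter> ball q (2 * (s * D)) \<noteq> {}} \<and>
      card {w \<in> stopping_nodes s \<tau>. node_map w \<tau> ` \<Delta> \<inter> ball q (2 * (s * D)) \<noteq> {}} \<le> K"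
proof -
  from uosc obtain X where X: "X \<noteq> {}" "bounded X" "open X"
    and XX: "\<And>l i. l \<in> \<Lambda> \<Longrightarrow> i \<in> {1..n l} \<Longrightarrow> f l i ` X \<subseteq> X"
    and disj: "\<And>l i j. l \<in> \<Lambda> \<Longrightarrow> i \<in> {1..n l} \<Longrightarrow> j \<in> {1..n l} \<Longrightarrow> i \<noteq> j \<Longrightarrow> f l i ` X \<inter> f l j ` X = {}"
    unfolding uniform_open_set_condition_def by metis
  from X obtain p where "p \<in> X" by blast
  with X obtain r where r: "0 < r" "ball p r \<subseteq> X" by (auto simp: open_contains_ball)
  have "bounded (insert p \<Delta>)" using compact_imp_bounded[OF compact_Delta] by simp
  define E where "E = diameter (insert p \<Delta>)"
  have E: "dist p y \<le> E" if "y \<in> \<Delta>" for y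
    unfolding E_def using \<open>bounded (insert p \<Delta>)\<close> that by (intro diameter_bounded_bound) auto
  have E0: "0 \<le> E" unfolding E_def by (rule diameter_ge_0) fact
  \<comment> \<open>In units of \<open>s\<close>: \<open>2 * D\<close> leads from \<open>q\<close>
    to a point of the cylinder, \<open>E\<close> further on to the image of \<open>p\<close>, and
    \<open>c_min * r\<close> is the radius of the small ball there. \<open>E\<close> links
    \<open>p\<close> to \<Delta>, since the open set and \<Delta> may lie apart.\<close>
  define R where "R = 2 * D + E + c_min * r"
  have R: "0 < R" using assms E0 c_min r by (simp add: R_def add_pos_nonneg add_nonneg_pos)
  define K where "K = Suc (nat \<lceil>(R / (c_min * r)) ^ DIM('a)\<rceil>)"
  have "finite W \<and> card W \<le> K"
    if s: "0 < s" and W: "W = {w \<in> stopping_nodes s \<tau>. node_map w \<tau> ` \<Delta> \<inter> ball q (2 * (s * D)) \<noteq> {}}"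
    for \<tau> s q W
  \<comment> \<open>Finiteness of \<open>W\<close> is itself part of the claim, so the volume bound
    is applied to its finite subsets.\<close>
  proof (rule finite_if_finite_subsets_card_bdd)
    fix G assume G: "G \<subseteq> W" "finite G"
    have stop: "w \<in> stopping_nodes s \<tau>" if "w \<in> G" for w using that G W by auto
    have nz: "node_ratio w \<tau> \<noteq> 0" "node_ratio w \<tau> \<le> s" if "w \<in> G" for w
      using stop[OF that] by (auto simp: stopping_nodes_def)
    have inX: "ball (node_map w \<tau> p) (c_min * s * r) \<subseteq> node_map w \<tau> ` X" if w: "w \<in> G" for w
    proof -
      have "ball (node_map w \<tau> p) (c_min * s * r) \<subseteq> ball (node_map w \<tau> p) (node_ratio w \<tau> * r)"
        using stopping_nodes_ge[OF stop[OF w] s] r by (intro subset_ball mult_right_mono) auto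
      also have "\<dots> \<subseteq> node_map w \<tau> ` ball p r"
        using nz(1)[OF w] node_ratio_nonneg[of w \<tau>]
        by (intro ball_subset_similar_image dist_node_map) auto
      also have "\<dots> \<subseteq> node_map w \<tau> ` X" using r by (intro image_mono)
      finally show ?thesis .
    qed
    have "real (card G) \<le> (s * R / (c_min * s * r)) ^ DIM('a)"
    proof (rule card_disjoint_balls_le)
      show "disjoint_family_on (\<lambda>w. ball (node_map w \<tau> p) (c_min * s * r)) G"
        unfolding disjoint_family_on_def
      proof (intro ballI impI)
        fix u w assume uw: "u \<in> G" "w \<in> G" "u \<noteq> w"
        have "node_map u \<tau> ` X \<inter> node_map w \<tau> ` X = {}"
          using uw nz stopping_nodes_incomparable[of u s \<tau> w] stopping_nodes_incomparable[of w s \<tau> u] stop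
          by (intro node_map_disjoint[OF XX disj]) auto
        with inX[OF uw(1)] inX[OF uw(2)]
        show "ball (node_map u \<tau> p) (c_min * s * r) \<inter> ball (node_map w \<tau> p) (c_min * s * r) = {}" by blast
      qed
      show "ball (node_map w \<tau> p) (c_min * s * r) \<subseteq> ball q (s * R)" if w: "w \<in> G" for w
      proof
        fix z assume z: "z \<in> ball (node_map w \<tau> p) (c_min * s * r)"
        have "node_map w \<tau> ` \<Delta> \<inter> ball q (2 * (s * D)) \<noteq> {}" using w G(1) W by auto
        then obtain y where y: "y \<in> \<Delta>" "dist q (node_map w \<tau> y) < 2 * (s * D)"
          by (auto simp: disjoint_iff)
        have "dist (node_map w \<tau> y) (node_map w \<tau> p) = node_ratio w \<tau> * dist p y"
          using dist_node_map[OF nz(1)[OF w]] by (simp add: dist_commute)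
        also have "\<dots> \<le> s * E" using nz(2)[OF w] E[OF y(1)] s by (intro mult_mono) auto
        finally have "dist q z < 2 * (s * D) + s * E + c_min * s * r"
          using y(2) z dist_triangle[of q z "node_map w \<tau> y"]
            dist_triangle[of "node_map w \<tau> y" z "node_map w \<tau> p"] by simp
        then show "z \<in> ball q (s * R)" by (simp add: R_def algebra_simps)
      qed
    qed (use G s r c_min R in auto)
    also have "s * R / (c_min * s * r) = R / (c_min * r)" using s by simp
    finally show "card G \<le> K" unfolding K_def by linarith
  qed
  then show ?thesis by (intro that[of K]) (auto simp: K_def)
qed

text \<open>A covering set of size \<open>u\<close> is traded for the at most \<open>K\<close>
  stopping nodes of scale \<open>u / D\<close> near it. Their ratios times \<open>D\<close> are at
  most \<open>u\<close>, so each of them costs at most \<open>h u\<close>, whatever the growth of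
  \<open>h\<close>. \<open>K\<close> is fixed before the gauge and the labelling. The intersection
  of the cylinders is the attractor if the labelling is valid.\<close>

lemma net_measure_le_hausdorff:
  assumes D: "0 < D" and \<Delta>: "\<Delta> \<noteq> {}"
  obtains K :: nat where "\<And>h \<tau>. gauge_function h \<Longrightarrow>
    net_measure (gauge_cost h D) N (\<lambda>w. node_ratio w \<tau>) \<le> of_nat K * hausdorff_measure h (\<Inter>k\<in>{1..}. cylinders k \<tau>)"
proof (rule card_stopping_nodes_bound[OF D])
  fix K :: nat assume K: "0 < K"
    and packing: "\<And>\<tau> s q. 0 < s \<Longrightarrow>
      finite {w \<in> stopping_nodes s \<tau>. node_map w \<tau> ` \<Delta> \<inter> ball q (2 * (s * D)) \<noteq> {}} \<and>
      card {w \<in> stopping_nodes s \<tau>. node_map w \<tau> ` \<Delta> \<inter> ball q (2 * (s * D)) \<noteq> {}} \<le> K"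
  have "net_measure (gauge_cost h D) N (\<lambda>w. node_ratio w \<tau>) \<le> of_nat K * hausdorff_measure h (\<Inter>k\<in>{1..}. cylinders k \<tau>)"
    if h: "gauge_function h" for h \<tau>
    unfolding net_measure_def
  proof (rule SUP_least)
    fix k
    define F where "F = (\<Inter>k\<in>{1..}. cylinders k \<tau>)"
    \<comment> \<open>Ratios of at most \<open>\<delta> / D < c_min ^ k\<close> occur only at levels
      from \<open>k\<close> on, because a live node of level \<open>j\<close> has ratio at least
      \<open>c_min ^ j\<close>.\<close>
    define \<delta> where "\<delta> = D * c_min ^ Suc k"
    let ?c = "\<lambda>m. cut_value (gauge_cost h D) N k m (\<lambda>w. node_ratio w \<tau>)"
    have cm: "c_min < 1"
    proof -
      obtain l where "l \<in> \<Lambda>" using family by (auto simp: similarity_ifs_family_def)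
      then show ?thesis using c_bounds[of l 1] n_ge[of l] c_max by auto
    qed
    have \<delta>: "0 < \<delta>" "\<delta> / D < c_min ^ k"
      using D c_min cm by (auto simp: \<delta>_def)
    have \<delta>1: "\<delta> / D < 1"
      using \<delta>(2) cm c_min power_le_one[of c_min k] by auto
    have "(INF m. ?c m) \<le> of_nat K * (\<Sum>i. ennreal (h (diameter (U i))))"
      if U: "F \<subseteq> (\<Union>i. U i)" "\<And>i. bounded (U i)" "\<And>i. diameter (U i) \<le> \<delta>" for U :: "nat \<Rightarrow> 'a set"
    proof (rule ennreal_le_epsilon)
      fix e :: real assume e: "0 < e"
      \<comment> \<open>Open neighbourhoods need a positive radius. For a set of diameter 0 the
        limit of \<open>h\<close> at 0 supplies one of small cost; otherwise the diameter itself is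
        kept. Multiplied by \<open>K\<close>, the errors add up to \<open>e\<close>.\<close>
      have "\<exists>u. 0 < u \<and> u \<le> \<delta> \<and> diameter (U i) \<le> u \<and> h u \<le> h (diameter (U i)) + e / K * (1/2) ^ Suc i" for i
      proof (cases "diameter (U i) = 0")
        case True
        have "\<forall>\<^sub>F r in at_right 0. h r < e / K * (1/2) ^ Suc i"
          using h e K by (intro order_tendstoD(2)[of h 0]) (auto simp: gauge_function_def)
        moreover have "\<forall>\<^sub>F r in at_right 0. r < \<delta>" "\<forall>\<^sub>F r in at_right 0. (0::real) < r"
          using \<delta>(1) by (auto simp: eventually_at_right_field)
        ultimately have "\<forall>\<^sub>F r in at_right 0. 0 < r \<and> r < \<delta> \<and> h r < e / K * (1/2) ^ Suc i"
          by eventually_elim auto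
        from eventually_happens'[OF trivial_limit_at_right_real this]
        obtain r where "0 < r" "r < \<delta>" "h r < e / K * (1/2) ^ Suc i" by blast
        then show ?thesis using True gauge_function_0[OF h] by (intro exI[of _ r]) auto
      next
        case False
        then show ?thesis using diameter_ge_0[OF U(2)[of i]] U(3)[of i] e
          by (intro exI[of _ "diameter (U i)"]) auto
      qed
      then obtain u where u: "\<And>i. 0 < u i" "\<And>i. u i \<le> \<delta>" "\<And>i. diameter (U i) \<le> u i"
        "\<And>i. h (u i) \<le> h (diameter (U i)) + e / K * (1/2) ^ Suc i" by metis
      define V where "V i = (\<Union>y\<in>U i. ball y (u i))" for i
      have "F \<subseteq> (\<Union>i. V i)" using U(1) u(1) by (force simp: V_def)
      have V_ball: "\<exists>q. V i \<subseteq> ball q (2 * u i)" for i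
      proof (cases "U i = {}")
        case False
        then obtain q where q: "q \<in> U i" by blast
        have "V i \<subseteq> ball q (2 * u i)"
        proof
          fix z assume "z \<in> V i"
          then obtain y where y: "y \<in> U i" "dist y z < u i" by (auto simp: V_def)
          have "dist q y \<le> u i"
            using diameter_bounded_bound[OF U(2)[of i] q y(1)] u(3)[of i] by linarith
          with y(2) dist_triangle[of q z y] show "z \<in> ball q (2 * u i)" by simp
        qed
        then show ?thesis by blast
      qed (simp add: V_def)
      have oV: "open (V i)" for i by (simp add: V_def open_UN)
      \<comment> \<open>Compactness of the nested cylinders: a whole finite level already lies in
        the open cover, so that a cut of finite depth can be extracted.\<close>
      obtain m0 where m0: "cylinders m0 \<tau> \<subseteq> (\<Union>i. V i)"
      proof (rule ccontr)
        assume "\<not> thesis"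
        then have "cylinders (Suc m) \<tau> - (\<Union>i. V i) \<noteq> {}" for m using that by blast
        then have "(\<Inter>m. cylinders (Suc m) \<tau> - (\<Union>i. V i)) \<noteq> {}"
          using oV cylinders_decreasing
          by (intro compact_nest compact_diff compact_cylinders Diff_mono) auto
        then obtain x where x: "x \<in> cylinders (Suc m) \<tau>" "x \<notin> (\<Union>i. V i)" for m by blast
        have "x \<in> cylinders k \<tau>" if "1 \<le> k" for k using x(1)[of "k - 1"] that by simp
        then have "x \<in> F" by (auto simp: F_def)
        with \<open>F \<subseteq> (\<Union>i. V i)\<close> x(2) show False by blast
      qed
      obtain I where I: "finite I" "cylinders m0 \<tau> \<subseteq> (\<Union>i\<in>I. V i)"
        using compactE_image[OF compact_cylinders, of UNIV V m0 \<tau>] oV m0 by auto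
      define s where "s i = u i / D" for i
      have s: "0 < s i" "s i \<le> \<delta> / D" "s i * D = u i" for i
        using u(1,2)[of i] D by (auto simp: s_def divide_right_mono)
      define W where "W i = {w \<in> stopping_nodes (s i) \<tau>. node_map w \<tau> ` \<Delta> \<inter> V i \<noteq> {}}" for i
      have W: "finite (W i)" "card (W i) \<le> K" for i
      proof -
        obtain q where "V i \<subseteq> ball q (2 * (s i * D))" using V_ball[of i] s(3)[of i] by auto
        then have sub: "W i \<subseteq> {w \<in> stopping_nodes (s i) \<tau>. node_map w \<tau> ` \<Delta> \<inter> ball q (2 * (s i * D)) \<noteq> {}}"
          unfolding W_def by blast
        note * = packing[OF s(1)[of i], of \<tau> q]
        show "finite (W i)" using finite_subset[OF sub] * by blast
        show "card (W i) \<le> K" using card_mono[OF _ sub] * by (meson order_trans)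
      qed
      have "\<forall>\<^sub>F m in sequentially. \<forall>i\<in>I. c_max ^ m < s i"
      proof (intro eventually_ball_finite I ballI)
        fix i
        show "\<forall>\<^sub>F m in sequentially. c_max ^ m < s i"
          by (rule order_tendstoD(2)[OF LIMSEQ_power_zero s(1)]) (use c_max c_max_pos in simp)
      qed
      then have "\<forall>\<^sub>F m in sequentially. (\<forall>i\<in>I. c_max ^ m < s i) \<and> m0 + k \<le> m"
        by (intro eventually_conj eventually_ge_at_top)
      then obtain m' where m': "\<forall>i\<in>I. c_max ^ m' < s i" "m0 + k \<le> m'"
        unfolding eventually_sequentially by blast
      \<comment> \<open>Deep enough that every live branch of length \<open>k + m\<close> has been
        stopped at each scale in use, and that level \<open>k + m\<close> lies inside the covered
        level \<open>m0\<close>.\<close>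
      define m where "m = m' - k"
      have m: "\<forall>i\<in>I. c_max ^ (k + m) < s i" "m0 \<le> k + m"
        using m' by (simp_all add: m_def)
      have "(INF m. ?c m) \<le> ?c m" by (rule INF_lower) simp
      also have "\<dots> \<le> (\<Sum>w\<in>(\<Union>i\<in>I. W i). gauge_cost h D (node_ratio w \<tau>))"
      proof (rule cut_value_le_sum)
        fix v assume v: "v \<in> level N (k + m)"
        show "\<exists>j. k \<le> j \<and> j \<le> k + m \<and> (take j v \<in> (\<Union>i\<in>I. W i) \<or> gauge_cost h D (node_ratio (take j v) \<tau>) = 0)"
        proof (cases "node_ratio v \<tau> = 0")
          case True
          then show ?thesis using v by (intro exI[of _ "k + m"]) (auto simp: level_def)
        next
          case False
          have lv: "length v = k + m" using v by (simp add: level_def)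
          from \<Delta> obtain y where y: "y \<in> \<Delta>" by blast
          have "node_map v \<tau> y \<in> cylinders (k + m) \<tau>" using False v y by (auto simp: cylinders_def live_def)
          with cylinders_decreasing[OF m(2)] I(2) obtain i where i: "i \<in> I" "node_map v \<tau> y \<in> V i" by blast
          have "node_ratio v \<tau> \<le> s i" using node_ratio_le[of v \<tau>] m(1) i(1) lv by force
          then obtain j where j: "j \<le> length v" "take j v \<in> stopping_nodes (s i) \<tau>"
            using stopping_nodes_prefix[OF False, of "s i"] s(2)[of i] \<delta>1 by auto
          have "node_map v \<tau> y \<in> node_map (take j v) \<tau> ` \<Delta>"
            using node_map_prefix[of "take j v" "drop j v" \<tau>] False y by auto
          then have "take j v \<in> W i" using j i by (auto simp: W_def)
          moreover have "k \<le> j"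
          proof (rule ccontr)
            assume "\<not> k \<le> j"
            then have "c_min ^ k \<le> c_min ^ j" using c_min cm by (intro power_decreasing) auto
            also have "\<dots> \<le> node_ratio (take j v) \<tau>"
              using node_ratio_ge[of "take j v" \<tau>] j by (auto simp: stopping_nodes_def)
            also have "\<dots> \<le> \<delta> / D" using j s(2)[of i] by (auto simp: stopping_nodes_def)
            finally show False using \<delta>(2) by simp
          qed
          ultimately show ?thesis using i(1) j(1) lv by (intro exI[of _ j]) auto
        qed
      qed (use I W in auto)
      also have "\<dots> \<le> (\<Sum>i\<in>I. \<Sum>w\<in>W i. gauge_cost h D (node_ratio w \<tau>))"
        by (rule sum_UN_le_ennreal) (use I W in auto)
      also have "\<dots> \<le> (\<Sum>i\<in>I. of_nat K * ennreal (h (u i)))"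
      proof (rule sum_mono)
        fix i
        have "(\<Sum>w\<in>W i. gauge_cost h D (node_ratio w \<tau>)) \<le> (\<Sum>w\<in>W i. ennreal (h (u i)))"
        proof (rule sum_mono)
          fix w assume "w \<in> W i"
          then have "node_ratio w \<tau> \<le> s i" by (simp add: W_def stopping_nodes_def)
          then have "D * node_ratio w \<tau> \<le> u i" using D s(3)[of i] by (metis mult.commute mult_left_mono less_imp_le)
          then show "gauge_cost h D (node_ratio w \<tau>) \<le> ennreal (h (u i))"
            using D by (auto simp: gauge_cost_def intro!: ennreal_leI gauge_mono[OF h])
        qed
        also have "\<dots> = of_nat (card (W i)) * ennreal (h (u i))" by simp
        also have "\<dots> \<le> of_nat K * ennreal (h (u i))" using W(2)[of i] by (intro mult_right_mono) auto
        finally show "(\<Sum>w\<in>W i. gauge_cost h D (node_ratio w \<tau>)) \<le> of_nat K * ennreal (h (u i))" .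
      qed
      also have "\<dots> \<le> (\<Sum>i. of_nat K * ennreal (h (u i)))"
        by (rule sum_le_suminf) (use I in auto)
      also have "\<dots> \<le> (\<Sum>i. of_nat K * ennreal (h (diameter (U i))) + ennreal (e * (1/2) ^ Suc i))"
      proof (intro suminf_le summableI)
        fix i
        have "ennreal (h (u i)) \<le> ennreal (h (diameter (U i))) + ennreal (e / K * (1/2) ^ Suc i)"
          using u(4)[of i] e gauge_nonneg[OF h diameter_ge_0[OF U(2)]] by (simp flip: ennreal_plus add: ennreal_leI)
        then have "of_nat K * ennreal (h (u i)) \<le> of_nat K * (ennreal (h (diameter (U i))) + ennreal (e / K * (1/2) ^ Suc i))"
          by (rule mult_left_mono) simp
        also have "of_nat K * ennreal (e / K * (1/2) ^ Suc i) = ennreal (e * (1/2) ^ Suc i)"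
          using K e by (simp add: ennreal_of_nat_eq_real_of_nat flip: ennreal_mult)
        then have "of_nat K * (ennreal (h (diameter (U i))) + ennreal (e / K * (1/2) ^ Suc i))
          = of_nat K * ennreal (h (diameter (U i))) + ennreal (e * (1/2) ^ Suc i)" by (simp only: distrib_left)
        finally show "of_nat K * ennreal (h (u i)) \<le> of_nat K * ennreal (h (diameter (U i))) + ennreal (e * (1/2) ^ Suc i)" .
      qed
      also have "\<dots> = (\<Sum>i. of_nat K * ennreal (h (diameter (U i)))) + (\<Sum>i. ennreal (e * (1/2) ^ Suc i))"
        by (rule suminf_add[symmetric]) auto
      also have "(\<Sum>i. ennreal (e * (1/2) ^ Suc i)) = ennreal e"
        using sums_mult[OF power_half_series, of e] e by (intro suminf_ennreal_eq) auto
      finally show "(INF m. ?c m) \<le> of_nat K * (\<Sum>i. ennreal (h (diameter (U i)))) + ennreal e" by simp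
    qed
    then have "(INF m. ?c m) \<le> of_nat K * hausdorff_premeasure h \<delta> F"
      unfolding hausdorff_premeasure_def by (intro le_mult_INF_ennreal K) auto
    also have "\<dots> \<le> of_nat K * hausdorff_measure h F"
      unfolding hausdorff_measure_eq_SUP using \<delta>(1) by (intro mult_left_mono SUP_upper) auto
    finally show "(INF m. ?c m) \<le> of_nat K * hausdorff_measure h (\<Inter>k\<in>{1..}. cylinders k \<tau>)"
      unfolding F_def .
  qed
  then show ?thesis by (rule that)
qed

end

section \<open>Bounded harmonic functions and stationary systems of independent blocks\<close>

lemma (in prob_space) square_integral_le:
  fixes g :: "'a \<Rightarrow> real"
  assumes [measurable]: "g \<in> borel_measurable M" and b: "\<And>x. \<bar>g x\<bar> \<le> 1"
  shows "(\<integral>x. g x \<partial>M)\<^sup>2 \<le> (\<integral>x. (g x)\<^sup>2 \<partial>M)"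
proof -
  have i: "integrable M g" "integrable M (\<lambda>x. (g x)\<^sup>2)"
    using b by (auto intro!: integrable_const_bound[where B = 1] simp: abs_square_le_1)
  have "0 \<le> (\<integral>x. (g x - expectation g)\<^sup>2 \<partial>M)" by simp
  also have "\<dots> = (\<integral>x. (g x)\<^sup>2 \<partial>M) - (expectation g)\<^sup>2"
    by (rule variance_eq[OF i])
  finally show ?thesis by simp
qed

text \<open>The Choquet--Deny argument: the averages of \<open>u\<^sup>2\<close> along the iterates grow by at least the
  conditional variance \<open>w\<close> in each step, because \<open>w\<close> is itself subharmonic by commutativity.
  As \<open>u\<close> is bounded, \<open>w\<close> vanishes.\<close>

lemma bounded_harmonic_invariant:
  fixes u :: "'x::topological_space \<Rightarrow> real" and act :: "'x \<Rightarrow> 'i \<Rightarrow> 'x"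
  assumes "prob_space Q"
    and act [measurable]: "(\<lambda>(x, a). act x a) \<in> borel \<Otimes>\<^sub>M Q \<rightarrow>\<^sub>M borel"
    and u [measurable]: "u \<in> borel_measurable borel"
    and u01: "\<And>x. 0 \<le> u x" "\<And>x. u x \<le> 1"
    and harmonic: "\<And>x. u x = (\<integral>a. u (act x a) \<partial>Q)"
    and comm: "\<And>x a b. u (act (act x a) b) = u (act (act x b) a)"
  shows "AE a in Q. u (act x a) = u x"
proof -
  interpret Q: prob_space Q by fact
  interpret QQ: pair_prob_space Q Q ..
  have [measurable]: "(\<lambda>a. act x a) \<in> Q \<rightarrow>\<^sub>M borel" for x
    using measurable_compose[OF measurable_Pair1' act, of x] by simp
  define w where "w x = (\<integral>a. (u (act x a) - u x)\<^sup>2 \<partial>Q)" for x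
  have d1: "\<bar>u x - u y\<bar> \<le> 1" for x y using u01[of x] u01[of y] by linarith
  have d2: "(u x - u y)\<^sup>2 \<le> 1" for x y using d1[of x y] by (simp add: abs_square_le_1)
  have u2: "(u x)\<^sup>2 \<le> 1" for x using u01[of x] by (simp add: power_le_one)
  have w_meas [measurable]: "w \<in> borel_measurable borel"
    unfolding w_def by measurable
  have w01: "0 \<le> w x" "w x \<le> 1" for x
    unfolding w_def using d2 by (auto intro!: Q.integral_le_const Q.integrable_const_bound[where B = 1])
  have iu: "integrable Q (\<lambda>a. u (act x a))" "integrable Q (\<lambda>a. (u (act x a))\<^sup>2)" for x
    using u01 u2 by (auto intro!: Q.integrable_const_bound[where B = 1])
  have w_eq: "w x = (\<integral>a. (u (act x a))\<^sup>2 \<partial>Q) - (u x)\<^sup>2" for x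
    unfolding w_def using Q.variance_eq[OF iu[of x]] harmonic[of x] by simp
  have w_sub: "w x \<le> (\<integral>b. w (act x b) \<partial>Q)" for x
  proof -
    \<comment> \<open>By harmonicity and commutativity, \<open>u (act x a) - u x\<close> is the
      average over \<open>b\<close> of the same difference at \<open>act x b\<close>. Jensen's
      inequality and Fubini then give subharmonicity.\<close>
    have "w x = (\<integral>a. (\<integral>b. u (act (act x b) a) - u (act x b) \<partial>Q)\<^sup>2 \<partial>Q)"
      unfolding w_def
    proof (rule Bochner_Integration.integral_cong[OF refl])
      fix a
      have "integrable Q (\<lambda>b. u (act (act x b) a))"
        unfolding comm[of x _ a] by (rule iu)
      then have "(\<integral>b. u (act (act x b) a) - u (act x b) \<partial>Q) = (\<integral>b. u (act (act x b) a) \<partial>Q) - u x"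
        using iu(1)[of x] harmonic[of x] by simp
      also have "(\<integral>b. u (act (act x b) a) \<partial>Q) = u (act x a)"
        unfolding comm[of x _ a] by (rule harmonic[symmetric])
      finally show "(u (act x a) - u x)\<^sup>2 = (\<integral>b. u (act (act x b) a) - u (act x b) \<partial>Q)\<^sup>2" by simp
    qed
    also have "\<dots> \<le> (\<integral>a. (\<integral>b. (u (act (act x b) a) - u (act x b))\<^sup>2 \<partial>Q) \<partial>Q)"
    proof (rule integral_mono)
      have [measurable]: "(\<lambda>b. u (act (act x b) a)) \<in> borel_measurable Q" for a
        unfolding comm[of x _ a] by measurable
      show "(\<integral>b. u (act (act x b) a) - u (act x b) \<partial>Q)\<^sup>2 \<le> (\<integral>b. (u (act (act x b) a) - u (act x b))\<^sup>2 \<partial>Q)" for a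
        by (rule Q.square_integral_le) (auto intro: d1)
      show "integrable Q (\<lambda>a. \<integral>b. (u (act (act x b) a) - u (act x b))\<^sup>2 \<partial>Q)"
        using d2 by (intro Q.integrable_const_bound[where B = 1])
          (auto intro!: Q.integral_le_const Q.integrable_const_bound[where B = 1])
      have "\<bar>\<integral>b. u (act (act x b) a) - u (act x b) \<partial>Q\<bar> \<le> 1" for a
        using d1 by (intro order_trans[OF integral_abs_bound] Q.integral_le_const Q.integrable_const_bound[where B = 1]) auto
      then show "integrable Q (\<lambda>a. (\<integral>b. u (act (act x b) a) - u (act x b) \<partial>Q)\<^sup>2)"
        by (intro Q.integrable_const_bound[where B = 1]) (auto simp: abs_square_le_1)
    qed
    also have "\<dots> = (\<integral>b. (\<integral>a. (u (act (act x b) a) - u (act x b))\<^sup>2 \<partial>Q) \<partial>Q)"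
      by (rule QQ.Fubini_integral) (use d2 in \<open>auto intro!: QQ.P.integrable_const_bound[where B = 1]\<close>)
    finally show ?thesis unfolding w_def .
  qed
  define g where "g k = ((\<lambda>g x. \<integral>a. g (act x a) \<partial>Q) ^^ k) (\<lambda>x. (u x)\<^sup>2)" for k
  have g_Suc: "g (Suc k) x = (\<integral>a. g k (act x a) \<partial>Q)" for k x by (simp add: g_def)
  have g: "g k \<in> borel_measurable borel \<and> (\<forall>x. 0 \<le> g k x \<and> g k x \<le> 1 \<and> (u x)\<^sup>2 + k * w x \<le> g k x)" for k
  proof (induction k)
    case 0
    then show ?case using u2 by (simp add: g_def)
  next
    case (Suc k)
    then have [measurable]: "g k \<in> borel_measurable borel" and b: "\<And>x. 0 \<le> g k x" "\<And>x. g k x \<le> 1"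
      and ge: "\<And>x. (u x)\<^sup>2 + k * w x \<le> g k x" by auto
    have ig: "integrable Q (\<lambda>a. g k (act x a))" for x
      using b by (auto intro!: Q.integrable_const_bound[where B = 1])
    have iw: "integrable Q (\<lambda>a. w (act x a))" for x
      using w01 by (auto intro!: Q.integrable_const_bound[where B = 1])
    have "g (Suc k) \<in> borel_measurable borel"
      unfolding g_Suc[abs_def] by measurable
    moreover have "0 \<le> g (Suc k) x" "g (Suc k) x \<le> 1" for x
      unfolding g_Suc using b ig by (auto intro!: Q.integral_le_const)
    moreover have "(u x)\<^sup>2 + Suc k * w x \<le> g (Suc k) x" for x
    proof -
      have "(u x)\<^sup>2 + Suc k * w x \<le> (\<integral>a. (u (act x a))\<^sup>2 \<partial>Q) + k * (\<integral>a. w (act x a) \<partial>Q)"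
        using w_eq[of x] mult_left_mono[OF w_sub[of x], of "real k"] by (simp add: algebra_simps)
      also have "\<dots> = (\<integral>a. (u (act x a))\<^sup>2 + k * w (act x a) \<partial>Q)"
        using iu[of x] iw[of x] by simp
      also have "\<dots> \<le> (\<integral>a. g k (act x a) \<partial>Q)"
        using ge iu iw ig by (intro integral_mono) auto
      finally show ?thesis unfolding g_Suc .
    qed
    ultimately show ?case by simp
  qed
  have "real k * w x \<le> 1" for k
    using g[of k] zero_le_power2[of "u x"] by (meson add_increasing2 order_trans add_increasing zero_le_power2 le_add_same_cancel2)
  then have "w x = 0"
    using w01(1)[of x] reals_Archimedean3[of "w x"] by (metis less_eq_real_def not_less order.asym)
  moreover have "integrable Q (\<lambda>a. (u (act x a) - u x)\<^sup>2)"
    using d2 by (auto intro!: Q.integrable_const_bound[where B = 1])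
  ultimately show ?thesis
    unfolding w_def by (subst (asm) integral_nonneg_eq_0_iff_AE) auto
qed

section \<open>Stationary systems of independent blocks and their zero-one law\<close>

lemma suminf_swap_ennreal:
  fixes g :: "nat \<Rightarrow> nat \<Rightarrow> ennreal"
  shows "(\<Sum>i. \<Sum>j. g i j) = (\<Sum>j. \<Sum>i. g i j)"
proof -
  have "(\<Sum>i. \<Sum>j. g i j) = (\<integral>\<^sup>+i. (\<Sum>j. g i j) \<partial>count_space UNIV)"
    by (simp add: nn_integral_count_space_nat)
  also have "\<dots> = (\<Sum>j. \<integral>\<^sup>+i. g i j \<partial>count_space UNIV)"
    by (rule nn_integral_suminf) simp
  finally show ?thesis by (simp add: nn_integral_count_space_nat)
qed

text \<open>The abstract form of a code-tree measure: \<open>G\<close> carries the sigma-algebra of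
  the first block and \<open>T\<close> is the neck shift. Invariance and independence of the first
  block from \<open>T\<close> make the successive blocks independent and identically
  distributed.\<close>

locale block_system = prob_space P for P :: "'w measure" +
  fixes G :: "'w measure" and T :: "'w \<Rightarrow> 'w"
  assumes T_meas [measurable]: "T \<in> P \<rightarrow>\<^sub>M P"
    and T_inv: "distr P P T = P"
    and space_G: "space G = space P" and sets_G: "sets G \<subseteq> sets P"
    and indep: "indep_set (sets G) (sets (vimage_algebra (space P) T P))"
begin

lemma id_meas [measurable]: "(\<lambda>\<omega>. \<omega>) \<in> P \<rightarrow>\<^sub>M G"
  using sets_G space_G by (intro measurableI) (auto dest: sets.sets_into_space)

definition Q :: "'w measure" where "Q = distr P G (\<lambda>\<omega>. \<omega>)"

lemma sets_Q [measurable_cong]: "sets Q = sets G" and space_Q: "space Q = space P"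
  by (simp_all add: Q_def space_G)

lemma prob_space_Q: "prob_space Q"
  unfolding Q_def by (rule prob_space_distr) simp

text \<open>The identity, regarded as a map into \<open>G\<close>, is the first block as a random
  variable. It is independent of \<open>T\<close>, and the law of \<open>T\<close> is
  \<open>P\<close> again.\<close>

lemma pair_law: "distr P (G \<Otimes>\<^sub>M P) (\<lambda>\<omega>. (\<omega>, T \<omega>)) = Q \<Otimes>\<^sub>M P"
proof -
  have "{(\<lambda>\<omega>. \<omega>) -` A \<inter> space P |A. A \<in> sets G} = sets G"
  proof (intro set_eqI iffI)
    fix A assume "A \<in> {(\<lambda>\<omega>. \<omega>) -` A \<inter> space P |A. A \<in> sets G}"
    then show "A \<in> sets G" by (auto simp flip: space_G)
  next
    fix A assume "A \<in> sets G"
    then show "A \<in> {(\<lambda>\<omega>. \<omega>) -` A \<inter> space P |A. A \<in> sets G}"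
      by (auto simp flip: space_G intro!: exI[of _ A] dest: sets.sets_into_space)
  qed
  then have "indep_var G (\<lambda>\<omega>. \<omega>) P T"
    unfolding indep_var_eq using indep sets.sigma_sets_eq[of G] space_G
    by (simp add: sets_vimage_algebra)
  then show ?thesis
    unfolding indep_var_distribution_eq Q_def by (simp add: T_inv)
qed

lemma pair_meas [measurable]: "(\<lambda>\<omega>. (\<omega>, T \<omega>)) \<in> P \<rightarrow>\<^sub>M G \<Otimes>\<^sub>M P"
  by measurable

lemma AE_shift: "(AE \<omega> in P. R \<omega>) \<Longrightarrow> (AE \<omega> in P. R (T \<omega>))"
  using AE_distrD[OF T_meas, of R] unfolding T_inv .

lemma emeasure_pair_law:
  assumes "X \<in> sets (G \<Otimes>\<^sub>M P)"
  shows "emeasure P {\<omega> \<in> space P. (\<omega>, T \<omega>) \<in> X} = (\<integral>\<^sup>+a. emeasure P {\<omega> \<in> space P. (a, \<omega>) \<in> X} \<partial>Q)"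
proof -
  have X: "X \<in> sets (Q \<Otimes>\<^sub>M P)" using assms by (simp cong: sets_pair_measure_cong add: sets_Q)
  have "emeasure P {\<omega> \<in> space P. (\<omega>, T \<omega>) \<in> X} = emeasure (distr P (G \<Otimes>\<^sub>M P) (\<lambda>\<omega>. (\<omega>, T \<omega>))) X"
    using assms by (subst emeasure_distr) (auto intro!: arg_cong[where f = "emeasure P"])
  also have "\<dots> = (\<integral>\<^sup>+a. emeasure P (Pair a -` X) \<partial>Q)"
    unfolding pair_law by (rule emeasure_pair_measure_alt[OF X])
  also have "\<dots> = (\<integral>\<^sup>+a. emeasure P {\<omega> \<in> space P. (a, \<omega>) \<in> X} \<partial>Q)"
  proof (intro nn_integral_cong arg_cong[where f = "emeasure P"])
    show "Pair a -` X = {\<omega> \<in> space P. (a, \<omega>) \<in> X}" for a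
      using sets.sets_into_space[OF X] by (auto simp: space_pair_measure)
  qed
  finally show ?thesis .
qed

text \<open>Fubini for the product law: in a relation between the first block of \<omega> and
  \<open>T \<omega>\<close>, the shifted point may be replaced by an independent copy. Measurability
  in \<open>G \<Otimes>\<^sub>M P\<close> says that \<open>R\<close> sees only the block of its
  first argument.\<close>

lemma AE_pair_law:
  assumes X: "{p \<in> space (G \<Otimes>\<^sub>M P). R (fst p) (snd p)} \<in> sets (G \<Otimes>\<^sub>M P)"
    and AE: "AE \<omega> in P. R \<omega> (T \<omega>)"
  shows "AE a in P. AE \<omega> in P. R a \<omega>"
proof -
  interpret Q: prob_space Q by (rule prob_space_Q)
  interpret QP: pair_prob_space Q P ..
  have "AE p in distr P (G \<Otimes>\<^sub>M P) (\<lambda>\<omega>. (\<omega>, T \<omega>)). R (fst p) (snd p)"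
    using AE by (subst AE_distr_iff[OF pair_meas X]) simp
  then have "AE a in Q. AE \<omega> in P. R a \<omega>"
    unfolding pair_law using QP.AE_pair by fastforce
  then show ?thesis
    unfolding Q_def using AE_distrD[OF id_meas] by fast
qed

text \<open>Conditions on finitely many blocks, one from \<open>G\<close> for each of \<omega>,
  \<open>T \<omega>\<close>, \<open>T (T \<omega>)\<close> and so on. They form an
  intersection-stable family.\<close>

inductive_set cylinder_events :: "'w set set" where
  space: "space P \<in> cylinder_events"
| step: "E \<in> sets G \<Longrightarrow> A \<in> cylinder_events \<Longrightarrow> E \<inter> T -` A \<inter> space P \<in> cylinder_events"

lemma cylinder_events_in_sets: "A \<in> cylinder_events \<Longrightarrow> A \<in> sets P"
proof (induction rule: cylinder_events.induct)
  case (step E A)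
  then have "E \<in> sets P" using sets_G by auto
  moreover have "T -` A \<inter> space P \<in> sets P" using step by (intro measurable_sets[OF T_meas])
  ultimately show ?case unfolding Int_assoc by (rule sets.Int)
qed simp

lemma cylinder_events_Int:
  "A \<in> cylinder_events \<Longrightarrow> B \<in> cylinder_events \<Longrightarrow> A \<inter> B \<in> cylinder_events"
proof (induction arbitrary: B rule: cylinder_events.induct)
  case space
  then show ?case using sets.Int_space_eq1[OF cylinder_events_in_sets[OF space]] by simp
next
  case (step E A)
  from step.prems show ?case
  proof cases
    case space
    have "E \<inter> T -` A \<inter> space P \<inter> B = E \<inter> T -` A \<inter> space P" unfolding space by blast
    then show ?thesis using cylinder_events.step[OF step.hyps(1,2)] by simp
  next
    case (step E' A')
    then have "E \<inter> T -` A \<inter> space P \<inter> B = (E \<inter> E') \<inter> T -` (A \<inter> A') \<inter> space P" by blast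
    moreover have "\<dots> \<in> cylinder_events"
      using step \<open>E \<in> sets G\<close> by (intro cylinder_events.step sets.Int \<open>\<And>B. B \<in> cylinder_events \<Longrightarrow> A \<inter> B \<in> cylinder_events\<close>) auto
    ultimately show ?thesis by simp
  qed
qed

text \<open>The events determined by the sequence of all blocks; in general these are fewer than the
  events of \<open>P\<close>.\<close>

definition blocks :: "'w measure" where
  "blocks = sigma (space P) cylinder_events"

lemma cylinder_events_Pow: "cylinder_events \<subseteq> Pow (space P)"
  using cylinder_events_in_sets sets.sets_into_space by blast

lemma space_blocks: "space blocks = space P"
  by (simp add: blocks_def space_measure_of_conv)

lemma sets_blocks: "sets blocks = sigma_sets (space P) cylinder_events"
  unfolding blocks_def using cylinder_events_Pow by (simp add: sets_measure_of)

lemma T_blocks: "T \<in> blocks \<rightarrow>\<^sub>M blocks"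
  unfolding blocks_def
proof (rule measurable_measure_of)
  show "T \<in> space (sigma (space P) cylinder_events) \<rightarrow> space P"
    using measurable_space[OF T_meas] by (auto simp: space_measure_of_conv)
  fix A assume "A \<in> cylinder_events"
  then have "space P \<inter> T -` A \<inter> space P \<in> cylinder_events"
    by (intro cylinder_events.step) (simp_all flip: space_G)
  moreover have "space P \<inter> T -` A \<inter> space P = T -` A \<inter> space P" by blast
  ultimately show "T -` A \<inter> space (sigma (space P) cylinder_events) \<in> sets (sigma (space P) cylinder_events)"
    using sets_blocks by (simp add: space_measure_of_conv blocks_def)
qed (rule cylinder_events_Pow)

lemma sets_G_blocks: "sets G \<subseteq> sets blocks"
proof
  fix E assume E: "E \<in> sets G"
  then have "E \<inter> T -` space P \<inter> space P \<in> cylinder_events" by (intro cylinder_events.intros)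
  moreover have "E \<inter> T -` space P \<inter> space P = E"
    using sets.sets_into_space[OF E] measurable_space[OF T_meas] by (auto simp: space_G)
  ultimately show "E \<in> sets blocks" by (simp add: sets_blocks)
qed

lemma G_blocks_measurable: "g \<in> G \<rightarrow>\<^sub>M M \<Longrightarrow> g \<in> blocks \<rightarrow>\<^sub>M M"
  using sets_G_blocks by (auto simp: measurable_def space_blocks space_G)

end

text \<open>\<open>y \<omega> t\<close> stands for the net measure at scale \<open>t\<close>, and
  \<open>\<rho> \<omega>\<close> for the ratios of the first block. The number of nodes in a block
  varies, so the ratios form a sequence padded with zeros, and \<open>y_0\<close> makes the padding
  harmless. The null set in \<open>y_eq\<close> may depend on \<open>t\<close>.\<close>

locale branching_system = block_system P G T
  for P :: "'w measure" and G T +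
  fixes y :: "'w \<Rightarrow> real \<Rightarrow> ennreal" and \<rho> :: "'w \<Rightarrow> nat \<Rightarrow> real"
  assumes y_meas [measurable]: "(\<lambda>(\<omega>, t). y \<omega> t) \<in> borel_measurable (P \<Otimes>\<^sub>M borel)"
    and \<rho>_meas: "\<And>i. (\<lambda>\<omega>. \<rho> \<omega> i) \<in> borel_measurable G"
    and y_0: "\<And>\<omega>. y \<omega> 0 = 0"
    and y_eq: "\<And>t. AE \<omega> in P. y \<omega> t = (\<Sum>i. y (T \<omega>) (t * \<rho> \<omega> i))"
begin

text \<open>\<open>act x \<omega>\<close> refines the family \<open>x\<close> of scales by the block of \<open>\<omega>\<close>; the pairs of indices are
  enumerated by \<open>prod_decode\<close>, so the action is commutative only up to a permutation.\<close>

definition act :: "(nat \<Rightarrow> real) \<Rightarrow> 'w \<Rightarrow> nat \<Rightarrow> real" where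
  "act x \<omega> k = x (fst (prod_decode k)) * \<rho> \<omega> (snd (prod_decode k))"

text \<open>The value when one and the same tree hangs below every node of a generation with ratios
  \<open>x\<close>: below a neck the subtrees are equal, not independent.\<close>

definition total :: "real \<Rightarrow> (nat \<Rightarrow> real) \<Rightarrow> 'w \<Rightarrow> ennreal" where
  "total t x \<omega> = (\<Sum>i. y \<omega> (t * x i))"

lemma act_meas [measurable]: "(\<lambda>(x, \<omega>). act x \<omega>) \<in> borel \<Otimes>\<^sub>M Q \<rightarrow>\<^sub>M borel"
proof -
  have [measurable]: "(\<lambda>x :: nat \<Rightarrow> real. x i) \<in> borel_measurable borel" for i by (rule measurable_coord_borel)
  have [measurable]: "(\<lambda>\<omega>. \<rho> \<omega> i) \<in> borel_measurable Q" for i using \<rho>_meas by (simp cong: measurable_cong_sets add: sets_Q)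
  show ?thesis unfolding split_beta'
    by (rule measurable_coordinatewise_then_product) (simp add: act_def)
qed

lemma total_meas [measurable]: "(\<lambda>(x, \<omega>). total t x \<omega>) \<in> borel_measurable (borel \<Otimes>\<^sub>M P)"
proof -
  have [measurable]: "(\<lambda>x :: nat \<Rightarrow> real. x i) \<in> borel_measurable borel" for i by (rule measurable_coord_borel)
  show ?thesis unfolding total_def by measurable
qed

lemma total_act: "total t (act x a) \<omega> = (\<Sum>i. \<Sum>j. y \<omega> (t * (x i * \<rho> a j)))"
  unfolding total_def act_def
  by (rule suminf_ennreal_2dimen[where f = "\<lambda>(i, j). y \<omega> (t * (x i * \<rho> a j))", simplified split_beta]) simp

lemma total_act_act: "total t (act (act x a) b) \<omega> = (\<Sum>i. \<Sum>j. \<Sum>k. y \<omega> (t * (x i * \<rho> a j * \<rho> b k)))"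
proof -
  have "total t (act (act x a) b) \<omega> = (\<Sum>m. \<Sum>k. y \<omega> (t * (x (fst (prod_decode m)) * \<rho> a (snd (prod_decode m)) * \<rho> b k)))"
    unfolding total_act by (simp add: act_def)
  also have "\<dots> = (\<Sum>i. \<Sum>j. \<Sum>k. y \<omega> (t * (x i * \<rho> a j * \<rho> b k)))"
    by (rule suminf_ennreal_2dimen[where f = "\<lambda>(i, j). \<Sum>k. y \<omega> (t * (x i * \<rho> a j * \<rho> b k))", simplified split_beta]) simp
  finally show ?thesis .
qed

lemma total_act_commute: "total t (act (act x a) b) \<omega> = total t (act (act x b) a) \<omega>"
proof -
  have "(\<Sum>j. \<Sum>k. y \<omega> (t * (x i * \<rho> a j * \<rho> b k))) = (\<Sum>j. \<Sum>k. y \<omega> (t * (x i * \<rho> b j * \<rho> a k)))" for i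
    by (subst suminf_swap_ennreal) (simp add: ac_simps)
  then show ?thesis unfolding total_act_act by simp
qed

lemma total_shift: "AE \<omega> in P. total t x \<omega> = total t (act x \<omega>) (T \<omega>)"
proof -
  have "AE \<omega> in P. \<forall>i. y \<omega> (t * x i) = (\<Sum>j. y (T \<omega>) (t * x i * \<rho> \<omega> j))"
    unfolding AE_all_countable using y_eq by blast
  then show ?thesis
    unfolding total_act by eventually_elim (simp add: total_def mult.assoc)
qed

definition total_prob :: "real \<Rightarrow> ennreal set \<Rightarrow> (nat \<Rightarrow> real) \<Rightarrow> real" where
  "total_prob t B x = prob {\<omega> \<in> space P. total t x \<omega> \<in> B}"

lemma total_event [measurable]: "B \<in> sets borel \<Longrightarrow> {\<omega> \<in> space P. total t x \<omega> \<in> B} \<in> sets P"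
proof -
  have [measurable]: "(\<lambda>\<omega>. total t x \<omega>) \<in> borel_measurable P"
    using measurable_compose[OF measurable_Pair1' total_meas, of x] by simp
  show "B \<in> sets borel \<Longrightarrow> {\<omega> \<in> space P. total t x \<omega> \<in> B} \<in> sets P"
    using measurable_sets[of "total t x" P borel B] by (simp add: vimage_def Int_def conj_commute)
qed

lemma total_prob_meas:
  assumes [measurable]: "B \<in> sets borel"
  shows "total_prob t B \<in> borel_measurable borel"
proof -
  have "{p \<in> space (borel \<Otimes>\<^sub>M P). total t (fst p) (snd p) \<in> B} \<in> sets (borel \<Otimes>\<^sub>M P)"
    using measurable_sets[OF total_meas assms] by (auto simp: vimage_def Int_def split_beta conj_commute)
  from measurable_emeasure_Pair[OF this]
  have "(\<lambda>x. enn2real (emeasure P (Pair x -` {p \<in> space (borel \<Otimes>\<^sub>M P). total t (fst p) (snd p) \<in> B}))) \<in> borel_measurable borel"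
    by measurable
  also have "(\<lambda>x. enn2real (emeasure P (Pair x -` {p \<in> space (borel \<Otimes>\<^sub>M P). total t (fst p) (snd p) \<in> B}))) = total_prob t B"
    by (auto simp: fun_eq_iff total_prob_def measure_def space_pair_measure vimage_def)
  finally show ?thesis .
qed

end

text \<open>A countable basis suffices: almost surely the value lies in exactly the basic sets of
  probability 1, and in a Hausdorff space these determine a point.\<close>

lemma (in prob_space) AE_const_if_zero_one:
  fixes X :: "'a \<Rightarrow> 'b::{second_countable_topology, t2_space}"
  assumes X [measurable]: "X \<in> borel_measurable M"
    and zo: "\<And>B. B \<in> sets borel \<Longrightarrow> prob {\<omega> \<in> space M. X \<omega> \<in> B} \<in> {0, 1}"
  shows "\<exists>c. AE \<omega> in M. X \<omega> = c"
proof -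
  obtain \<B> :: "'b set set" where \<B>: "countable \<B>" "topological_basis \<B>"
    using ex_countable_basis by blast
  have "AE \<omega> in M. X \<omega> \<in> B \<longleftrightarrow> prob {\<omega> \<in> space M. X \<omega> \<in> B} = 1" if "B \<in> \<B>" for B
  proof -
    have B [measurable]: "B \<in> sets borel" using topological_basis_open[OF \<B>(2) that] by simp
    have S: "{\<omega> \<in> space M. X \<omega> \<in> B} \<in> sets M" by measurable
    from zo[OF B] consider "prob {\<omega> \<in> space M. X \<omega> \<in> B} = 0" | "prob {\<omega> \<in> space M. X \<omega> \<in> B} = 1" by auto
    then show ?thesis
    proof cases
      case 1
      then have "AE \<omega> in M. X \<omega> \<notin> B" using prob_eq_0[OF S] by (auto simp: AE_space)
      with 1 show ?thesis by simp
    next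
      case 2
      then have "AE \<omega> in M. X \<omega> \<in> B" using prob_eq_1[OF S] by auto
      with 2 show ?thesis by simp
    qed
  qed
  then have AE: "AE \<omega> in M. \<forall>B\<in>\<B>. X \<omega> \<in> B \<longleftrightarrow> prob {\<omega> \<in> space M. X \<omega> \<in> B} = 1"
    using \<B>(1) by (subst AE_ball_countable) auto
  have eq: "X \<omega> = X \<omega>'"
    if "\<forall>B\<in>\<B>. X \<omega> \<in> B \<longleftrightarrow> prob {\<omega> \<in> space M. X \<omega> \<in> B} = 1"
       "\<forall>B\<in>\<B>. X \<omega>' \<in> B \<longleftrightarrow> prob {\<omega> \<in> space M. X \<omega> \<in> B} = 1" for \<omega> \<omega>'
  proof (rule ccontr)
    assume "X \<omega> \<noteq> X \<omega>'"
    from hausdorff[OF this] obtain U V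
      where UV: "open U" "X \<omega> \<in> U" "X \<omega>' \<in> V" "U \<inter> V = {}" by blast
    from topological_basisE[OF \<B>(2) UV(1,2)] obtain B where "B \<in> \<B>" "X \<omega> \<in> B" "B \<subseteq> U" .
    with UV that show False by blast
  qed
  from AE obtain \<omega>' where "\<forall>B\<in>\<B>. X \<omega>' \<in> B \<longleftrightarrow> prob {\<omega> \<in> space M. X \<omega> \<in> B} = 1"
    using eventually_happens'[OF ae_filter_bot AE] by blast
  then show ?thesis using AE eq by (intro exI[of _ "X \<omega>'"]) (auto elim!: eventually_mono)
qed

context branching_system
begin

definition total_in :: "real \<Rightarrow> ennreal set \<Rightarrow> (nat \<Rightarrow> real) \<Rightarrow> 'w set" where
  "total_in t B x = {\<omega> \<in> space P. total t x \<omega> \<in> B}"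

lemma total_prob_eq: "total_prob t B x = prob (total_in t B x)"
  by (simp add: total_prob_def total_in_def)

lemma total_in_sets [measurable]: "B \<in> sets borel \<Longrightarrow> total_in t B x \<in> sets P"
  unfolding total_in_def by (rule total_event)

lemma act_meas_G: "(\<lambda>a. act x a) \<in> G \<rightarrow>\<^sub>M borel"
  unfolding act_def[abs_def]
  by (intro measurable_coordinatewise_then_product borel_measurable_times borel_measurable_const \<rho>_meas)

lemma act_meas_Q [measurable]: "(\<lambda>a. act x a) \<in> Q \<rightarrow>\<^sub>M borel"
  using act_meas_G by (simp cong: measurable_cong_sets add: sets_Q)

text \<open>Conditioning on the first block: by \<open>total_shift\<close> the value at the scales
  \<open>x\<close> is that of the shifted point at the scales refined by the block, and the shifted
  point is independent of the block.\<close>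

lemma total_split:
  assumes B: "B \<in> sets borel" and E: "E \<in> sets G" and A: "A \<in> sets P"
  shows "emeasure P (total_in t B x \<inter> (E \<inter> T -` A \<inter> space P))
    = (\<integral>\<^sup>+a. indicator E a * emeasure P (total_in t B (act x a) \<inter> A) \<partial>Q)"
proof -
  define X where "X = {p \<in> space (G \<Otimes>\<^sub>M P). fst p \<in> E \<and> snd p \<in> A \<and> total t (act x (fst p)) (snd p) \<in> B}"
  have tm: "(\<lambda>p. total t (act x (fst p)) (snd p)) \<in> borel_measurable (G \<Otimes>\<^sub>M P)"
  proof -
    have "(\<lambda>p. (act x (fst p), snd p)) \<in> G \<Otimes>\<^sub>M P \<rightarrow>\<^sub>M borel \<Otimes>\<^sub>M P"
      by (intro measurable_Pair measurable_compose[OF measurable_fst act_meas_G] measurable_snd)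
    from measurable_compose[OF this total_meas] show ?thesis by simp
  qed
  have "X = (\<lambda>p. total t (act x (fst p)) (snd p)) -` B \<inter> space (G \<Otimes>\<^sub>M P) \<inter> (E \<times> A)"
    by (auto simp: X_def)
  also have "\<dots> \<in> sets (G \<Otimes>\<^sub>M P)" using E A by (intro sets.Int measurable_sets[OF tm B] pair_measureI)
  finally have X: "X \<in> sets (G \<Otimes>\<^sub>M P)" .
  have X': "{\<omega> \<in> space P. (\<omega>, T \<omega>) \<in> X} \<in> sets P"
    using measurable_sets[OF pair_meas X] by (simp add: vimage_def Int_def conj_commute)
  have ET: "E \<inter> T -` A \<inter> space P \<in> sets P"
  proof -
    have "E \<inter> (T -` A \<inter> space P) \<in> sets P"
      using E A sets_G by (intro sets.Int measurable_sets[OF T_meas]) auto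
    then show ?thesis by (simp only: Int_assoc)
  qed
  have "emeasure P (total_in t B x \<inter> (E \<inter> T -` A \<inter> space P)) = emeasure P {\<omega> \<in> space P. (\<omega>, T \<omega>) \<in> X}"
  proof (rule emeasure_eq_AE)
    show "AE \<omega> in P. \<omega> \<in> total_in t B x \<inter> (E \<inter> T -` A \<inter> space P) \<longleftrightarrow> \<omega> \<in> {\<omega> \<in> space P. (\<omega>, T \<omega>) \<in> X}"
      using total_shift[of t x] AE_space
    proof eventually_elim
      case (elim \<omega>)
      then show ?case using measurable_space[OF T_meas]
        by (auto simp: total_in_def X_def space_pair_measure space_G)
    qed
  qed (use X' ET B in auto)
  also have "\<dots> = (\<integral>\<^sup>+a. emeasure P {\<omega> \<in> space P. (a, \<omega>) \<in> X} \<partial>Q)"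
    by (rule emeasure_pair_law[OF X])
  also have "\<dots> = (\<integral>\<^sup>+a. indicator E a * emeasure P (total_in t B (act x a) \<inter> A) \<partial>Q)"
  proof (rule nn_integral_cong)
    fix a assume "a \<in> space Q"
    then have "{\<omega> \<in> space P. (a, \<omega>) \<in> X} = (if a \<in> E then total_in t B (act x a) \<inter> A else {})"
      using sets.sets_into_space[OF A] by (auto simp: X_def total_in_def space_pair_measure space_Q space_G)
    then show "emeasure P {\<omega> \<in> space P. (a, \<omega>) \<in> X} = indicator E a * emeasure P (total_in t B (act x a) \<inter> A)"
      by (auto simp: indicator_def)
  qed
  finally show ?thesis .
qed

lemma total_prob_harmonic:
  assumes B: "B \<in> sets borel"
  shows "total_prob t B x = (\<integral>a. total_prob t B (act x a) \<partial>Q)"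
proof -
  interpret Q: prob_space Q by (rule prob_space_Q)
  have "integrable Q (\<lambda>a. total_prob t B (act x a))"
    using measurable_compose[OF act_meas_Q total_prob_meas[OF B]]
    by (intro Q.integrable_const_bound[where B = 1]) (auto simp: total_prob_def)
  then have "ennreal (\<integral>a. total_prob t B (act x a) \<partial>Q) = (\<integral>\<^sup>+a. ennreal (total_prob t B (act x a)) \<partial>Q)"
    by (intro nn_integral_eq_integral[symmetric]) (auto simp: total_prob_def)
  also have "\<dots> = (\<integral>\<^sup>+a. indicator (space P) a * emeasure P (total_in t B (act x a) \<inter> space P) \<partial>Q)"
    using total_in_sets[OF B, THEN sets.Int_space_eq2]
    by (intro nn_integral_cong) (auto simp: space_Q total_prob_eq emeasure_eq_measure)
  also have "\<dots> = emeasure P (total_in t B x \<inter> (space P \<inter> T -` space P \<inter> space P))"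
    using B sets.top[of G] by (intro total_split[symmetric]) (auto simp: space_G)
  also have "total_in t B x \<inter> (space P \<inter> T -` space P \<inter> space P) = total_in t B x"
    using measurable_space[OF T_meas] by (auto simp: total_in_def)
  finally show ?thesis
    by (simp add: total_prob_eq emeasure_eq_measure)
qed

text \<open>Choquet--Deny for the law of \<open>total\<close>: refining the scales by almost any
  block leaves this law unchanged. The required commutativity holds at the level of sums.\<close>

lemma total_prob_invariant:
  assumes B: "B \<in> sets borel"
  shows "AE a in Q. total_prob t B (act x a) = total_prob t B x"
  using prob_space_Q act_meas total_prob_meas[OF B]
proof (rule bounded_harmonic_invariant)
  show "total_prob t B x = (\<integral>a. total_prob t B (act x a) \<partial>Q)" for x by (rule total_prob_harmonic[OF B])
  show "total_prob t B (act (act x a) b) = total_prob t B (act (act x b) a)" for x a b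
    unfolding total_prob_def total_act_commute[of t x a b] ..
qed (auto simp: total_prob_def)

text \<open>Given the first block \<open>a\<close>, the event has the probability belonging to the
  scales \<open>act x a\<close>, which by invariance is the one belonging to \<open>x\<close>. So
  the block carries no information about \<open>total\<close>; the induction treats the next block
  with the refined scales.\<close>

lemma indep_cylinder_events:
  assumes B: "B \<in> sets borel"
  shows "A \<in> cylinder_events \<Longrightarrow> prob (total_in t B x \<inter> A) = total_prob t B x * prob A"
proof (induction arbitrary: x rule: cylinder_events.induct)
  case space
  then show ?case using sets.Int_space_eq2[OF total_in_sets[OF B]] by (simp add: total_prob_eq prob_space)
next
  case (step E A)
  have A: "A \<in> sets P" by (rule cylinder_events_in_sets[OF step(2)])
  have E: "E \<in> sets Q" using step by (simp add: sets_Q)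
  have "emeasure P (total_in t B x \<inter> (E \<inter> T -` A \<inter> space P))
      = (\<integral>\<^sup>+a. indicator E a * emeasure P (total_in t B (act x a) \<inter> A) \<partial>Q)"
    by (rule total_split[OF B step(1) A])
  also have "\<dots> = (\<integral>\<^sup>+a. ennreal (total_prob t B x * prob A) * indicator E a \<partial>Q)"
    using total_prob_invariant[OF B, of t x]
    by (intro nn_integral_cong_AE) (auto elim!: eventually_mono simp: emeasure_eq_measure step mult.commute)
  also have "\<dots> = ennreal (total_prob t B x * prob A) * emeasure Q E"
    using E by (rule nn_integral_cmult_indicator)
  finally have 1: "emeasure P (total_in t B x \<inter> (E \<inter> T -` A \<inter> space P)) = ennreal (total_prob t B x * prob A) * emeasure Q E" .
  \<comment> \<open>With \<open>UNIV\<close> in place of \<open>B\<close>, the same splitting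
    formula computes the probability of the cylinder event alone.\<close>
  have U: "total_in t UNIV x = space P" for x by (auto simp: total_in_def)
  have "E \<inter> T -` A \<inter> space P = total_in t UNIV x \<inter> (E \<inter> T -` A \<inter> space P)" by (auto simp: U)
  also have "emeasure P \<dots> = (\<integral>\<^sup>+a. indicator E a * emeasure P (total_in t UNIV (act x a) \<inter> A) \<partial>Q)"
    by (rule total_split) (use step A in auto)
  also have "\<dots> = (\<integral>\<^sup>+a. emeasure P A * indicator E a \<partial>Q)"
    using sets.Int_space_eq1[OF A] by (simp add: U mult.commute)
  also have "\<dots> = emeasure P A * emeasure Q E"
    using E by (rule nn_integral_cmult_indicator)
  finally have 2: "emeasure P (E \<inter> T -` A \<inter> space P) = emeasure P A * emeasure Q E" .
  have "ennreal (prob (total_in t B x \<inter> (E \<inter> T -` A \<inter> space P))) = ennreal (total_prob t B x * prob (E \<inter> T -` A \<inter> space P))"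
    using 1 2 by (simp add: emeasure_eq_measure ennreal_mult total_prob_def mult.assoc)
  then show ?case by (simp add: total_prob_def)
qed

lemma indep_blocks:
  assumes B: "B \<in> sets borel" and A: "A \<in> sets blocks"
  shows "prob (total_in t B x \<inter> A) = total_prob t B x * prob A"
proof -
  have sub: "sigma_sets (space P) cylinder_events \<subseteq> sets P"
    using cylinder_events_in_sets by (intro sets.sigma_sets_subset) auto
  have "Int_stable cylinder_events" by (auto simp: Int_stable_def cylinder_events_Int)
  moreover have "A \<in> sigma_sets (space P) cylinder_events" using A by (simp add: sets_blocks)
  ultimately show ?thesis
  proof (induction rule: sigma_sets_induct_disjoint[OF _ cylinder_events_Pow, consumes 2, case_names basic empty compl union])
    case (basic A)
    then show ?case by (rule indep_cylinder_events[OF B])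
  next
    case empty
    show ?case by simp
  next
    case (compl A)
    then have [measurable]: "A \<in> sets P" using sub by auto
    have "total_in t B x \<inter> (space P - A) = total_in t B x - (total_in t B x \<inter> A)"
      by (auto simp: total_in_def)
    then have "prob (total_in t B x \<inter> (space P - A)) = prob (total_in t B x) - prob (total_in t B x \<inter> A)"
      using B by (simp add: finite_measure_Diff)
    then show ?case using compl by (simp add: prob_compl total_prob_eq algebra_simps)
  next
    case (union A)
    then have m [measurable]: "A i \<in> sets P" for i using sub by auto
    have "(\<lambda>i. prob (total_in t B x \<inter> A i)) sums prob (\<Union>i. total_in t B x \<inter> A i)"
      using union(1) B by (intro finite_measure_UNION) (auto simp: disjoint_family_on_def)
    moreover have "(\<lambda>i. total_prob t B x * prob (A i)) sums (total_prob t B x * prob (\<Union>i. A i))"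
      using union(1) by (intro sums_mult finite_measure_UNION) auto
    ultimately show ?case using union by (simp add: sums_iff)
  qed
qed

text \<open>The events determined by \<open>y\<close> at \<open>t\<close> are almost surely block
  events, hence independent of themselves. The scale sequence \<open>e\<close> with the single entry
  1 exhibits \<open>y\<close> as an instance of \<open>total\<close>.\<close>

lemma y_AE_const:
  assumes g: "g \<in> borel_measurable blocks" and eq: "AE \<omega> in P. y \<omega> t = g \<omega>"
  shows "\<exists>c. AE \<omega> in P. y \<omega> t = c"
proof (rule AE_const_if_zero_one)
  have ym: "(\<lambda>\<omega>. y \<omega> t) \<in> borel_measurable P"
    using measurable_compose[OF _ y_meas, of "\<lambda>\<omega>. (\<omega>, t)" P] by simp
  then show "(\<lambda>\<omega>. y \<omega> t) \<in> borel_measurable P" .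
  fix B :: "ennreal set" assume B: "B \<in> sets borel"
  define e where "e i = (if i = 0 then 1 else 0 :: real)" for i :: nat
  have e: "total t e \<omega> = y \<omega> t" for \<omega>
  proof -
    have "total t e \<omega> = (\<Sum>i\<in>{0}. y \<omega> (t * e i))"
      unfolding total_def by (rule suminf_finite) (auto simp: e_def y_0)
    then show ?thesis by (simp add: e_def)
  qed
  let ?A = "g -` B \<inter> space P"
  have A: "?A \<in> sets blocks" using measurable_sets[OF g B] by (simp add: space_blocks)
  have "sigma_sets (space P) cylinder_events \<subseteq> sets P"
    using cylinder_events_in_sets by (intro sets.sigma_sets_subset) auto
  then have AP: "?A \<in> sets P" using A by (auto simp: sets_blocks)
  have "prob (total_in t B e) = prob ?A"
    using eq by (intro measure_eq_AE) (auto simp: total_in_def e AP B elim!: eventually_mono intro!: total_event[of B t e, unfolded e])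
  moreover have "prob (total_in t B e \<inter> ?A) = prob ?A"
    using eq B AP by (intro measure_eq_AE) (auto simp: total_in_def e elim!: eventually_mono intro!: sets.Int total_event[of B t e, unfolded e])
  moreover have "prob (total_in t B e \<inter> ?A) = prob (total_in t B e) * prob ?A"
    using indep_blocks[OF B A] by (simp add: total_prob_eq)
  ultimately have "prob (total_in t B e) \<in> {0, 1}" by auto
  then show "prob {\<omega> \<in> space P. y \<omega> t \<in> B} \<in> {0, 1}" by (simp add: total_in_def e)
qed

text \<open>The scales \<open>t * \<rho> \<omega> i\<close> are random, whereas the exceptional set
  of \<open>a\<close> belongs to a fixed scale, so \<open>a\<close> cannot be inserted for
  \<open>y (T \<omega>)\<close> directly. After decoupling, the block is fixed and only countably
  many null sets occur.\<close>

lemma const_functional_equation: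
  assumes a: "\<And>t. AE \<omega> in P. y \<omega> t = a t"
  shows "AE \<omega> in P. a t = (\<Sum>i. a (t * \<rho> \<omega> i))"
proof -
  have "AE \<omega> in P. a t = (\<Sum>i. y (T \<omega>) (t * \<rho> \<omega> i))"
    using a[of t] y_eq[of t] by eventually_elim simp
  moreover have "{p \<in> space (G \<Otimes>\<^sub>M P). a t = (\<Sum>i. y (snd p) (t * \<rho> (fst p) i))} \<in> sets (G \<Otimes>\<^sub>M P)"
  proof -
    have [measurable]: "(\<lambda>\<omega>. \<rho> \<omega> i) \<in> borel_measurable G" for i by (rule \<rho>_meas)
    show ?thesis by measurable
  qed
  ultimately have "AE \<omega>' in P. AE \<omega> in P. a t = (\<Sum>i. y \<omega> (t * \<rho> \<omega>' i))"
    by (intro AE_pair_law)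
  then show ?thesis
  proof eventually_elim
    case (elim \<omega>')
    have "AE \<omega> in P. \<forall>i. y \<omega> (t * \<rho> \<omega>' i) = a (t * \<rho> \<omega>' i)"
      unfolding AE_all_countable using a by blast
    with elim have "AE \<omega> in P. a t = (\<Sum>i. a (t * \<rho> \<omega>' i))" by eventually_elim simp
    then show ?case by simp
  qed
qed

end

section \<open>Exponents of functional equations\<close>

text \<open>At exponent 0 the sum counts \<open>S\<close> and is at least 1; at a large exponent it
  is below 1. A singleton \<open>S\<close> has exponent 0.\<close>

lemma exponent_exists:
  fixes c :: "'v \<Rightarrow> real"
  assumes "finite S" "S \<noteq> {}" "\<And>v. v \<in> S \<Longrightarrow> 0 < c v \<and> c v < 1"
  shows "\<exists>s\<ge>0. (\<Sum>v\<in>S. c v powr s) = 1"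
proof -
  have "norm (c v) < 1" if "v \<in> S" for v using assms(3)[OF that] by simp
  then have "(\<lambda>n. \<Sum>v\<in>S. c v ^ n) \<longlonglongrightarrow> (\<Sum>v\<in>S. 0)"
    by (intro tendsto_sum LIMSEQ_power_zero)
  then have "\<forall>\<^sub>F n in sequentially. (\<Sum>v\<in>S. c v ^ n) < 1"
    by (intro order_tendstoD) auto
  then obtain n where "(\<Sum>v\<in>S. c v ^ n) < 1"
    unfolding eventually_sequentially by blast
  then have "(\<Sum>v\<in>S. c v powr real n) \<le> 1"
    using assms by (simp add: powr_realpow cong: sum.cong)
  moreover have "1 \<le> (\<Sum>v\<in>S. c v powr 0)"
  proof -
    have "(\<Sum>v\<in>S. c v powr 0) = (\<Sum>v\<in>S. 1)"
      by (rule sum.cong) (use assms(3) in force)+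
    then have "(\<Sum>v\<in>S. c v powr 0) = real (card S)" by simp
    moreover have "0 < card S" using assms by (simp add: card_gt_0_iff)
    ultimately show ?thesis by simp
  qed
  moreover have "continuous_on {0..real n} (\<lambda>s. \<Sum>v\<in>S. c v powr s)"
    using assms(3) by (intro continuous_on_sum continuous_on_powr continuous_intros) force
  ultimately show ?thesis
    using IVT2'[of "\<lambda>s. \<Sum>v\<in>S. c v powr s" "real n" 1 0] by auto
qed

text \<open>A monotone solution of \<open>b t = (\<Sum>v. b (t * c v))\<close> is of order \<open>t powr s\<close>: the functional equation
  is applied until all arguments lie between \<open>\<gamma> * x\<close> and \<open>x\<close>.\<close>

lemma functional_equation_bounds:
  fixes c :: "'v \<Rightarrow> real" and b :: "real \<Rightarrow> real"
  assumes c: "\<And>v. v \<in> S \<Longrightarrow> \<gamma> \<le> c v \<and> c v \<le> m" and \<gamma>: "0 < \<gamma>" "\<gamma> \<le> 1" and m: "0 < m" "m < 1"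
    and s: "0 \<le> s" "(\<Sum>v\<in>S. c v powr s) = 1"
    and mono: "\<And>t t'. 0 < t \<Longrightarrow> t \<le> t' \<Longrightarrow> t' \<le> 1 \<Longrightarrow> b t \<le> b t'" and nonneg: "\<And>t. 0 \<le> b t"
    and eq: "\<And>t. 0 < t \<Longrightarrow> t \<le> 1 \<Longrightarrow> b t = (\<Sum>v\<in>S. b (t * c v))"
    and x: "0 < x" "x \<le> 1"
  shows "b 1 \<le> b x * (1 / (\<gamma> * x)) powr s" "b (\<gamma> * x) * (1 / x) powr s \<le> b 1"
proof -
  have near: "b t \<le> b x * (t / (\<gamma> * x)) powr s" "b (\<gamma> * x) * (t / x) powr s \<le> b t"
    if t: "\<gamma> * x \<le> t" "t \<le> x" for t
  proof -
    have t0: "0 < t" using t \<gamma> x by (meson less_le_trans mult_pos_pos)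
    have "1 \<le> (t / (\<gamma> * x)) powr s"
      using t \<gamma> x s by (intro ge_one_powr_ge_zero) (simp_all add: field_simps)
    then have "b x * 1 \<le> b x * (t / (\<gamma> * x)) powr s" by (intro mult_left_mono nonneg)
    moreover have "b t \<le> b x" using t t0 x by (intro mono) auto
    ultimately show "b t \<le> b x * (t / (\<gamma> * x)) powr s" by simp
    have "(t / x) powr s \<le> 1" using t t0 x s by (intro powr_le1) simp_all
    then have "b (\<gamma> * x) * (t / x) powr s \<le> b (\<gamma> * x) * 1" by (intro mult_left_mono nonneg)
    moreover have "b (\<gamma> * x) \<le> b t" using t \<gamma> x by (intro mono) auto
    ultimately show "b (\<gamma> * x) * (t / x) powr s \<le> b t" by simp
  qed
  \<comment> \<open>Induction on the number \<open>k\<close> of refinements that bring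
    \<open>t\<close> down to at most \<open>x\<close>. A step from above \<open>x\<close> cannot
    jump below \<open>\<gamma> * x\<close>, and the weights \<open>c v powr s\<close> sum to 1, so
    both bounds are inherited.\<close>
  have claim: "b t \<le> b x * (t / (\<gamma> * x)) powr s \<and> b (\<gamma> * x) * (t / x) powr s \<le> b t"
    if "\<gamma> * x \<le> t" "t \<le> 1" "t * m ^ k \<le> x" for t k
    using that
  proof (induction k arbitrary: t)
    case 0
    then show ?case using near[of t] by simp
  next
    case (Suc k)
    show ?case
    proof (cases "t \<le> x")
      case True
      then show ?thesis using near[of t] Suc by simp
    next
      case False
      then have t: "x < t" "0 < t" using x by auto
      have IH: "b (t * c v) \<le> b x * (t * c v / (\<gamma> * x)) powr s \<and> b (\<gamma> * x) * (t * c v / x) powr s \<le> b (t * c v)"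
        if v: "v \<in> S" for v
      proof (rule Suc.IH)
        show "\<gamma> * x \<le> t * c v" using c[OF v] t \<gamma> x by (subst mult.commute) (intro mult_mono, auto)
        show "t * c v \<le> 1" using c[OF v] t Suc.prems m \<gamma> by (intro mult_le_one) auto
        have "t * c v * m ^ k \<le> t * m * m ^ k"
          using c[OF v] t m by (intro mult_right_mono mult_left_mono) auto
        then show "t * c v * m ^ k \<le> x" using Suc.prems by (simp add: mult.assoc)
      qed
      have cv: "(t * c v / z) powr s = (t / z) powr s * c v powr s" if "v \<in> S" "0 < z" for v z
      proof -
        have "t * c v / z = (t / z) * c v" by simp
        then show ?thesis using that c[OF that(1)] \<gamma> t by (simp only: powr_mult)
      qed
      have "b t = (\<Sum>v\<in>S. b (t * c v))" using Suc.prems t by (intro eq) auto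
      also have "\<dots> \<le> (\<Sum>v\<in>S. b x * (t * c v / (\<gamma> * x)) powr s)" using IH by (intro sum_mono) auto
      also have "\<dots> = (\<Sum>v\<in>S. b x * (t / (\<gamma> * x)) powr s * c v powr s)"
        using \<gamma> x by (intro sum.cong refl) (simp only: cv mult.assoc mult_pos_pos)
      also have "\<dots> = b x * (t / (\<gamma> * x)) powr s" by (simp add: s(2) flip: sum_distrib_left)
      finally have 1: "b t \<le> b x * (t / (\<gamma> * x)) powr s" .
      have "b (\<gamma> * x) * (t / x) powr s = (\<Sum>v\<in>S. b (\<gamma> * x) * (t / x) powr s * c v powr s)"
        by (simp add: s(2) flip: sum_distrib_left)
      also have "\<dots> = (\<Sum>v\<in>S. b (\<gamma> * x) * (t * c v / x) powr s)"
        using x by (intro sum.cong refl) (simp only: cv mult.assoc)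
      also have "\<dots> \<le> (\<Sum>v\<in>S. b (t * c v))" using IH by (intro sum_mono) auto
      also have "\<dots> = b t" using Suc.prems t by (intro eq[symmetric]) auto
      finally show ?thesis using 1 by simp
    qed
  qed
  obtain k where "m ^ k < x" using real_arch_pow_inv[OF x(1) m(2)] by blast
  then have "b 1 \<le> b x * (1 / (\<gamma> * x)) powr s \<and> b (\<gamma> * x) * (1 / x) powr s \<le> b 1"
    using \<gamma> x by (intro claim[of 1 k]) (auto intro: mult_le_one)
  then show "b 1 \<le> b x * (1 / (\<gamma> * x)) powr s" "b (\<gamma> * x) * (1 / x) powr s \<le> b 1" by auto
qed

text \<open>By the two bounds, \<open>b x\<close> is at least of order \<open>x powr s\<close> and
  at most of order \<open>x powr s'\<close>; for small \<open>x\<close> this excludes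
  \<open>s < s'\<close>.\<close>

lemma functional_equation_exponent_le:
  fixes c :: "'v \<Rightarrow> real" and c' :: "'u \<Rightarrow> real" and b :: "real \<Rightarrow> real"
  assumes c: "\<And>v. v \<in> S \<Longrightarrow> \<gamma> \<le> c v \<and> c v \<le> m" and \<gamma>: "0 < \<gamma>" "\<gamma> \<le> 1"
    and s: "0 \<le> s" "(\<Sum>v\<in>S. c v powr s) = 1"
    and c': "\<And>v. v \<in> S' \<Longrightarrow> \<gamma>' \<le> c' v \<and> c' v \<le> m" and \<gamma>': "0 < \<gamma>'" "\<gamma>' \<le> 1"
    and s': "0 \<le> s'" "(\<Sum>v\<in>S'. c' v powr s') = 1"
    and m: "0 < m" "m < 1"
    and mono: "\<And>t t'. 0 < t \<Longrightarrow> t \<le> t' \<Longrightarrow> t' \<le> 1 \<Longrightarrow> b t \<le> b t'" and nonneg: "\<And>t. 0 \<le> b t"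
    and eq: "\<And>t. 0 < t \<Longrightarrow> t \<le> 1 \<Longrightarrow> b t = (\<Sum>v\<in>S. b (t * c v))"
    and eq': "\<And>t. 0 < t \<Longrightarrow> t \<le> 1 \<Longrightarrow> b t = (\<Sum>v\<in>S'. b (t * c' v))"
    and b1: "0 < b 1"
  shows "s' \<le> s"
proof (rule ccontr)
  assume "\<not> s' \<le> s"
  then have ss: "0 < s' - s" by simp
  \<comment> \<open>The bounds at \<open>\<gamma>' * x\<close> will force
    \<open>(\<gamma> * \<gamma>') powr s \<le> x powr (s' - s)\<close>. The point \<open>x\<close>
    is chosen so that the right-hand side equals \<open>z\<close>, half of the left-hand
    side.\<close>
  define z where "z = (\<gamma> * \<gamma>') powr s / 2"
  have z: "0 < z" "z \<le> 1"
    using \<gamma> \<gamma>' s powr_le1[of s "\<gamma> * \<gamma>'"] by (auto simp: z_def mult_le_one)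
  define x where "x = z powr (1 / (s' - s))"
  have x: "0 < x" "x \<le> 1" using z ss by (auto simp: x_def intro!: powr_le1)
  have gx: "0 < \<gamma>' * x" "\<gamma>' * x \<le> 1" using \<gamma>' x by (auto intro: mult_le_one)
  have "b 1 \<le> b (\<gamma>' * x) * (1 / (\<gamma> * (\<gamma>' * x))) powr s"
    by (rule functional_equation_bounds(1)[OF c \<gamma> m s mono nonneg eq gx])
  also have "\<dots> = b (\<gamma>' * x) / (\<gamma> * \<gamma>' * x) powr s"
    using \<gamma> \<gamma>' x by (subst powr_divide) (simp_all add: mult.assoc)
  finally have 1: "b 1 * (\<gamma> * \<gamma>' * x) powr s \<le> b (\<gamma>' * x)"
    using \<gamma> \<gamma>' x by (simp add: pos_le_divide_eq)
  have "b (\<gamma>' * x) * (1 / x) powr s' \<le> b 1"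
    by (rule functional_equation_bounds(2)[OF c' \<gamma>' m s' mono nonneg eq' x])
  then have "b (\<gamma>' * x) \<le> b 1 * x powr s'"
    using x by (simp add: powr_divide pos_divide_le_eq)
  with 1 have "b 1 * (\<gamma> * \<gamma>' * x) powr s \<le> b 1 * x powr s'" by linarith
  then have "(\<gamma> * \<gamma>' * x) powr s \<le> x powr s'" using b1 by simp
  also have "x powr s' = x powr (s' - s) * x powr s" by (simp flip: powr_add)
  also have "(\<gamma> * \<gamma>' * x) powr s = (\<gamma> * \<gamma>') powr s * x powr s"
    using \<gamma> \<gamma>' x by (intro powr_mult) 
  finally have "(\<gamma> * \<gamma>') powr s \<le> x powr (s' - s)" using x by simp
  also have "x powr (s' - s) = z" using ss z by (simp add: x_def powr_powr)
  finally show False using z by (simp add: z_def)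
qed

text \<open>One null set serves only countably many \<open>t\<close>, so for a given block the
  equation is available at rational \<open>t\<close>, with values of \<open>a\<close> at the
  arbitrary reals \<open>t * c v\<close>. As \<open>a\<close> may jump, it need not extend to all
  \<open>t\<close>; for the left limit it does.\<close>

definition left_limit :: "(real \<Rightarrow> ennreal) \<Rightarrow> real \<Rightarrow> ennreal" where
  "left_limit a t = (SUP q\<in>{q\<in>\<rat>. q < t}. a q)"

lemma left_limit_mono: "t \<le> t' \<Longrightarrow> left_limit a t \<le> left_limit a t'"
  unfolding left_limit_def by (rule SUP_subset_mono) auto

lemma left_limit_le: "mono a \<Longrightarrow> left_limit a t \<le> a t"
  unfolding left_limit_def by (rule SUP_least) (auto simp: mono_def)

lemma left_limit_eq_SUP:
  assumes a: "mono a" and u: "\<And>k. u k < t" "u \<longlonglongrightarrow> t"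
  shows "left_limit a t = (SUP k::nat. a (u k))"
proof (rule antisym)
  show "left_limit a t \<le> (SUP k. a (u k))"
    unfolding left_limit_def
  proof (rule SUP_least)
    fix q assume "q \<in> {q\<in>\<rat>. q < t}"
    then have "\<forall>\<^sub>F k in sequentially. q < u k" using u(2) by (intro order_tendstoD) auto
    then obtain k where "q < u k" unfolding eventually_sequentially by blast
    then have "a q \<le> a (u k)" using a by (simp add: mono_def)
    then show "a q \<le> (SUP k. a (u k))" by (rule SUP_upper2[rotated]) simp
  qed
  show "(SUP k. a (u k)) \<le> left_limit a t"
  proof (rule SUP_least)
    fix k
    obtain q where "q \<in> \<rat>" "u k < q" "q < t" using Rats_dense_in_real[OF u(1)] by blast
    then have "a (u k) \<le> a q" "q \<in> {q\<in>\<rat>. q < t}" using a by (auto simp: mono_def)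
    then show "a (u k) \<le> left_limit a t" unfolding left_limit_def by (intro SUP_upper2[of q])
  qed
qed

lemma rational_sequence_from_below:
  fixes t :: real
  shows "\<exists>u :: nat \<Rightarrow> real. incseq u \<and> (\<forall>k. u k \<in> \<rat> \<and> u k < t) \<and> u \<longlonglongrightarrow> t"
proof -
  have "\<exists>q\<in>\<rat>. t - inverse (Suc k) < q \<and> q < t" for k :: nat
    using Rats_dense_in_real[of "t - inverse (Suc k)" t] by simp
  then obtain q where q: "\<And>k. q k \<in> \<rat>" "\<And>k. t - inverse (Suc k) < q k" "\<And>k. q k < t" by metis
  define u where "u k = Max (q ` {..k})" for k
  have in_q: "u k \<in> q ` {..k}" for k unfolding u_def by (intro Max_in) auto
  have r: "u k \<in> \<rat>" "u k < t" for k using in_q[of k] q by auto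
  have ge: "q k \<le> u k" for k unfolding u_def by (intro Max_ge) auto
  have "u \<longlonglongrightarrow> t"
  proof (rule tendsto_sandwich[of "\<lambda>k. t - inverse (Suc k)" u sequentially "\<lambda>_. t"])
    show "(\<lambda>k. t - inverse (real (Suc k))) \<longlonglongrightarrow> t"
      using tendsto_diff[OF tendsto_const[of t] LIMSEQ_inverse_real_of_nat] by simp
    show "\<forall>\<^sub>F k in sequentially. t - inverse (real (Suc k)) \<le> u k"
      using q(2) ge by (intro always_eventually allI) (meson less_imp_le less_le_trans)
    show "\<forall>\<^sub>F k in sequentially. u k \<le> t"
      using r(2) by (intro always_eventually allI less_imp_le)
  qed simp
  moreover have "incseq u" unfolding u_def by (intro monoI Max_mono) auto
  ultimately show ?thesis using r by blast
qed

lemma left_limit_functional_equation: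
  assumes a: "mono a" and S: "\<And>v. v \<in> S \<Longrightarrow> (0::real) < c v"
    and eq: "\<And>q. q \<in> \<rat> \<Longrightarrow> a q = (\<Sum>v\<in>S. a (q * c v))"
  shows "left_limit a t = (\<Sum>v\<in>S. left_limit a (t * c v))"
proof -
  obtain u :: "nat \<Rightarrow> real" where u: "incseq u" "\<And>k. u k \<in> \<rat>" "\<And>k. u k < t" "u \<longlonglongrightarrow> t"
    using rational_sequence_from_below[of t] by blast
  have "left_limit a t = (SUP k. \<Sum>v\<in>S. a (u k * c v))"
    unfolding left_limit_eq_SUP[OF a u(3,4)] using eq u(2) by simp
  also have "\<dots> = (\<Sum>v\<in>S. SUP k. a (u k * c v))"
  proof (rule ennreal_SUP_sum)
    fix v assume "v \<in> S"
    then show "incseq (\<lambda>k. a (u k * c v))"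
      using S[of v] u(1) a by (auto simp: incseq_def mono_def intro!: mult_right_mono)
  qed
  also have "\<dots> = (\<Sum>v\<in>S. left_limit a (t * c v))"
  proof (intro sum.cong refl left_limit_eq_SUP[OF a, symmetric])
    fix v assume "v \<in> S"
    then show "u k * c v < t * c v" for k using S[of v] u(3)[of k] by simp
    show "(\<lambda>k. u k * c v) \<longlonglongrightarrow> t * c v" by (intro tendsto_mult u(4) tendsto_const)
  qed
  finally show ?thesis .
qed

text \<open>All good points share the same function \<open>b\<close>, whatever their blocks look
  like. Comparing two of them in both directions forces their exponents to coincide.\<close>

lemma (in prob_space) AE_exponent:
  fixes a :: "real \<Rightarrow> ennreal" and S :: "'a \<Rightarrow> 'v set" and c :: "'a \<Rightarrow> 'v \<Rightarrow> real" and m :: real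
  assumes a: "mono a" "0 < a 1" "a 1 < \<infinity>" and m: "0 < m" "m < 1"
    and S: "AE \<omega> in M. finite (S \<omega>) \<and> S \<omega> \<noteq> {} \<and> (\<forall>v\<in>S \<omega>. 0 < c \<omega> v \<and> c \<omega> v \<le> m)"
    and eq: "\<And>t. AE \<omega> in M. a t = (\<Sum>v\<in>S \<omega>. a (t * c \<omega> v))"
  obtains s where "0 \<le> s" "AE \<omega> in M. (\<Sum>v\<in>S \<omega>. c \<omega> v powr s) = 1"
proof -
  define good where "good \<omega> \<longleftrightarrow> finite (S \<omega>) \<and> S \<omega> \<noteq> {} \<and> (\<forall>v\<in>S \<omega>. 0 < c \<omega> v \<and> c \<omega> v \<le> m) \<and>
    (\<forall>q\<in>\<rat>. a q = (\<Sum>v\<in>S \<omega>. a (q * c \<omega> v)))" for \<omega>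
  have "AE \<omega> in M. \<forall>q\<in>\<rat>. a q = (\<Sum>v\<in>S \<omega>. a (q * c \<omega> v))"
    using eq by (subst AE_ball_countable) (auto simp: countable_rat)
  with S have AE_good: "AE \<omega> in M. good \<omega>"
    unfolding good_def by eventually_elim auto
  define b where "b t = enn2real (left_limit a t)" for t
  have fin: "left_limit a t < \<infinity>" if "t \<le> 1" for t
    by (rule le_less_trans[OF order_trans[OF left_limit_le[OF a(1)] monoD[OF a(1) that]] a(3)])
  have b_mono: "b t \<le> b t'" if "t \<le> t'" "t' \<le> 1" for t t'
    unfolding b_def using that fin by (intro enn2real_mono left_limit_mono) auto
  have b_nonneg: "0 \<le> b t" for t by (simp add: b_def)
  have b_eq: "b t = (\<Sum>v\<in>S \<omega>. b (t * c \<omega> v))" if "good \<omega>" "0 < t" "t \<le> 1" for \<omega> t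
  proof -
    have "left_limit a t = (\<Sum>v\<in>S \<omega>. left_limit a (t * c \<omega> v))"
      using that by (intro left_limit_functional_equation a) (auto simp: good_def)
    moreover have "left_limit a (t * c \<omega> v) < \<infinity>" if "v \<in> S \<omega>" for v
      using that \<open>good \<omega>\<close> \<open>t \<le> 1\<close> \<open>0 < t\<close> m by (intro fin mult_le_one) (auto simp: good_def)
    ultimately show ?thesis by (simp add: b_def enn2real_sum)
  qed
  \<comment> \<open>As \<open>a\<close> may jump at 1, positivity of \<open>a 1\<close> does not
    pass to the left limit directly. The functional equation yields a node with
    \<open>0 < a (c \<omega> v)\<close>, and \<open>c \<omega> v \<le> m\<close> stays away from
    1.\<close>
  have b1: "0 < b 1" if "good \<omega>" for \<omega>
  proof -
    have "a 1 = (\<Sum>v\<in>S \<omega>. a (1 * c \<omega> v))"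
      using that Rats_1 unfolding good_def by blast
    have "\<not> (\<forall>v\<in>S \<omega>. a (c \<omega> v) = 0)"
    proof
      assume "\<forall>v\<in>S \<omega>. a (c \<omega> v) = 0"
      with \<open>a 1 = _\<close> have "a 1 = 0" by simp
      with a(2) show False by simp
    qed
    then obtain v where v: "v \<in> S \<omega>" "0 < a (c \<omega> v)" by (auto simp: zero_less_iff_neq_zero)
    obtain q where q: "q \<in> \<rat>" "m < q" "q < 1" using Rats_dense_in_real[OF m(2)] by blast
    have "c \<omega> v \<le> m" using that v(1) by (simp add: good_def)
    then have "a (c \<omega> v) \<le> a q" using q by (intro monoD[OF a(1)]) simp
    also have "\<dots> \<le> left_limit a 1" unfolding left_limit_def using q by (intro SUP_upper) auto
    finally have "0 < left_limit a 1" using v by auto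
    then show ?thesis using fin[of 1] by (simp add: b_def enn2real_positive_iff)
  qed
  have le: "s' \<le> s"
    if "good \<omega>" "0 \<le> s" "(\<Sum>v\<in>S \<omega>. c \<omega> v powr s) = 1" "good \<omega>'" "0 \<le> s'" "(\<Sum>v\<in>S \<omega>'. c \<omega>' v powr s') = 1"
    for \<omega> \<omega>' s s'
  proof -
    have \<gamma>: "0 < Min (c x ` S x)" "Min (c x ` S x) \<le> 1" "\<And>v. v \<in> S x \<Longrightarrow> Min (c x ` S x) \<le> c x v \<and> c x v \<le> m"
      if x: "good x" for x
    proof -
      have "finite (S x)" "S x \<noteq> {}" "\<And>v. v \<in> S x \<Longrightarrow> 0 < c x v \<and> c x v \<le> m" using x by (auto simp: good_def)
      then show "0 < Min (c x ` S x)" "\<And>v. v \<in> S x \<Longrightarrow> Min (c x ` S x) \<le> c x v \<and> c x v \<le> m" by auto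
      moreover from \<open>S x \<noteq> {}\<close> obtain v where "v \<in> S x" by blast
      ultimately show "Min (c x ` S x) \<le> 1" using m by (meson order_trans less_imp_le)
    qed
    show ?thesis
      by (rule functional_equation_exponent_le[where b = b, OF \<gamma>(3)[OF that(1)] \<gamma>(1,2)[OF that(1)] that(2,3)
          \<gamma>(3)[OF that(4)] \<gamma>(1,2)[OF that(4)] that(5,6) m b_mono b_nonneg b_eq[OF that(1)] b_eq[OF that(4)] b1[OF that(1)]])
  qed
  from eventually_happens'[OF ae_filter_bot AE_good] obtain \<omega>0 where \<omega>0: "good \<omega>0" ..
  have exponent: "\<exists>s\<ge>0. (\<Sum>v\<in>S \<omega>. c \<omega> v powr s) = 1" if "good \<omega>" for \<omega>
    using that m by (intro exponent_exists) (auto simp: good_def)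
  from exponent[OF \<omega>0] obtain s where s: "0 \<le> s" "(\<Sum>v\<in>S \<omega>0. c \<omega>0 v powr s) = 1" by blast
  have "AE \<omega> in M. (\<Sum>v\<in>S \<omega>. c \<omega> v powr s) = 1"
    using AE_good
  proof eventually_elim
    case (elim \<omega>)
    from exponent[OF this] obtain s' where s': "0 \<le> s'" "(\<Sum>v\<in>S \<omega>. c \<omega> v powr s') = 1" by blast
    have "s' = s" using le[OF \<omega>0 s elim s'] le[OF elim s' \<omega>0 s] by simp
    with s' show ?case by simp
  qed
  with s(1) show ?thesis by (rule that)
qed

section \<open>Random code trees\<close>

lemma suminf_list_decode:
  fixes F :: "real \<Rightarrow> ennreal"
  assumes "finite A" "F 0 = 0"
  shows "(\<Sum>i. F (if list_decode i \<in> A then g (list_decode i) else 0)) = (\<Sum>v\<in>A. F (g v))"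
proof -
  have "(\<Sum>i. F (if list_decode i \<in> A then g (list_decode i) else 0))
      = (\<Sum>i\<in>list_encode ` A. F (if list_decode i \<in> A then g (list_decode i) else 0))"
  proof (rule suminf_finite)
    fix i assume "i \<notin> list_encode ` A"
    then have "list_decode i \<notin> A" by (metis imageI list_decode_inverse)
    then show "F (if list_decode i \<in> A then g (list_decode i) else 0) = 0" using assms by simp
  qed (use assms in simp)
  also have "\<dots> = (\<Sum>v\<in>A. F (g v))"
    by (subst sum.reindex) (auto intro!: inj_onI dest: arg_cong[where f = list_decode])
  finally show ?thesis .
qed

locale random_code_tree = similarity_tree \<Lambda> n f c \<Delta> c_min c_max N
  for \<Lambda> :: "'l::euclidean_space set" and n and f :: "'l \<Rightarrow> nat \<Rightarrow> 'a::euclidean_space \<Rightarrow> 'a"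
    and c \<Delta> c_min c_max N +
  fixes P :: "((nat list \<Rightarrow> 'l) \<times> (nat \<Rightarrow> nat)) measure"
  assumes code_tree: "code_tree_measure \<Lambda> n P"
begin

definition G :: "((nat list \<Rightarrow> 'l) \<times> (nat \<Rightarrow> nat)) measure" where
  "G = vimage_algebra (space P) (first_block N) borel"

abbreviation T where "T \<equiv> neck_shift N"

definition C :: "(nat list \<Rightarrow> 'l) \<times> (nat \<Rightarrow> nat) \<Rightarrow> nat list \<Rightarrow> real" where
  "C \<omega> v = node_ratio v (fst \<omega>)"

lemma sets_P: "sets P = sets (restrict_space borel (labellings N \<Lambda> \<times> UNIV))"
  and AE_neck: "AE \<omega> in P. neck_list N n (fst \<omega>) (snd \<omega>)"
  and distr_T: "distr P P T = P"
  and integrable_neck: "integrable P (\<lambda>\<omega>. real (snd \<omega> 0))"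
  and prob_P: "prob_space P"
  and indep_P: "prob_space.indep_set P (sets G) (sets (vimage_algebra (space P) T borel))"
  using code_tree unfolding code_tree_measure_def G_def
  by (simp_all add: Let_def split_beta' flip: N_eq)

lemma space_P: "space P = labellings N \<Lambda> \<times> UNIV"
  using sets_eq_imp_space_eq[OF sets_P] by (simp add: space_restrict_space)

lemma N_pos: "1 \<le> N"
proof -
  obtain l where "l \<in> \<Lambda>" using family by (auto simp: similarity_ifs_family_def)
  then show ?thesis using n_ge[of l] n_le[of l] by simp
qed

lemma valid_P: "\<omega> \<in> space P \<Longrightarrow> valid (fst \<omega>)"
  using valid_labellings by (auto simp: space_P)

lemma T_space: "\<omega> \<in> space P \<Longrightarrow> T \<omega> \<in> space P"
proof -
  assume "\<omega> \<in> space P"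
  then have l: "fst \<omega> \<in> labellings N \<Lambda>" by (auto simp: space_P)
  have "replicate (snd \<omega> 0) 1 @ w \<in> tree_nodes N" if "w \<in> tree_nodes N" for w
    using that N_pos by (auto simp: tree_nodes_def level_def)
  then have "subtree N (replicate (snd \<omega> 0) 1) (fst \<omega>) \<in> labellings N \<Lambda>"
    using l by (auto simp: labellings_def subtree_def PiE_iff)
  then show ?thesis by (simp add: neck_shift_def space_P split_beta)
qed

sublocale prob_space P by (rule prob_P)

text \<open>Measurability is contained in the independence assumption, by which both families
  consist of events of \<open>P\<close>.\<close>

lemma T_measurable: "T \<in> P \<rightarrow>\<^sub>M P"
proof (rule measurableI)
  fix A assume "A \<in> sets P"
  then obtain B where B: "B \<in> sets borel" "A = (labellings N \<Lambda> \<times> UNIV) \<inter> B"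
    by (auto simp: sets_P sets_restrict_space)
  have "T -` A \<inter> space P = T -` B \<inter> space P" using T_space by (auto simp: B(2) simp flip: space_P)
  also have "\<dots> \<in> sets (vimage_algebra (space P) T borel)" using B(1) by (rule in_vimage_algebra)
  also have "\<dots> \<subseteq> sets P" by (rule indep_setD_ev2[OF indep_P])
  finally show "T -` A \<inter> space P \<in> sets P" .
qed (rule T_space)

sublocale block_system P G T
proof
  show "T \<in> P \<rightarrow>\<^sub>M P" by (rule T_measurable)
  show "distr P P T = P" by (rule distr_T)
  show "space G = space P" by (simp add: G_def)
  show "sets G \<subseteq> sets P" by (rule indep_setD_ev1[OF indep_P])
  have "sets (vimage_algebra (space P) T P) \<subseteq> sets (vimage_algebra (space P) T borel)"
  proof -
    have "T \<in> vimage_algebra (space P) T borel \<rightarrow>\<^sub>M P"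
    proof (rule measurableI)
      fix A assume "A \<in> sets P"
      then obtain B where B: "B \<in> sets borel" "A = (labellings N \<Lambda> \<times> UNIV) \<inter> B"
        by (auto simp: sets_P sets_restrict_space)
      have "T -` A \<inter> space P = T -` B \<inter> space P" using T_space by (auto simp: B(2) simp flip: space_P)
      also have "\<dots> \<in> sets (vimage_algebra (space P) T borel)" using B(1) by (rule in_vimage_algebra)
      finally show "T -` A \<inter> space (vimage_algebra (space P) T borel) \<in> sets (vimage_algebra (space P) T borel)" by simp
    qed (simp add: T_space)
    then show ?thesis by (intro sets_image_in_sets) simp_all
  qed
  with indep_P show "indep_set (sets G) (sets (vimage_algebra (space P) T P))"
    unfolding indep_sets2_eq by blast
qed

text \<open>The ratio is the distance between the images of 0 and of a unit vector, so it inherits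
  measurability in \<open>l\<close> from the maps.\<close>

lemma borel_measurable_edge: "(\<lambda>l. edge l i) \<in> borel_measurable borel"
proof (cases "1 \<le> i")
  case False
  then have "(\<lambda>l. edge l i) = (\<lambda>_. 0)" by (auto simp: edge_def)
  then show ?thesis by simp
next
  case True
  let ?A = "{l \<in> \<Lambda>. i \<le> n l}"
  have \<Lambda>: "\<Lambda> \<in> sets borel" using family by (auto simp: similarity_ifs_family_def intro: borel_compact)
  have "n \<in> restrict_space borel \<Lambda> \<rightarrow>\<^sub>M count_space UNIV" using family by (simp add: similarity_ifs_family_def)
  from measurable_sets[OF this, of "{i..}"] have "?A \<in> sets (restrict_space borel \<Lambda>)"
    by (auto simp: space_restrict_space vimage_def Int_def conj_commute)
  then have A: "?A \<in> sets borel" using \<Lambda> by (auto simp: sets_restrict_space_iff)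
  obtain b :: 'a where b: "b \<in> Basis" using nonempty_Basis by blast
  have "(\<lambda>l. f l i x) \<in> borel_measurable (restrict_space borel ?A)" for x
    using family True by (simp add: similarity_ifs_family_def)
  then have "(\<lambda>l. dist (f l i 0) (f l i b)) \<in> borel_measurable (restrict_space borel ?A)"
    by (intro borel_measurable_dist)
  then have "(\<lambda>l. indicator ?A l *\<^sub>R dist (f l i 0) (f l i b)) \<in> borel_measurable borel"
    using A by (subst (asm) borel_measurable_restrict_space_iff) auto
  also have "(\<lambda>l. indicator ?A l *\<^sub>R dist (f l i 0) (f l i b)) = (\<lambda>l. edge l i)"
    using True b by (auto simp: fun_eq_iff edge_def indicator_def dist_f norm_Basis)
  finally show ?thesis .
qed

lemma borel_measurable_node_ratio: "(\<lambda>\<tau>. node_ratio v (\<lambda>w. \<tau> (u @ w))) \<in> borel_measurable borel"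
proof (induction v arbitrary: u)
  case (Cons i v)
  have "(\<lambda>\<tau>. edge (\<tau> u) i) \<in> borel_measurable borel"
    by (rule measurable_compose[OF measurable_coord_borel borel_measurable_edge])
  moreover have "(\<lambda>\<tau>. node_ratio v (\<lambda>w. \<tau> ((u @ [i]) @ w))) \<in> borel_measurable borel" by (rule Cons)
  ultimately show ?case by (simp add: borel_measurable_times)
qed simp

lemma node_ratio_measurable: "node_ratio v \<in> borel_measurable borel"
  using borel_measurable_node_ratio[of v "[]"] by simp

lemma fst_borel: "fst \<in> P \<rightarrow>\<^sub>M borel" and snd_borel: "snd \<in> P \<rightarrow>\<^sub>M borel"
proof -
  have "fst \<in> (borel :: ((nat list \<Rightarrow> 'l) \<times> (nat \<Rightarrow> nat)) measure) \<rightarrow>\<^sub>M borel"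
    "snd \<in> (borel :: ((nat list \<Rightarrow> 'l) \<times> (nat \<Rightarrow> nat)) measure) \<rightarrow>\<^sub>M borel"
    by (intro borel_measurable_continuous_onI continuous_on_fst continuous_on_snd continuous_on_id)+
  then show "fst \<in> P \<rightarrow>\<^sub>M borel" "snd \<in> P \<rightarrow>\<^sub>M borel"
    using measurable_restrict_space1 by (simp_all cong: measurable_cong_sets add: sets_P)
qed

lemma C_meas [measurable]: "(\<lambda>\<omega>. C \<omega> v) \<in> borel_measurable P"
  unfolding C_def by (rule measurable_compose[OF fst_borel node_ratio_measurable])

lemma neck_meas: "(\<lambda>\<omega>. snd \<omega> k) \<in> P \<rightarrow>\<^sub>M borel"
  by (rule measurable_compose[OF snd_borel measurable_coord_borel])

section \<open>Factorisation of the ratios at necks and their dependence on the blocks\<close>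

lemma node_ratio_cong_prefix:
  "(\<And>j. j < length v \<Longrightarrow> \<tau> (take j v) = \<tau>' (take j v)) \<Longrightarrow> node_ratio v \<tau> = node_ratio v \<tau>'"
proof (induction v arbitrary: \<tau> \<tau>')
  case (Cons i v)
  have "node_ratio v (\<lambda>w. \<tau> (i # w)) = node_ratio v (\<lambda>w. \<tau>' (i # w))"
  proof (rule Cons.IH)
    fix j assume "j < length v"
    then show "\<tau> (i # take j v) = \<tau>' (i # take j v)" using Cons.prems[of "Suc j"] by simp
  qed
  moreover have "\<tau> [] = \<tau>' []" using Cons.prems[of 0] by simp
  ultimately show ?case by simp
qed simp

lemma node_ratio_cong_tree:
  assumes "\<And>u. u \<in> tree_nodes N \<Longrightarrow> \<tau> u = \<tau>' u"
  shows "node_ratio w \<tau> = node_ratio w \<tau>'"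
  using assms
proof (induction w arbitrary: \<tau> \<tau>')
  case (Cons i w)
  have root: "\<tau> [] = \<tau>' []" using Cons.prems[of "[]"] by (auto simp: tree_nodes_def level_def)
  show ?case
  proof (cases "i \<in> {1..N}")
    case True
    have "node_ratio w (\<lambda>w. \<tau> (i # w)) = node_ratio w (\<lambda>w. \<tau>' (i # w))"
    proof (rule Cons.IH)
      fix u assume "u \<in> tree_nodes N"
      then have "i # u \<in> tree_nodes N" using True by (auto simp: tree_nodes_def level_def)
      then show "\<tau> (i # u) = \<tau>' (i # u)" by (rule Cons.prems)
    qed
    then show ?thesis by (simp add: root)
  next
    case False
    then have "edge (\<tau>' []) i = 0" using n_le[of "\<tau>' []"] by (auto simp: edge_def)
    then show ?thesis by (simp add: root)
  qed
qed simp

lemma node_ratio_replicate: "valid \<tau> \<Longrightarrow> node_ratio (replicate k 1) \<tau> \<noteq> 0"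
proof (induction k arbitrary: \<tau>)
  case (Suc k)
  have "0 < edge (\<tau> []) 1" using n_ge[OF valid_root[OF Suc.prems]] by (intro edge_pos valid_root Suc.prems) auto
  moreover have "node_ratio (replicate k 1) (\<lambda>w. \<tau> (1 # w)) \<noteq> 0"
    using N_pos by (intro Suc.IH valid_child Suc.prems) auto
  ultimately show ?case by simp
qed simp

lemma live_nonempty: "valid \<tau> \<Longrightarrow> live \<tau> k \<noteq> {}"
  using node_ratio_replicate[of \<tau> k] N_pos by (auto simp: live_def level_def intro!: exI[of _ "replicate k 1"])

text \<open>The node \<open>(1, ..., 1)\<close> is alive because every system has a map, so at a
  neck the tree below any live \<open>v\<close> is the one selected by the shift. For dead
  \<open>v\<close> both sides vanish.\<close>

lemma C_neck:
  assumes \<omega>: "\<omega> \<in> space P" and neck: "neck_list N n (fst \<omega>) (snd \<omega>)" and v: "v \<in> level N (snd \<omega> 0)"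
  shows "C \<omega> (v @ w) = C \<omega> v * C (T \<omega>) w"
proof (cases "C \<omega> v = 0")
  case False
  let ?r = "replicate (snd \<omega> 0) 1"
  have alive: "alive_nodes N n (fst \<omega>) (snd \<omega> 0) = live (fst \<omega>) (snd \<omega> 0)"
    by (rule alive_nodes_eq_live[OF valid_P[OF \<omega>]])
  have "v \<in> live (fst \<omega>) (snd \<omega> 0)" using v False by (simp add: live_def C_def)
  moreover have "?r \<in> live (fst \<omega>) (snd \<omega> 0)"
    using node_ratio_replicate[OF valid_P[OF \<omega>]] N_pos by (auto simp: live_def level_def)
  ultimately have "subtree N v (fst \<omega>) = subtree N ?r (fst \<omega>)"
    using neck unfolding neck_list_def alive[symmetric] by blast
  then have "C (T \<omega>) w = node_ratio w (subtree N v (fst \<omega>))"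
    by (simp add: C_def neck_shift_def split_beta)
  also have "\<dots> = node_ratio w (\<lambda>x. fst \<omega> (v @ x))"
    by (rule node_ratio_cong_tree) (simp add: subtree_def)
  finally show ?thesis by (simp add: C_def node_ratio_append)
qed (simp add: C_def node_ratio_append)

text \<open>A neck list may start at level 0. The first neck of the shifted pair is a difference of
  consecutive necks, hence positive, and invariance carries this back.\<close>

lemma AE_neck_pos: "AE \<omega> in P. 0 < snd \<omega> 0"
proof -
  have "AE \<omega> in P. 0 < snd (T \<omega>) 0"
    using AE_neck
  proof eventually_elim
    case (elim \<omega>)
    then have "snd \<omega> 0 < snd \<omega> 1" unfolding neck_list_def strict_mono_def by simp
    then show ?case by (simp add: neck_shift_def split_beta One_nat_def[symmetric])
  qed
  moreover have "{\<omega> \<in> space P. 0 < snd \<omega> 0} \<in> sets P"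
    using measurable_sets[OF neck_meas[of 0], of "{0<..}"] by (simp add: vimage_def Int_def conj_commute)
  ultimately have "AE \<omega> in distr P P T. 0 < snd \<omega> 0"
    by (subst AE_distr_iff[OF T_measurable])
  then show ?thesis unfolding distr_T .
qed

lemma first_block_meas: "first_block N \<in> G \<rightarrow>\<^sub>M borel"
  unfolding G_def by (rule measurable_vimage_algebra1) simp

lemma neck_meas_G: "(\<lambda>\<omega>. snd \<omega> 0) \<in> G \<rightarrow>\<^sub>M borel"
proof -
  have "fst \<in> (borel :: (nat \<times> (nat list \<Rightarrow> 'l)) measure) \<rightarrow>\<^sub>M borel"
    by (intro borel_measurable_continuous_onI continuous_on_fst continuous_on_id)
  from measurable_compose[OF first_block_meas this] show ?thesis
    by (simp add: first_block_def split_beta)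
qed

text \<open>The ratio of \<open>v\<close> reads only the labels at proper prefixes, and these lie in
  the first block once \<open>length v\<close> is at most the first neck level. \<open>R\<close>
  allows for both an equality and an inequality with that level.\<close>

lemma C_block_meas:
  assumes v: "set v \<subseteq> {1..N}" and R: "\<And>k. R k \<Longrightarrow> length v \<le> k"
  shows "(\<lambda>\<omega>. if R (snd \<omega> 0) then C \<omega> v else 0) \<in> borel_measurable G"
proof -
  have "snd \<in> (borel :: (nat \<times> (nat list \<Rightarrow> 'l)) measure) \<rightarrow>\<^sub>M borel"
    by (intro borel_measurable_continuous_onI continuous_on_snd continuous_on_id)
  then have "(\<lambda>\<omega>. node_ratio v (snd (first_block N \<omega>))) \<in> borel_measurable G"
    by (intro measurable_compose[OF first_block_meas] measurable_compose[OF _ node_ratio_measurable])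
  moreover have "{\<omega> \<in> space G. R (snd \<omega> 0)} \<in> sets G"
  proof -
    have "{k. R k} \<in> sets (borel :: nat measure)" by (rule sets.countable) auto
    from measurable_sets[OF neck_meas_G this] show ?thesis
      by (simp add: vimage_def Int_def conj_commute)
  qed
  ultimately have "(\<lambda>\<omega>. if R (snd \<omega> 0) then node_ratio v (snd (first_block N \<omega>)) else 0) \<in> borel_measurable G"
    by (intro measurable_If) auto
  also have "(\<lambda>\<omega>. if R (snd \<omega> 0) then node_ratio v (snd (first_block N \<omega>)) else 0) = (\<lambda>\<omega>. if R (snd \<omega> 0) then C \<omega> v else 0)"
  proof (intro ext if_cong refl)
    fix \<omega> :: "(nat list \<Rightarrow> 'l) \<times> (nat \<Rightarrow> nat)" assume "R (snd \<omega> 0)"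
    then have "length v \<le> snd \<omega> 0" by (rule R)
    then show "node_ratio v (snd (first_block N \<omega>)) = C \<omega> v"
      unfolding C_def first_block_def split_beta snd_conv
      using v by (intro node_ratio_cong_prefix) (force simp: level_def dest: in_set_takeD)
  qed
  finally show ?thesis .
qed

text \<open>Nodes are enumerated by \<open>list_decode\<close>; numbers of nodes off the first neck
  level receive the padding value 0.\<close>

definition block_ratio :: "(nat list \<Rightarrow> 'l) \<times> (nat \<Rightarrow> nat) \<Rightarrow> nat \<Rightarrow> real" where
  "block_ratio \<omega> i = (if list_decode i \<in> level N (snd \<omega> 0) then C \<omega> (list_decode i) else 0)"

lemma block_ratio_meas: "(\<lambda>\<omega>. block_ratio \<omega> i) \<in> borel_measurable G"
proof (cases "set (list_decode i) \<subseteq> {1..N}")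
  case True
  have "(\<lambda>\<omega>. if snd \<omega> 0 = length (list_decode i) then C \<omega> (list_decode i) else 0) \<in> borel_measurable G"
    by (rule C_block_meas[OF True]) simp
  moreover have "(\<lambda>\<omega>. block_ratio \<omega> i) = (\<lambda>\<omega>. if snd \<omega> 0 = length (list_decode i) then C \<omega> (list_decode i) else 0)"
    using True by (auto simp: block_ratio_def level_def fun_eq_iff)
  ultimately show ?thesis by simp
next
  case False
  then have "(\<lambda>\<omega>. block_ratio \<omega> i) = (\<lambda>\<omega>. 0)" by (auto simp: block_ratio_def level_def)
  then show ?thesis by simp
qed

text \<open>A node not beyond the first neck is read off the first block. Otherwise its ratio
  factors at the neck, and the second factor is the ratio of a shorter node for the shifted point.
  The factorisation uses the neck property, hence the equality is only almost sure.\<close>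

lemma C_blocks: "\<exists>g\<in>borel_measurable blocks. AE \<omega> in P. C \<omega> v = g \<omega>"
proof (induction "length v" arbitrary: v rule: less_induct)
  case less
  show ?case
  proof (cases "set v \<subseteq> {1..N}")
    case False
    then have "C \<omega> v = 0" for \<omega> using node_ratio_nonzero_set by (auto simp: C_def)
    then show ?thesis by (intro bexI[of _ "\<lambda>_. 0"]) auto
  next
    case True
    let ?l = "length v"
    have "\<forall>k\<in>{1..<?l}. \<exists>g\<in>borel_measurable blocks. AE \<omega> in P. C \<omega> (drop k v) = g \<omega>"
      using less by auto
    then have "\<exists>g. \<forall>k\<in>{1..<?l}. g k \<in> borel_measurable blocks \<and> (AE \<omega> in P. C \<omega> (drop k v) = g k \<omega>)"
      by (intro bchoice) blast
    then obtain g where g: "\<And>k. k \<in> {1..<?l} \<Longrightarrow> g k \<in> borel_measurable blocks"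
      "\<And>k. k \<in> {1..<?l} \<Longrightarrow> AE \<omega> in P. C \<omega> (drop k v) = g k \<omega>" by blast
    \<comment> \<open>\<open>A\<close> is the case of a first neck at or below the node;
      \<open>B k\<close> is the upper factor when the first neck lies at level
      \<open>k\<close>.\<close>
    define A where "A \<omega> = (if ?l \<le> snd \<omega> 0 then C \<omega> v else 0)" for \<omega> :: "(nat list \<Rightarrow> 'l) \<times> (nat \<Rightarrow> nat)"
    define B where "B k \<omega> = (if snd \<omega> 0 = k then C \<omega> (take k v) else 0)" for k and \<omega> :: "(nat list \<Rightarrow> 'l) \<times> (nat \<Rightarrow> nat)"
    have "A \<in> borel_measurable blocks"
      unfolding A_def by (rule G_blocks_measurable[OF C_block_meas[OF True]])
    moreover have "B k \<in> borel_measurable blocks" for k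
      unfolding B_def using True by (intro G_blocks_measurable[OF C_block_meas]) (auto dest: in_set_takeD)
    moreover have "(\<lambda>\<omega>. g k (T \<omega>)) \<in> borel_measurable blocks" if "k \<in> {1..<?l}" for k
      by (rule measurable_compose[OF T_blocks g(1)[OF that]])
    ultimately have "(\<lambda>\<omega>. A \<omega> + (\<Sum>k\<in>{1..<?l}. B k \<omega> * g k (T \<omega>))) \<in> borel_measurable blocks"
      by (intro borel_measurable_add borel_measurable_sum borel_measurable_times)
    moreover have "AE \<omega> in P. \<forall>k\<in>{1..<?l}. C (T \<omega>) (drop k v) = g k (T \<omega>)"
      using g(2) by (intro AE_finite_allI AE_shift) auto
    then have "AE \<omega> in P. C \<omega> v = A \<omega> + (\<Sum>k\<in>{1..<?l}. B k \<omega> * g k (T \<omega>))"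
      using AE_neck AE_neck_pos AE_space
    proof eventually_elim
      case (elim \<omega>)
      show ?case
      proof (cases "?l \<le> snd \<omega> 0")
        case True
        then have "B k \<omega> = 0" if "k \<in> {1..<?l}" for k using that by (auto simp: B_def)
        with True show ?thesis by (simp add: A_def)
      next
        case False
        then have k: "snd \<omega> 0 \<in> {1..<?l}" using elim by auto
        have "(\<Sum>k\<in>{1..<?l}. B k \<omega> * g k (T \<omega>)) = (\<Sum>k\<in>{1..<?l}. if k = snd \<omega> 0 then C \<omega> (take k v) * g k (T \<omega>) else 0)"
          by (intro sum.cong) (auto simp: B_def)
        also have "\<dots> = C \<omega> (take (snd \<omega> 0) v) * g (snd \<omega> 0) (T \<omega>)" using k by simp
        also have "\<dots> = C \<omega> (take (snd \<omega> 0) v) * C (T \<omega>) (drop (snd \<omega> 0) v)" using elim k by simp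
        also have "\<dots> = C \<omega> (take (snd \<omega> 0) v @ drop (snd \<omega> 0) v)"
          using elim k \<open>set v \<subseteq> {1..N}\<close>
          by (intro C_neck[symmetric]) (auto simp: level_def dest: in_set_takeD)
        finally show ?thesis using False by (simp add: A_def)
      qed
    qed
    ultimately show ?thesis by (intro bexI)
  qed
qed

lemma net_measure_AE_const:
  assumes H: "mono H" "H \<in> borel_measurable borel" "H 0 = 0"
  obtains a where "mono a" "a 0 = 0" "\<And>t. AE \<omega> in P. net_measure H N (\<lambda>w. t * C \<omega> w) = a t"
    "\<And>t. AE \<omega> in P. a t = (\<Sum>v\<in>live (fst \<omega>) (snd \<omega> 0). a (t * C \<omega> v))"
proof -
  define y where "y \<omega> t = net_measure H N (\<lambda>w. t * C \<omega> w)" for \<omega> t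
  have y0: "y \<omega> 0 = 0" for \<omega> unfolding y_def using net_measure_0[where H = H, OF H(3)] by simp
  interpret branching_system P G T y block_ratio
  proof
    have "(\<lambda>p w. snd p * C (fst p) w) \<in> P \<Otimes>\<^sub>M borel \<rightarrow>\<^sub>M borel"
      by (rule measurable_coordinatewise_then_product) measurable
    from measurable_compose[OF this net_measure_measurable[OF H(2)]]
    show "(\<lambda>(\<omega>, t). y \<omega> t) \<in> borel_measurable (P \<Otimes>\<^sub>M borel)"
      by (simp add: y_def split_beta')
    show "(\<lambda>\<omega>. block_ratio \<omega> i) \<in> borel_measurable G" for i by (rule block_ratio_meas)
    show "y \<omega> 0 = 0" for \<omega> by (rule y0)
    show "AE \<omega> in P. y \<omega> t = (\<Sum>i. y (T \<omega>) (t * block_ratio \<omega> i))" for t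
      using AE_neck AE_space
    proof eventually_elim
      case (elim \<omega>)
      have "(\<Sum>i. y (T \<omega>) (t * block_ratio \<omega> i)) = (\<Sum>v\<in>level N (snd \<omega> 0). y (T \<omega>) (t * C \<omega> v))"
        unfolding block_ratio_def by (rule suminf_list_decode) (simp_all add: y0)
      also have "\<dots> = (\<Sum>v\<in>level N (snd \<omega> 0). net_measure H N (\<lambda>w. t * C \<omega> (v @ w)))"
        unfolding y_def using elim by (intro sum.cong refl) (simp add: C_neck mult.assoc)
      also have "\<dots> = y \<omega> t" unfolding y_def by (rule net_measure_level[symmetric])
      finally show ?case ..
    qed
  qed
  have "\<exists>a. AE \<omega> in P. y \<omega> t = a" for t
  proof -
    have "\<exists>g. \<forall>v. g v \<in> borel_measurable blocks \<and> (AE \<omega> in P. C \<omega> v = g v \<omega>)"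
      by (intro choice allI) (use C_blocks in blast)
    then obtain g where g: "\<And>v. g v \<in> borel_measurable blocks" "\<And>v. AE \<omega> in P. C \<omega> v = g v \<omega>"
      by blast
    have "(\<lambda>\<omega> w. t * g w \<omega>) \<in> blocks \<rightarrow>\<^sub>M borel"
      by (intro measurable_coordinatewise_then_product borel_measurable_times borel_measurable_const g)
    from measurable_compose[OF this net_measure_measurable[OF H(2)]]
    show ?thesis
    proof (rule y_AE_const)
      have "AE \<omega> in P. \<forall>v. C \<omega> v = g v \<omega>" unfolding AE_all_countable using g(2) by blast
      then show "AE \<omega> in P. y \<omega> t = net_measure H N (\<lambda>w. t * g w \<omega>)"
        unfolding y_def by eventually_elim simp
    qed
  qed
  then obtain a where a: "\<And>t. AE \<omega> in P. y \<omega> t = a t" by metis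
  have a0: "a 0 = 0" using a[of 0] unfolding y0 by simp
  have "mono a"
  proof (rule monoI)
    fix t t' :: real assume "t \<le> t'"
    then have le: "y \<omega> t \<le> y \<omega> t'" for \<omega>
      unfolding y_def C_def by (intro net_measure_mono H mult_right_mono node_ratio_nonneg)
    have "AE \<omega> in P. a t \<le> a t'" using a[of t] a[of t'] by eventually_elim (metis le)
    then show "a t \<le> a t'" by simp
  qed
  moreover have "AE \<omega> in P. a t = (\<Sum>v\<in>live (fst \<omega>) (snd \<omega> 0). a (t * C \<omega> v))" for t
    using const_functional_equation[OF a, of t]
  proof eventually_elim
    case (elim \<omega>)
    have "(\<Sum>i. a (t * block_ratio \<omega> i)) = (\<Sum>v\<in>level N (snd \<omega> 0). a (t * C \<omega> v))"
      unfolding block_ratio_def by (rule suminf_list_decode) (simp_all add: a0)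
    also have "\<dots> = (\<Sum>v\<in>live (fst \<omega>) (snd \<omega> 0). a (t * C \<omega> v))"
      by (rule sum.mono_neutral_right) (auto simp: live_def C_def a0)
    finally show ?case using elim by simp
  qed
  ultimately show ?thesis using a a0 by (intro that[of a]) (simp_all add: y_def)
qed

end

section \<open>Sublinear growth of the gaps between necks\<close>

context block_system
begin

lemma T_power_meas [measurable]: "(T ^^ k) \<in> P \<rightarrow>\<^sub>M P"
  by (induction k) (auto intro: measurable_compose[OF _ T_meas] simp: comp_def)

lemma distr_T_power: "distr P P (T ^^ k) = P"
proof (induction k)
  case 0
  show ?case using distr_id[of P] by (simp add: id_def)
next
  case (Suc k)
  have "distr P P (T ^^ Suc k) = distr (distr P P (T ^^ k)) P T"
    by (simp add: distr_distr comp_def)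
  also have "\<dots> = P" unfolding Suc by (rule T_inv)
  finally show ?case .
qed

lemma AE_T_power: "(AE \<omega> in P. R \<omega>) \<Longrightarrow> (AE \<omega> in P. R ((T ^^ k) \<omega>))"
  using AE_distrD[OF T_power_meas[of k], of R] unfolding distr_T_power .

text \<open>Borel--Cantelli: by invariance the probabilities of
  \<open>k < X ((T ^^ k) \<omega>)\<close> add up to the expectation of \<open>X\<close>. Applied to
  every multiple of the first neck level, this shows that the gaps are o(k).\<close>

lemma AE_sublinear:
  fixes X :: "'w \<Rightarrow> nat"
  assumes X: "X \<in> P \<rightarrow>\<^sub>M count_space UNIV" and int: "integrable P (\<lambda>\<omega>. real (X \<omega>))"
  shows "AE \<omega> in P. \<forall>\<^sub>F k in sequentially. X ((T ^^ k) \<omega>) \<le> k"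
proof -
  note [measurable] = X
  define A where "A k = {\<omega> \<in> space P. k < X ((T ^^ k) \<omega>)}" for k
  have A [measurable]: "A k \<in> sets P" for k unfolding A_def by measurable
  have eq: "emeasure P (A k) = emeasure P {\<omega> \<in> space P. k < X \<omega>}" for k
  proof -
    have m: "{\<omega> \<in> space P. k < X \<omega>} \<in> sets P" by measurable
    have "emeasure P {\<omega> \<in> space P. k < X \<omega>} = emeasure (distr P P (T ^^ k)) {\<omega> \<in> space P. k < X \<omega>}"
      by (simp add: distr_T_power)
    also have "\<dots> = emeasure P ((T ^^ k) -` {\<omega> \<in> space P. k < X \<omega>} \<inter> space P)"
      by (rule emeasure_distr[OF T_power_meas m])
    also have "(T ^^ k) -` {\<omega> \<in> space P. k < X \<omega>} \<inter> space P = A k"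
      using measurable_space[OF T_power_meas] by (auto simp: A_def)
    finally show ?thesis ..
  qed
  have "(\<Sum>k. ennreal (measure P (A k))) = (\<Sum>k. \<integral>\<^sup>+\<omega>. indicator {\<omega> \<in> space P. k < X \<omega>} \<omega> \<partial>P)"
    by (simp add: eq flip: emeasure_eq_measure)
  also have "\<dots> = (\<integral>\<^sup>+\<omega>. (\<Sum>k. indicator {\<omega> \<in> space P. k < X \<omega>} \<omega>) \<partial>P)"
    by (rule nn_integral_suminf[symmetric]) measurable
  also have "\<dots> = (\<integral>\<^sup>+\<omega>. ennreal (real (X \<omega>)) \<partial>P)"
  proof (rule nn_integral_cong)
    fix \<omega> assume \<omega>: "\<omega> \<in> space P"
    have "(\<Sum>k. indicator {\<omega> \<in> space P. k < X \<omega>} \<omega>) = (\<Sum>k\<in>{..<X \<omega>}. (indicator {\<omega> \<in> space P. k < X \<omega>} \<omega> :: ennreal))"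
      by (rule suminf_finite) auto
    also have "\<dots> = (\<Sum>k\<in>{..<X \<omega>}. 1)" using \<omega> by (intro sum.cong) auto
    finally show "(\<Sum>k. indicator {\<omega> \<in> space P. k < X \<omega>} \<omega>) = ennreal (real (X \<omega>))"
      by (simp add: ennreal_of_nat_eq_real_of_nat)
  qed
  also have "\<dots> \<noteq> top" using int by (subst nn_integral_eq_integral) auto
  finally have "summable (\<lambda>k. measure P (A k))" by (intro summable_suminf_not_top) auto
  then have "AE \<omega> in P. \<forall>\<^sub>F k in sequentially. \<omega> \<in> space P - A k"
    by (intro borel_cantelli_AE1) (auto simp: emeasure_eq_measure)
  then show ?thesis
    by eventually_elim (auto simp: A_def elim!: eventually_mono)
qed

end

section \<open>Dimension of the attractor when all blocks have the same exponent\<close>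

context random_code_tree
begin

text \<open>The level of the \<open>k\<close>-th neck as a sum of gaps, the root being counted as
  neck number 0.\<close>

definition neck_level :: "(nat list \<Rightarrow> 'l) \<times> (nat \<Rightarrow> nat) \<Rightarrow> nat \<Rightarrow> nat" where
  "neck_level \<omega> k = (\<Sum>j<k. snd ((T ^^ j) \<omega>) 0)"

definition regular :: "real \<Rightarrow> (nat list \<Rightarrow> 'l) \<times> (nat \<Rightarrow> nat) \<Rightarrow> bool" where
  "regular s \<omega> \<longleftrightarrow> \<omega> \<in> space P \<and> neck_list N n (fst \<omega>) (snd \<omega>) \<and> 0 < snd \<omega> 0 \<and>
    (\<Sum>v\<in>live (fst \<omega>) (snd \<omega> 0). C \<omega> v powr s) = 1"

context
  fixes s :: real and \<omega> :: "(nat list \<Rightarrow> 'l) \<times> (nat \<Rightarrow> nat)"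
  assumes s: "0 \<le> s" and regular: "\<And>k. regular s ((T ^^ k) \<omega>)"
begin

lemma space_\<omega>: "\<omega> \<in> space P"
  using regular[of 0] by (simp add: regular_def)

lemma block_sum: "(\<Sum>v\<in>level N (snd ((T ^^ k) \<omega>) 0). C ((T ^^ k) \<omega>) v powr s) = 1"
proof -
  let ?\<omega> = "(T ^^ k) \<omega>"
  have "(\<Sum>v\<in>level N (snd ?\<omega> 0). C ?\<omega> v powr s) = (\<Sum>v\<in>live (fst ?\<omega>) (snd ?\<omega> 0). C ?\<omega> v powr s)"
    by (rule sum.mono_neutral_right) (auto simp: live_def C_def)
  then show ?thesis using regular[of k] by (simp add: regular_def)
qed

lemma neck_level_0 [simp]: "neck_level \<omega> 0 = 0"
  and neck_level_Suc: "neck_level \<omega> (Suc k) = neck_level \<omega> k + snd ((T ^^ k) \<omega>) 0"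
  by (simp_all add: neck_level_def)

lemma neck_level_less: "neck_level \<omega> k < neck_level \<omega> (Suc k)"
  using regular[of k] by (simp add: neck_level_Suc regular_def)

lemma strict_mono_neck_level: "strict_mono (neck_level \<omega>)"
  by (rule strict_monoI_Suc) (rule neck_level_less)

lemma neck_level_ge: "k \<le> neck_level \<omega> k"
  by (rule strict_mono_imp_increasing[OF strict_mono_neck_level])

lemma C_neck_level: "v \<in> level N (neck_level \<omega> k) \<Longrightarrow> C \<omega> (v @ w) = C \<omega> v * C ((T ^^ k) \<omega>) w"
proof (induction k arbitrary: v w)
  case 0
  then show ?case by (simp add: C_def)
next
  case (Suc k)
  define u where "u = take (neck_level \<omega> k) v"
  define x where "x = drop (neck_level \<omega> k) v"
  have v: "v = u @ x" by (simp add: u_def x_def)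
  have u: "u \<in> level N (neck_level \<omega> k)" and x: "x \<in> level N (snd ((T ^^ k) \<omega>) 0)"
    using Suc.prems by (auto simp: u_def x_def level_def neck_level_Suc dest: in_set_takeD in_set_dropD)
  have "C ((T ^^ k) \<omega>) (x @ w) = C ((T ^^ k) \<omega>) x * C (T ((T ^^ k) \<omega>)) w"
    using regular[of k] by (intro C_neck x) (auto simp: regular_def)
  then show ?case using Suc.IH[OF u, of "x @ w"] Suc.IH[OF u, of x] by (simp add: v)
qed

text \<open>Once the \<open>k\<close>-th neck level has reached \<open>length v\<close>, the value
  no longer depends on \<open>k\<close>, since every block has sum 1. It is then the mass of
  \<open>v\<close> under the natural mass distribution on the tree.\<close>

definition tail_sum :: "nat \<Rightarrow> nat list \<Rightarrow> real" where
  "tail_sum k v = (\<Sum>w\<in>level N (neck_level \<omega> k - length v). C \<omega> (v @ w) powr s)"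

lemma tail_sum_Suc:
  assumes v: "length v \<le> neck_level \<omega> k"
  shows "tail_sum (Suc k) v = tail_sum k v"
proof -
  have "neck_level \<omega> (Suc k) - length v = (neck_level \<omega> k - length v) + snd ((T ^^ k) \<omega>) 0"
    using v by (simp add: neck_level_Suc)
  then have "tail_sum (Suc k) v = (\<Sum>u\<in>level N (neck_level \<omega> k - length v).
      \<Sum>w\<in>level N (snd ((T ^^ k) \<omega>) 0). C \<omega> ((v @ u) @ w) powr s)"
    by (simp add: tail_sum_def sum_level_add)
  also have "\<dots> = (\<Sum>u\<in>level N (neck_level \<omega> k - length v). C \<omega> (v @ u) powr s)"
  proof (rule sum.cong[OF refl])
    fix u assume u: "u \<in> level N (neck_level \<omega> k - length v)"
    show "(\<Sum>w\<in>level N (snd ((T ^^ k) \<omega>) 0). C \<omega> ((v @ u) @ w) powr s) = C \<omega> (v @ u) powr s"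
    proof (cases "set v \<subseteq> {1..N}")
      case True
      then have "v @ u \<in> level N (neck_level \<omega> k)" using u v by (auto simp: level_def)
      then have "(\<Sum>w\<in>level N (snd ((T ^^ k) \<omega>) 0). C \<omega> ((v @ u) @ w) powr s)
        = (\<Sum>w\<in>level N (snd ((T ^^ k) \<omega>) 0). C \<omega> (v @ u) powr s * C ((T ^^ k) \<omega>) w powr s)"
        by (intro sum.cong refl) (simp only: C_neck_level, simp add: powr_mult C_def node_ratio_nonneg)
      then show ?thesis by (simp add: block_sum flip: sum_distrib_left)
    next
      case False
      then have "C \<omega> (v @ x) = 0" for x
        using node_ratio_nonzero_set[of "v @ x" "fst \<omega>"] by (auto simp: C_def)
      then show ?thesis by simp
    qed
  qed
  finally show ?thesis by (simp add: tail_sum_def)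
qed

lemma tail_sum_mono:
  assumes "length v \<le> neck_level \<omega> k" "k \<le> k'"
  shows "tail_sum k' v = tail_sum k v"
  using assms(2)
proof (induction rule: dec_induct)
  case (step j)
  have "length v \<le> neck_level \<omega> j"
    using assms(1) strict_mono_mono[OF strict_mono_neck_level] step(1) by (meson monoD order_trans)
  then show ?case using tail_sum_Suc step by simp
qed simp

lemma tail_sum_children:
  assumes "length v < neck_level \<omega> k"
  shows "tail_sum k v = (\<Sum>i\<in>{1..N}. tail_sum k (v @ [i]))"
proof -
  have "neck_level \<omega> k - length v = Suc (neck_level \<omega> k - length (v @ [i]))" for i :: nat
    using assms by simp
  then show ?thesis by (simp add: tail_sum_def sum_level_Suc)
qed

lemma tail_sum_root: "tail_sum k [] = 1"
  using tail_sum_mono[of "[]" 0 k] by (simp add: tail_sum_def C_def)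

text \<open>A cut at the \<open>j\<close>-th neck level costs at most
  \<open>D powr t * q ^ j\<close>: the \<open>s\<close>-th powers there sum to 1, and each surplus
  factor \<open>C \<omega> v powr (t - s)\<close> is at most \<open>q ^ j\<close>.\<close>

lemma net_measure_eq_0:
  assumes t: "s < t" and D: "0 < D"
  shows "net_measure (gauge_cost (\<lambda>r. r powr t) D) N (C \<omega>) = 0"
proof -
  let ?H = "gauge_cost (\<lambda>r. r powr t) D"
  define q where "q = c_max powr (t - s)"
  have q: "0 < q" "q < 1" using t c_max c_max_pos powr_less_mono2[of "t - s" c_max 1] by (auto simp: q_def)
  have bound: "(\<Sum>v\<in>level N (neck_level \<omega> j). ?H (C \<omega> v)) \<le> ennreal (D powr t * q ^ j)" for j
  proof -
    have "?H (C \<omega> v) \<le> ennreal (D powr t * q ^ j * C \<omega> v powr s)" if v: "v \<in> level N (neck_level \<omega> j)" for v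
    proof (cases "0 < C \<omega> v")
      case True
      have "C \<omega> v \<le> c_max ^ length v" unfolding C_def by (rule node_ratio_le)
      also have "\<dots> \<le> c_max ^ j"
        using v neck_level_ge[of j] c_max c_max_pos by (intro power_decreasing) (auto simp: level_def)
      finally have "C \<omega> v powr (t - s) \<le> (c_max ^ j) powr (t - s)"
        using True t by (intro powr_mono2) auto
      also have "\<dots> = q ^ j" using c_max_pos by (simp add: q_def powr_powr powr_realpow[symmetric] mult.commute)
      finally have *: "C \<omega> v powr (t - s) \<le> q ^ j" .
      have "(D * C \<omega> v) powr t = D powr t * (C \<omega> v powr (t - s) * C \<omega> v powr s)"
        using True D by (simp add: powr_mult flip: powr_add)
      also have "\<dots> \<le> D powr t * (q ^ j * C \<omega> v powr s)"
        using * by (intro mult_left_mono mult_right_mono) auto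
      finally show ?thesis using True by (simp add: gauge_cost_def mult.assoc ennreal_leI)
    qed (simp add: gauge_cost_def)
    then have "(\<Sum>v\<in>level N (neck_level \<omega> j). ?H (C \<omega> v))
      \<le> (\<Sum>v\<in>level N (neck_level \<omega> j). ennreal (D powr t * q ^ j * C \<omega> v powr s))" by (rule sum_mono)
    also have "\<dots> = ennreal (\<Sum>v\<in>level N (neck_level \<omega> j). D powr t * q ^ j * C \<omega> v powr s)"
      using q by (intro sum_ennreal) simp
    also have "(\<Sum>v\<in>level N (neck_level \<omega> j). D powr t * q ^ j * C \<omega> v powr s) = D powr t * q ^ j * tail_sum j []"
      by (simp add: tail_sum_def flip: sum_distrib_left)
    finally show ?thesis by (simp add: tail_sum_root)
  qed
  have "(INF m. cut_value ?H N k m (C \<omega>)) \<le> 0" for k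
  proof (rule tendsto_lowerbound)
    show "(\<lambda>j. ennreal (D powr t * q ^ j)) \<longlonglongrightarrow> 0"
      using tendsto_ennrealI[OF tendsto_mult[OF tendsto_const LIMSEQ_power_zero], of q "D powr t"] q by simp
    show "\<forall>\<^sub>F j in sequentially. (INF m. cut_value ?H N k m (C \<omega>)) \<le> ennreal (D powr t * q ^ j)"
      using eventually_ge_at_top[of k]
    proof eventually_elim
      case (elim j)
      then have j: "k + (neck_level \<omega> j - k) = neck_level \<omega> j" using neck_level_ge[of j] by simp
      have "(INF m. cut_value ?H N k m (C \<omega>)) \<le> cut_value ?H N k (neck_level \<omega> j - k) (C \<omega>)"
        by (rule INF_lower) simp
      also have "\<dots> \<le> (\<Sum>v\<in>level N (neck_level \<omega> j). ?H (C \<omega> v))"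
        using cut_value_le_level[of ?H N k "neck_level \<omega> j - k" "C \<omega>"] by (simp only: j)
      also note bound[of j]
      finally show ?case .
    qed
  qed simp
  then show ?thesis by (auto simp: net_measure_def)
qed

text \<open>Mass distribution principle for \<open>tail_sum\<close>. The mass of \<open>v\<close> is
  at most \<open>C \<omega> v powr s\<close> times the number of nodes down to the next neck, which
  is at most \<open>N\<close> to the power of the gap. As gaps are sublinear, the surplus
  \<open>C \<omega> v powr (s - t)\<close>, exponentially small in the neck index, absorbs this
  factor.\<close>

lemma net_measure_pos:
  assumes t: "t < s" and D: "0 < D"
    and gap: "\<And>i::nat. \<forall>\<^sub>F k in sequentially. Suc i * snd ((T ^^ k) \<omega>) 0 \<le> k"
  shows "0 < net_measure (gauge_cost (\<lambda>r. r powr t) D) N (C \<omega>)"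
proof -
  let ?H = "gauge_cost (\<lambda>r. r powr t) D"
  let ?L = "\<lambda>k. snd ((T ^^ k) \<omega>) 0"
  define q where "q = c_max powr (s - t)"
  have q: "0 < q" "q < 1" using t c_max c_max_pos powr_less_mono2[of "s - t" c_max 1] by (auto simp: q_def)
  have N0: "0 < real N" "1 \<le> real N" using N_pos by auto
  \<comment> \<open>With \<open>i\<close> such that \<open>N * q ^ Suc i \<le> 1\<close>, the
    product is at most 1 as soon as \<open>Suc i\<close> times the gap is at most \<open>k\<close>.
    The finitely many remaining indices are added to the bound.\<close>
  obtain B where B: "\<And>k. real N ^ ?L k * q ^ k \<le> B" "0 < B"
  proof -
    have "(\<lambda>i. q ^ Suc i) \<longlonglongrightarrow> 0" using q by (intro LIMSEQ_Suc LIMSEQ_power_zero) simp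
    then have "\<forall>\<^sub>F i in sequentially. q ^ Suc i < 1 / real N" using N0 by (intro order_tendstoD) auto
    then obtain i where i: "real N * q ^ Suc i \<le> 1"
      unfolding eventually_sequentially using N0 by (auto simp: field_simps intro: less_imp_le)
    have "\<forall>\<^sub>F k in sequentially. real N ^ ?L k * q ^ k \<le> 1"
      using gap[of i]
    proof eventually_elim
      case (elim k)
      have "real N ^ ?L k * q ^ k \<le> real N ^ ?L k * q ^ (Suc i * ?L k)"
        using elim q N0 by (intro mult_left_mono power_decreasing) auto
      also have "\<dots> = (real N * q ^ Suc i) ^ ?L k" by (simp only: power_mult power_mult_distrib)
      also have "\<dots> \<le> 1" using i q N0 by (intro power_le_one) auto
      finally show ?case .
    qed
    then obtain k0 where k0: "\<And>k. k \<ge> k0 \<Longrightarrow> real N ^ ?L k * q ^ k \<le> 1"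
      unfolding eventually_sequentially by blast
    define B where "B = 1 + (\<Sum>k<k0. real N ^ ?L k * q ^ k)"
    have nn: "0 \<le> (\<Sum>k<k0. real N ^ ?L k * q ^ k)" using q by (intro sum_nonneg) auto
    have "real N ^ ?L k * q ^ k \<le> B" for k
    proof (cases "k < k0")
      case True
      then have "real N ^ ?L k * q ^ k \<le> (\<Sum>k<k0. real N ^ ?L k * q ^ k)"
        using q by (intro member_le_sum) auto
      then show ?thesis by (simp add: B_def)
    next
      case False
      then show ?thesis using k0[of k] nn by (simp add: B_def)
    qed
    then show ?thesis using nn by (intro that[of B]) (auto simp: B_def)
  qed
  define \<epsilon> where "\<epsilon> = D powr t / B"
  have \<epsilon>: "0 < \<epsilon>" using B D by (simp add: \<epsilon>_def)
  \<comment> \<open>\<open>K v\<close> numbers the last neck at or above \<open>v\<close>. The next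
    neck lies strictly below \<open>v\<close>, so \<open>tail_sum\<close> is already stable there
    both for \<open>v\<close> and for its children.\<close>
  define K where "K v = (LEAST k. length v < neck_level \<omega> (Suc k))" for v :: "nat list"
  have ex: "\<exists>k. length v < neck_level \<omega> (Suc k)" for v :: "nat list"
    using neck_level_ge[of "Suc (length v)"] by (intro exI[of _ "length v"]) simp
  have K1: "length v < neck_level \<omega> (Suc (K v))" for v
    unfolding K_def using ex[of v] by (rule LeastI_ex)
  have K2: "neck_level \<omega> (K v) \<le> length v" for v
  proof (cases "K v")
    case (Suc k)
    then have "\<not> length v < neck_level \<omega> (Suc k)" unfolding K_def by (intro not_less_Least) simp
    then show ?thesis by (simp add: Suc)
  qed simp
  define g where "g v = ennreal (\<epsilon> * tail_sum (Suc (K v)) v)" for v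
  have "g [] \<le> cut_value ?H N 0 m (\<lambda>w. C \<omega> ([] @ w))" for m
  proof (rule cut_value_ge)
    fix v
    show "g v \<le> ?H (C \<omega> v)"
    proof (cases "C \<omega> v = 0")
      case True
      then have "C \<omega> (v @ w) = 0" for w by (simp add: C_def node_ratio_append)
      then show ?thesis by (simp add: g_def tail_sum_def)
    next
      case False
      then have pos: "0 < C \<omega> v" using node_ratio_nonneg[of v "fst \<omega>"] by (simp add: C_def)
      let ?gap = "neck_level \<omega> (Suc (K v)) - length v"
      have gap: "?gap \<le> ?L (K v)" using K2[of v] by (simp add: neck_level_Suc)
      have "tail_sum (Suc (K v)) v \<le> (\<Sum>w\<in>level N ?gap. C \<omega> v powr s)"
        unfolding tail_sum_def
      proof (rule sum_mono)
        fix w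
        have "C \<omega> (v @ w) \<le> C \<omega> v"
          using mult_left_le[OF node_ratio_le_1 node_ratio_nonneg] by (simp add: C_def node_ratio_append)
        then show "C \<omega> (v @ w) powr s \<le> C \<omega> v powr s"
          using s by (intro powr_mono2) (auto simp: C_def node_ratio_nonneg)
      qed
      also have "\<dots> = real N ^ ?gap * C \<omega> v powr s" by (simp add: card_level)
      also have "\<dots> \<le> real N ^ ?L (K v) * C \<omega> v powr s"
        using gap N0 by (intro mult_right_mono power_increasing) auto
      also have "C \<omega> v powr s = C \<omega> v powr (s - t) * C \<omega> v powr t" by (simp flip: powr_add)
      also have "C \<omega> v powr (s - t) \<le> q ^ K v"
      proof -
        have "C \<omega> v \<le> c_max ^ length v" unfolding C_def by (rule node_ratio_le)
        also have "\<dots> \<le> c_max ^ K v"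
          using K2[of v] neck_level_ge[of "K v"] c_max c_max_pos by (intro power_decreasing) auto
        finally have "C \<omega> v powr (s - t) \<le> (c_max ^ K v) powr (s - t)"
          using pos t by (intro powr_mono2) auto
        also have "\<dots> = q ^ K v" using c_max_pos by (simp add: q_def powr_powr powr_realpow[symmetric] mult.commute)
        finally show ?thesis .
      qed
      finally have "tail_sum (Suc (K v)) v \<le> real N ^ ?L (K v) * (q ^ K v * C \<omega> v powr t)"
        by (simp add: mult_left_mono mult_right_mono)
      also have "\<dots> \<le> B * C \<omega> v powr t"
        using B(1)[of "K v"] by (simp add: mult.assoc[symmetric] mult_right_mono)
      finally have "\<epsilon> * tail_sum (Suc (K v)) v \<le> \<epsilon> * (B * C \<omega> v powr t)"
        using \<epsilon> by (intro mult_left_mono) auto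
      also have "\<dots> = (D * C \<omega> v) powr t" using B D pos by (simp add: \<epsilon>_def powr_mult)
      finally show ?thesis using pos by (simp add: g_def gauge_cost_def ennreal_leI)
    qed
    have "tail_sum (Suc (K v)) v = (\<Sum>i\<in>{1..N}. tail_sum (Suc (K v)) (v @ [i]))"
      by (rule tail_sum_children[OF K1])
    also have "\<dots> = (\<Sum>i\<in>{1..N}. tail_sum (Suc (K (v @ [i]))) (v @ [i]))"
    proof (rule sum.cong[OF refl])
      fix i
      have "K v \<le> K (v @ [i])"
        unfolding K_def[of v] using K1[of "v @ [i]"] by (intro Least_le) simp
      moreover have "length (v @ [i]) \<le> neck_level \<omega> (Suc (K v))" using K1[of v] by simp
      ultimately show "tail_sum (Suc (K v)) (v @ [i]) = tail_sum (Suc (K (v @ [i]))) (v @ [i])"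
        by (intro tail_sum_mono[symmetric]) auto
    qed
    finally have "\<epsilon> * tail_sum (Suc (K v)) v = (\<Sum>i\<in>{1..N}. \<epsilon> * tail_sum (Suc (K (v @ [i]))) (v @ [i]))"
      by (simp add: sum_distrib_left)
    then show "g v \<le> (\<Sum>i\<in>{1..N}. g (v @ [i]))"
      unfolding g_def using \<epsilon> by (subst sum_ennreal) (auto simp: tail_sum_def intro!: mult_nonneg_nonneg sum_nonneg)
  qed
  then have "g [] \<le> (INF m. cut_value ?H N 0 m (C \<omega>))" by (intro INF_greatest) simp
  also have "\<dots> \<le> net_measure ?H N (C \<omega>)" unfolding net_measure_def by (rule SUP_upper) simp
  finally have "g [] \<le> net_measure ?H N (C \<omega>)" .
  moreover have "0 < g []" using \<epsilon> by (simp add: g_def tail_sum_root)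
  ultimately show ?thesis by (rule less_le_trans[rotated])
qed

text \<open>The measure vanishes at all exponents above \<open>s\<close> and at no positive exponent
  below \<open>s\<close>. For \<open>s = 0\<close> the infimum over positive exponents is still
  \<open>s\<close>.\<close>

lemma hausdorff_dim_attractor:
  assumes \<Delta>: "\<Delta> \<noteq> {}"
    and gap: "\<And>i::nat. \<forall>\<^sub>F k in sequentially. Suc i * snd ((T ^^ k) \<omega>) 0 \<le> k"
  shows "hausdorff_dim (attractor N n f \<Delta> (fst \<omega>)) = s"
proof -
  \<comment> \<open>Adding 1 keeps \<open>D\<close> positive when \<Delta> is a single
    point.\<close>
  define D where "D = diameter \<Delta> + 1"
  have D: "0 < D" "diameter \<Delta> \<le> D"
    using diameter_ge_0[OF compact_imp_bounded[OF compact_Delta]] by (auto simp: D_def)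
  have v: "valid (fst \<omega>)" by (rule valid_P[OF space_\<omega>])
  have C: "C \<omega> = (\<lambda>w. node_ratio w (fst \<omega>))" by (simp add: C_def fun_eq_iff)
  show ?thesis unfolding hausdorff_dim_def
  proof (rule cInf_eq)
    fix t assume "t \<in> {t. 0 < t \<and> hausdorff_measure (\<lambda>r. r powr t) (attractor N n f \<Delta> (fst \<omega>)) = 0}"
    then have t: "0 < t" "hausdorff_measure (\<lambda>r. r powr t) (attractor N n f \<Delta> (fst \<omega>)) = 0" by auto
    show "s \<le> t"
    proof (rule net_measure_le_hausdorff[OF D(1) \<Delta>])
      fix K :: nat
      assume K: "\<And>h \<tau>. gauge_function h \<Longrightarrow>
        net_measure (gauge_cost h D) N (\<lambda>w. node_ratio w \<tau>) \<le> of_nat K * hausdorff_measure h (\<Inter>k\<in>{1..}. cylinders k \<tau>)"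
      have "net_measure (gauge_cost (\<lambda>r. r powr t) D) N (C \<omega>) \<le> 0"
        using K[OF gauge_function_powr[OF t(1)], of "fst \<omega>"] t(2) by (simp add: C attractor_eq[OF v])
      then show "s \<le> t" using net_measure_pos[OF _ D(1) gap, of t] by (meson leD not_le)
    qed
  next
    fix y assume y: "\<And>t. t \<in> {t. 0 < t \<and> hausdorff_measure (\<lambda>r. r powr t) (attractor N n f \<Delta> (fst \<omega>)) = 0} \<Longrightarrow> y \<le> t"
    have "y \<le> t" if t: "s < t" for t
    proof (rule y)
      have "0 < t" using s t by simp
      moreover have "hausdorff_measure (\<lambda>r. r powr t) (attractor N n f \<Delta> (fst \<omega>)) \<le> 0"
        using hausdorff_measure_le_net[OF gauge_function_powr[OF \<open>0 < t\<close>] D(2) _ v] net_measure_eq_0[OF t D(1)] D(1)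
        by (simp add: C)
      ultimately show "t \<in> {t. 0 < t \<and> hausdorff_measure (\<lambda>r. r powr t) (attractor N n f \<Delta> (fst \<omega>)) = 0}" by simp
    qed
    then show "y \<le> s" by (rule dense_ge)
  qed
qed

end

lemma almost_deterministic_if_exponent:
  assumes s: "0 \<le> s" and AE: "AE \<omega> in P. (\<Sum>v\<in>live (fst \<omega>) (snd \<omega> 0). C \<omega> v powr s) = 1"
    and \<Delta>: "\<Delta> \<noteq> {}"
  shows "almost_deterministic \<Lambda> n f c \<Delta> P"
proof -
  have "AE \<omega> in P. regular s \<omega>"
    using AE AE_neck AE_neck_pos AE_space by eventually_elim (simp add: regular_def)
  then have "AE \<omega> in P. \<forall>k. regular s ((T ^^ k) \<omega>)"
    unfolding AE_all_countable by (intro allI AE_T_power)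
  moreover have "AE \<omega> in P. \<forall>i::nat. \<forall>\<^sub>F k in sequentially. Suc i * snd ((T ^^ k) \<omega>) 0 \<le> k"
    unfolding AE_all_countable
  proof
    fix i :: nat
    have "(\<lambda>\<omega>. snd \<omega> 0) \<in> P \<rightarrow>\<^sub>M count_space UNIV"
    proof (rule measurableI)
      fix A :: "nat set"
      have "A \<in> sets borel" by (rule sets.countable) auto
      then show "(\<lambda>\<omega>. snd \<omega> 0) -` A \<inter> space P \<in> sets P" by (rule measurable_sets[OF neck_meas])
    qed simp
    then have "(\<lambda>\<omega>. Suc i * snd \<omega> 0) \<in> P \<rightarrow>\<^sub>M count_space UNIV" by measurable
    moreover have "integrable P (\<lambda>\<omega>. real (Suc i * snd \<omega> 0))"
      using integrable_neck by (simp only: of_nat_mult) (rule integrable_mult_right)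
    ultimately show "AE \<omega> in P. \<forall>\<^sub>F k in sequentially. Suc i * snd ((T ^^ k) \<omega>) 0 \<le> k"
      by (rule AE_sublinear)
  qed
  ultimately have "AE \<omega> in P. hausdorff_dim (attractor N n f \<Delta> (fst \<omega>)) = s"
    by eventually_elim (rule hausdorff_dim_attractor[OF s _ \<Delta>]; simp)
  moreover have "AE \<omega> in P. (\<Sum>v\<in>alive_nodes N n (fst \<omega>) (snd \<omega> 0). word_ratio c (coding (fst \<omega>) v) powr s) = 1"
    using AE AE_space
  proof eventually_elim
    case (elim \<omega>)
    have "(\<Sum>v\<in>alive_nodes N n (fst \<omega>) (snd \<omega> 0). word_ratio c (coding (fst \<omega>) v) powr s)
      = (\<Sum>v\<in>live (fst \<omega>) (snd \<omega> 0). C \<omega> v powr s)"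
      unfolding alive_nodes_eq_live[OF valid_P[OF elim(2)]]
      by (intro sum.cong refl) (simp add: live_def word_ratio_coding C_def)
    with elim show ?case by simp
  qed
  ultimately show ?thesis
    unfolding almost_deterministic_def Let_def split_beta' N_eq[symmetric] by blast
qed

lemma hausdorff_measure_zero_infinity:
  assumes not_det: "\<not> almost_deterministic \<Lambda> n f c \<Delta> P" and h: "gauge_function h"
  shows "AE \<omega> in P. hausdorff_measure h (attractor N n f \<Delta> (fst \<omega>)) \<in> {0, \<infinity>}"
proof (cases "\<Delta> = {}")
  \<comment> \<open>The lower bound by the net measure uses a point of \<Delta>, so empty \<Delta>
    is treated apart: its attractor is empty and has measure 0.\<close>
  case True
  have "hausdorff_measure h ({} :: 'a set) \<le> 0"
    unfolding hausdorff_measure_eq_SUP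
  proof (rule SUP_least)
    fix \<delta> :: real assume "\<delta> \<in> {0<..}"
    then show "hausdorff_premeasure h \<delta> ({} :: 'a set) \<le> 0"
      using hausdorff_premeasure_empty[of \<delta> h] gauge_function_0[OF h] by simp
  qed
  then show ?thesis by (simp add: True attractor_def)
next
  case \<Delta>: False
  define D where "D = diameter \<Delta> + 1"
  have D: "0 < D" "diameter \<Delta> \<le> D"
    using diameter_ge_0[OF compact_imp_bounded[OF compact_Delta]] by (auto simp: D_def)
  let ?H = "gauge_cost h D"
  have H: "mono ?H" "?H \<in> borel_measurable borel" "?H 0 = 0"
    using D h by (auto intro: mono_gauge_cost measurable_gauge_cost)
  show ?thesis
  proof (rule net_measure_AE_const[OF H])
    fix a assume a: "mono a" "a 0 = 0" "\<And>t. AE \<omega> in P. net_measure ?H N (\<lambda>w. t * C \<omega> w) = a t"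
      "\<And>t. AE \<omega> in P. a t = (\<Sum>v\<in>live (fst \<omega>) (snd \<omega> 0). a (t * C \<omega> v))"
    have net: "AE \<omega> in P. net_measure ?H N (\<lambda>w. node_ratio w (fst \<omega>)) = a 1"
      using a(3)[of 1] by (simp add: C_def)
    consider "a 1 = 0" | "a 1 = \<infinity>" | "0 < a 1" "a 1 < \<infinity>"
      by (cases "a 1 = 0"; cases "a 1 = \<infinity>") (auto simp: zero_less_iff_neq_zero less_top)
    then show ?thesis
    proof cases
      case 1
      from net AE_space show ?thesis
      proof eventually_elim
        case (elim \<omega>)
        then show ?case using hausdorff_measure_le_net[OF h D(2) _ valid_P[OF elim(2)]] D(1) 1 by simp
      qed
    next
      case 2
      show ?thesis
      proof (rule net_measure_le_hausdorff[OF D(1) \<Delta>])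
        fix K :: nat
        assume K: "\<And>h \<tau>. gauge_function h \<Longrightarrow>
          net_measure (gauge_cost h D) N (\<lambda>w. node_ratio w \<tau>) \<le> of_nat K * hausdorff_measure h (\<Inter>k\<in>{1..}. cylinders k \<tau>)"
        from net AE_space show ?thesis
        proof eventually_elim
          case (elim \<omega>)
          then have "of_nat K * hausdorff_measure h (attractor N n f \<Delta> (fst \<omega>)) = \<infinity>"
            using K[OF h, of "fst \<omega>"] 2 by (simp add: attractor_eq[OF valid_P] top_unique)
          then show ?case by (auto simp: ennreal_mult_eq_top_iff)
        qed
      qed
    next
      case 3
      have "AE \<omega> in P. finite (live (fst \<omega>) (snd \<omega> 0)) \<and> live (fst \<omega>) (snd \<omega> 0) \<noteq> {} \<and>
          (\<forall>v\<in>live (fst \<omega>) (snd \<omega> 0). 0 < C \<omega> v \<and> C \<omega> v \<le> c_max)"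
        using AE_neck_pos AE_space
      proof eventually_elim
        case (elim \<omega>)
        have "0 < C \<omega> v \<and> C \<omega> v \<le> c_max" if v: "v \<in> live (fst \<omega>) (snd \<omega> 0)" for v
        proof
          show "0 < C \<omega> v" using v node_ratio_nonneg[of v "fst \<omega>"] by (simp add: live_def C_def)
          have "C \<omega> v \<le> c_max ^ length v" unfolding C_def by (rule node_ratio_le)
          also have "\<dots> \<le> c_max ^ 1"
            using v elim c_max c_max_pos by (intro power_decreasing) (auto simp: live_def level_def)
          finally show "C \<omega> v \<le> c_max" by simp
        qed
        then show ?case using live_nonempty[OF valid_P[OF elim(2)]] by simp
      qed
      from AE_exponent[OF a(1) 3 c_max_pos c_max this a(4)] obtain s
        where "0 \<le> s" "AE \<omega> in P. (\<Sum>v\<in>live (fst \<omega>) (snd \<omega> 0). C \<omega> v powr s) = 1" .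
      then have "almost_deterministic \<Lambda> n f c \<Delta> P" by (rule almost_deterministic_if_exponent[OF _ _ \<Delta>])
      with not_det show ?thesis ..
    qed
  qed
qed

end

theorem theorem4p5:
  fixes \<Lambda> :: "'l::euclidean_space set"
    and n :: "'l \<Rightarrow> nat"
    and f :: "'l \<Rightarrow> nat \<Rightarrow> 'a::euclidean_space \<Rightarrow> 'a"
    and c :: "'l \<Rightarrow> nat \<Rightarrow> real"
    and \<Delta> :: "'a set"
    and c_min c_max :: real
    and P :: "((nat list \<Rightarrow> 'l) \<times> (nat \<Rightarrow> nat)) measure"
  assumes "similarity_ifs_family \<Lambda> n f c \<Delta>"
    and "uniform_open_set_condition \<Lambda> n f"
    and "bdd_above (n ` \<Lambda>)" and "2 \<le> max_maps \<Lambda> n"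
    and "0 < c_min" and "c_max < 1"
    and "\<And>l i. l \<in> \<Lambda> \<Longrightarrow> i \<in> {1..n l} \<Longrightarrow> c_min \<le> c l i \<and> c l i \<le> c_max"
    and "code_tree_measure \<Lambda> n P"
    and "\<not> almost_deterministic \<Lambda> n f c \<Delta> P"
  shows "(\<forall>h. gauge_function h \<longrightarrow>
            (AE (\<tau>, M) in P. hausdorff_measure h (attractor (max_maps \<Lambda> n) n f \<Delta> \<tau>) \<in> {0, \<infinity>})) \<and>
         \<not> (\<exists>h. gauge_function h \<and>
            (AE (\<tau>, M) in P. 0 < hausdorff_measure h (attractor (max_maps \<Lambda> n) n f \<Delta> \<tau>) \<and>
                             hausdorff_measure h (attractor (max_maps \<Lambda> n) n f \<Delta> \<tau>) < \<infinity>))"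
proof -
  interpret random_code_tree \<Lambda> n f c \<Delta> c_min c_max "max_maps \<Lambda> n" P
    by unfold_locales (use assms in auto)
  have zi: "AE \<omega> in P. hausdorff_measure h (attractor (max_maps \<Lambda> n) n f \<Delta> (fst \<omega>)) \<in> {0, \<infinity>}"
    if "gauge_function h" for h
    using assms(9) that by (rule hausdorff_measure_zero_infinity)
  have False
    if "gauge_function h" and pos: "AE \<omega> in P. 0 < hausdorff_measure h (attractor (max_maps \<Lambda> n) n f \<Delta> (fst \<omega>)) \<and>
      hausdorff_measure h (attractor (max_maps \<Lambda> n) n f \<Delta> (fst \<omega>)) < \<infinity>" for h
  proof -
    have "AE \<omega> in P. False" using zi[OF that(1)] pos by eventually_elim auto
    then show False by simp
  qed
  with zi show ?thesis unfolding split_beta' by blast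
qed

end
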